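(* Let $\phi$ be the automorphism of the free group $F_3=\langle a,b,c\rangle$ given by $\phi(a)=b$, $\phi(b)=c$, $\phi(c)=ab$, and let $\Gamma=F_3\rtimes_\phi\mathbb{Z}=\langle a,b,c,t\mid tat^{-1}=b,\ tbt^{-1}=c,\ tct^{-1}=ab\rangle$, which is isomorphic to $\langle a,t\mid t^3at^{-2}a^{-1}t^{-1}a^{-1}\rangle$. Then $\Gamma$ is word hyperbolic and large, even though $\phi^k$ is irreducible for every $k\ge 1$.
   Context: A group is large if it has a finite index subgroup admitting a surjective homomorphism onto a non-abelian free group. An automorphism $\alpha$ of $F_n$ is reducible if there exist proper non-trivial free factors $R_1,\dots,R_k$ of $F_n$ (forming a free factor system) whose conjugacy classes are permuted transitively by $\alpha$; otherwise it is irreducible. *)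

theory Defs
  imports "HOL-Algebra.Algebra"
begin

text \<open>A letter (x, False) stands for the generator x, (x, True) for its inverse.\<close>
type_synonym 'a fword = "('a \<times> bool) list"

fun fg_reduced :: "'a fword \<Rightarrow> bool" where
  "fg_reduced [] = True"
| "fg_reduced [x] = True"
| "fg_reduced (x # y # xs) = (\<not> (fst x = fst y \<and> snd x \<noteq> snd y) \<and> fg_reduced (y # xs))"

definition fg_cons :: "('a \<times> bool) \<Rightarrow> 'a fword \<Rightarrow> 'a fword" where
  "fg_cons x w = (case w of [] \<Rightarrow> [x]
     | y # ys \<Rightarrow> (if fst x = fst y \<and> snd x \<noteq> snd y then ys else x # y # ys))"

definition fg_norm :: "'a fword \<Rightarrow> 'a fword" where
  "fg_norm w = foldr fg_cons w []"

definition fg_inv :: "'a fword \<Rightarrow> 'a fword" where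
  "fg_inv w = rev (map (\<lambda>(x, s). (x, \<not> s)) w)"

definition free_group :: "'a set \<Rightarrow> 'a fword monoid" where
  "free_group Y = \<lparr> carrier = {w. fg_reduced w \<and> fst ` set w \<subseteq> Y},
                    monoid.mult = (\<lambda>u v. fg_norm (u @ v)),
                    monoid.one = [] \<rparr>"

definition fg_lift :: "('a \<Rightarrow> 'b fword) \<Rightarrow> 'a fword \<Rightarrow> 'b fword" where
  "fg_lift f w = fg_norm (concat (map (\<lambda>(x, s). if s then fg_inv (f x) else f x) w))"

definition normal_closure :: "('g, 'm) monoid_scheme \<Rightarrow> 'g set \<Rightarrow> 'g set" where
  "normal_closure G R = generate G {g \<otimes>\<^bsub>G\<^esub> r \<otimes>\<^bsub>G\<^esub> inv\<^bsub>G\<^esub> g | g r. g \<in> carrier G \<and> r \<in> R}"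

definition presented_group :: "'a set \<Rightarrow> 'a fword set \<Rightarrow> 'a fword set monoid" where
  "presented_group Y R = free_group Y Mod normal_closure (free_group Y) R"

definition word_length :: "('g, 'm) monoid_scheme \<Rightarrow> 'g set \<Rightarrow> 'g \<Rightarrow> nat" where
  "word_length G S g = (LEAST n. \<exists>ws. length ws = n \<and> set ws \<subseteq> S \<union> (\<lambda>s. inv\<^bsub>G\<^esub> s) ` S
                                  \<and> foldr (\<lambda>a b. a \<otimes>\<^bsub>G\<^esub> b) ws \<one>\<^bsub>G\<^esub> = g)"

definition word_dist :: "('g, 'm) monoid_scheme \<Rightarrow> 'g set \<Rightarrow> 'g \<Rightarrow> 'g \<Rightarrow> nat" where
  "word_dist G S g h = word_length G S (inv\<^bsub>G\<^esub> g \<otimes>\<^bsub>G\<^esub> h)"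

definition gromov_product :: "('g, 'm) monoid_scheme \<Rightarrow> 'g set \<Rightarrow> 'g \<Rightarrow> 'g \<Rightarrow> 'g \<Rightarrow> real" where
  "gromov_product G S w x y =
     (real (word_dist G S w x) + real (word_dist G S w y) - real (word_dist G S x y)) / 2"

definition word_hyperbolic :: "('g, 'm) monoid_scheme \<Rightarrow> bool" where
  "word_hyperbolic G \<longleftrightarrow> group G \<and> (\<exists>S. finite S \<and> S \<subseteq> carrier G \<and> generate G S = carrier G \<and>
     (\<exists>\<delta>::real. \<forall>x\<in>carrier G. \<forall>y\<in>carrier G. \<forall>z\<in>carrier G. \<forall>w\<in>carrier G.
        gromov_product G S w x y \<ge> min (gromov_product G S w x z) (gromov_product G S w y z) - \<delta>))"

text \<open>A finite index subgroup surjects onto a non-abelian free group (free of rank at least 2;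
  countable rank suffices since all groups considered are countable).\<close>
definition large :: "('g, 'm) monoid_scheme \<Rightarrow> bool" where
  "large G \<longleftrightarrow> (\<exists>H. subgroup H G \<and> finite (rcosets\<^bsub>G\<^esub> H) \<and>
     (\<exists>Y::nat set. (\<exists>x\<in>Y. \<exists>y\<in>Y. x \<noteq> y) \<and>
        (\<exists>f. f \<in> hom (G\<lparr>carrier := H\<rparr>) (free_group Y) \<and> f ` H = carrier (free_group Y))))"

definition free_product_decomp :: "('g, 'm) monoid_scheme \<Rightarrow> 'g set list \<Rightarrow> bool" where
  "free_product_decomp G As \<longleftrightarrow>
     (\<forall>A\<in>set As. subgroup A G) \<and> generate G (\<Union>(set As)) = carrier G \<and>
     (\<forall>ps :: (nat \<times> 'g) list. ps \<noteq> [] \<longrightarrow>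
        (\<forall>p\<in>set ps. fst p < length As \<and> snd p \<in> As ! fst p \<and> snd p \<noteq> \<one>\<^bsub>G\<^esub>) \<longrightarrow>
        (\<forall>j. Suc j < length ps \<longrightarrow> fst (ps ! j) \<noteq> fst (ps ! Suc j)) \<longrightarrow>
        foldr (\<lambda>p acc. snd p \<otimes>\<^bsub>G\<^esub> acc) ps \<one>\<^bsub>G\<^esub> \<noteq> \<one>\<^bsub>G\<^esub>)"

definition free_factor :: "('g, 'm) monoid_scheme \<Rightarrow> 'g set \<Rightarrow> bool" where
  "free_factor G A \<longleftrightarrow> (\<exists>B. free_product_decomp G [A, B])"

definition sg_conj :: "('g, 'm) monoid_scheme \<Rightarrow> 'g \<Rightarrow> 'g set \<Rightarrow> 'g set" where
  "sg_conj G g A = (\<lambda>h. g \<otimes>\<^bsub>G\<^esub> h \<otimes>\<^bsub>G\<^esub> inv\<^bsub>G\<^esub> g) ` A"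

definition conjugate_subgroups :: "('g, 'm) monoid_scheme \<Rightarrow> 'g set \<Rightarrow> 'g set \<Rightarrow> bool" where
  "conjugate_subgroups G A B \<longleftrightarrow> (\<exists>g\<in>carrier G. B = sg_conj G g A)"

text \<open>The conjugacy classes [R_1],...,[R_k] form a free factor system:
  G = g_1 R_1 g_1^-1 * ... * g_k R_k g_k^-1 * B for suitable g_i and B.\<close>
definition free_factor_system :: "('g, 'm) monoid_scheme \<Rightarrow> 'g set list \<Rightarrow> bool" where
  "free_factor_system G Rs \<longleftrightarrow> (\<exists>gs B. length gs = length Rs \<and> set gs \<subseteq> carrier G \<and>
      free_product_decomp G (map2 (sg_conj G) gs Rs @ [B]))"

definition proper_free_factor :: "('g, 'm) monoid_scheme \<Rightarrow> 'g set \<Rightarrow> bool" where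
  "proper_free_factor G A \<longleftrightarrow> free_factor G A \<and> A \<noteq> carrier G \<and> A \<noteq> {\<one>\<^bsub>G\<^esub>}"

definition reducible_aut :: "('g, 'm) monoid_scheme \<Rightarrow> ('g \<Rightarrow> 'g) \<Rightarrow> bool" where
  "reducible_aut G \<alpha> \<longleftrightarrow> (\<exists>Rs. Rs \<noteq> [] \<and> (\<forall>R\<in>set Rs. proper_free_factor G R) \<and>
      free_factor_system G Rs \<and>
      (\<forall>i<length Rs. \<exists>j<length Rs. conjugate_subgroups G (\<alpha> ` (Rs ! i)) (Rs ! j)) \<and>
      (\<forall>i<length Rs. \<forall>j<length Rs. \<exists>m. conjugate_subgroups G ((\<alpha> ^^ m) ` (Rs ! i)) (Rs ! j)))"

definition irreducible_aut :: "('g, 'm) monoid_scheme \<Rightarrow> ('g \<Rightarrow> 'g) \<Rightarrow> bool" where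
  "irreducible_aut G \<alpha> \<longleftrightarrow> \<not> reducible_aut G \<alpha>"

text \<open>F_3 = <a,b,c> with a = 0, b = 1, c = 2.\<close>
definition F3 :: "nat fword monoid" where
  "F3 = free_group {0, 1, 2}"

definition phi :: "nat fword \<Rightarrow> nat fword" where
  "phi = fg_lift (\<lambda>x. if x = 0 then [(1, False)] else if x = 1 then [(2, False)]
                      else [(0, False), (1, False)])"

text \<open>Gamma = <a,b,c,t | t a t^-1 = b, t b t^-1 = c, t c t^-1 = ab>, with t = 3;
  relators t a t^-1 b^-1, t b t^-1 c^-1, t c t^-1 b^-1 a^-1.\<close>
definition Gamma :: "nat fword set monoid" where
  "Gamma = presented_group {0, 1, 2, 3}
     { [(3, False), (0, False), (3, True), (1, True)],
       [(3, False), (1, False), (3, True), (2, True)],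
       [(3, False), (2, False), (3, True), (1, True), (0, True)] }"

end

theory Submission
  imports Defs
begin

text \<open>
  \<^emph>\<open>Hyperbolicity.\<close> A weighted count of two-letter subwords is invariant under inversion and
  grows under \<open>phi\<close> by at least the length of the word, up to a constant. Cut a van Kampen diagram of \<open>Gamma\<close> along
  its corridors, with a pairing of the letters \<open>t\<close> and \<open>t\<inverse>\<close> chosen minimal: each piece is a
  polygon in the tree of \<open>F\<^sub>3\<close> in which two sides of the same kind (both tops or both bottoms of
  corridors) cancel only boundedly, so the weights of the tops and those of the bottoms nearly agree
  and the total corridor length, hence the area, is linear in the boundary length. A linear isoperimetric inequality makes geodesic triangles thin: a
  filling of a loop through a geodesic which stays away from the remaining sides near some point
  grows exponentially around that point.

  \<^emph>\<open>Largeness.\<close> An explicit action of \<open>Gamma\<close> on 112 copies of the free group of rank 2 commutes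
  with right multiplication; the stabilizer of a copy maps onto that free group.

  \<^emph>\<open>Irreducibility.\<close> The abelianization of \<open>F\<^sub>3\<close> is \<open>\<int>[\<theta>]\<close> with \<open>\<theta>\<^sup>3 = \<theta> + 1\<close>, and \<open>phi\<close> acts as
  multiplication by \<open>\<theta>\<close>. A free factor in an orbit permuted by \<open>phi ^^ k\<close> has as its image a
  subgroup invariant under some \<open>\<theta> ^ n\<close> with \<open>n \<ge> 1\<close>. The image is not zero, because a non-trivial
  retract of a free group is not contained in the commutator subgroup, hence it has rank 3, leaving
  no room for a complementary factor.
\<close>

section \<open>Free groups and presentations\<close>

text \<open>Length does not measure growth here: \<open>phi\<close> sends a to b and a c^-1 to a^-1,
  so the top of a corridor can be shorter than its bottom. The count \<open>turn_sum\<close> repairs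
  this because it is additive up to a bounded error at each junction; it may be negative, so only
  differences between tops and bottoms are used. A segment that cancels between a top and a bottom
  enters twice with opposite signs and drops out. Between two tops or two bottoms the two copies
  would add up. This is where minimality enters: for t a t^-1 B t b t^-1, pairing the outer letters
  with each other and the inner ones with each other would save twice the common segment. Fillings
  are homological: a closed walk is an integer 1-cycle, written as a sum of short cycles. Replacing
  part of a filling is then addition of chains, and this takes the place of planar diagrams in the
  passage to hyperbolicity. A free factor is given by a normal form condition and not by a basis.
  The retraction coming from the universal property carries all the information: on the factor
  itself it feeds the Magnus argument, on the complement it kills the factor.\<close>

lemma fg_reduced_Cons:
  "fg_reduced (x # w) \<longleftrightarrow> (w = [] \<or> \<not> (fst x = fst (hd w) \<and> snd x \<noteq> snd (hd w))) \<and> fg_reduced w"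
  by (cases w) auto

lemma fg_reduced_tl: "fg_reduced (x # w) \<Longrightarrow> fg_reduced w"
  by (simp add: fg_reduced_Cons)

lemma fg_reduced_append:
  "fg_reduced (u @ v) \<longleftrightarrow> fg_reduced u \<and> fg_reduced v \<and>
     (u = [] \<or> v = [] \<or> \<not> (fst (last u) = fst (hd v) \<and> snd (last u) \<noteq> snd (hd v)))"
  by (induction u) (auto simp: fg_reduced_Cons)

lemma fg_cons_reduced: "fg_reduced w \<Longrightarrow> fg_reduced (fg_cons x w)"
  by (cases w) (auto simp: fg_cons_def fg_reduced_Cons)

lemma fg_cons_eq_Cons: "fg_reduced (x # w) \<Longrightarrow> fg_cons x w = x # w"
  by (cases w) (auto simp: fg_cons_def)

lemma fg_norm_Nil [simp]: "fg_norm [] = []"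
  by (simp add: fg_norm_def)

lemma fg_norm_Cons: "fg_norm (x # w) = fg_cons x (fg_norm w)"
  by (simp add: fg_norm_def)

lemma fg_norm_reduced [simp]: "fg_reduced (fg_norm w)"
  by (induction w) (simp_all add: fg_norm_Cons fg_cons_reduced)

lemma fg_norm_id: "fg_reduced w \<Longrightarrow> fg_norm w = w"
  by (induction w) (simp_all add: fg_norm_Cons fg_cons_eq_Cons fg_reduced_tl)

lemma fg_cons_cancel:
  "fg_reduced w \<Longrightarrow> fst x = fst y \<Longrightarrow> snd x \<noteq> snd y \<Longrightarrow> fg_cons x (fg_cons y w) = w"
  by (cases w; cases x; cases y) (auto simp: fg_cons_def split: list.splits)

lemma foldr_fg_cons_reduced: "fg_reduced w \<Longrightarrow> fg_reduced (foldr fg_cons u w)"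
  by (induction u) (simp_all add: fg_cons_reduced)

lemma foldr_fg_cons_cons:
  assumes "fg_reduced w"
  shows "foldr fg_cons (fg_cons x u) w = fg_cons x (foldr fg_cons u w)"
proof (cases u)
  case (Cons y ys)
  have "fg_reduced (foldr fg_cons ys w)" by (rule foldr_fg_cons_reduced[OF assms])
  then show ?thesis
    using fg_cons_cancel[of "foldr fg_cons ys w" x y] by (auto simp: Cons fg_cons_def[of x "y # ys"])
qed (simp add: fg_cons_def[of x "[]"])

text \<open>Van der Waerden's argument: letters act on reduced words through \<open>fg_cons\<close>,
  and inverse letters act inversely, so the action of a word depends only on its reduced form.
  Confluence of free reduction and associativity follow from this.\<close>

lemma foldr_fg_cons_norm:
  "fg_reduced w \<Longrightarrow> foldr fg_cons (fg_norm u) w = foldr fg_cons u w"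
  by (induction u) (simp_all add: fg_norm_Cons foldr_fg_cons_cons)

lemma fg_norm_append_left [simp]: "fg_norm (fg_norm u @ v) = fg_norm (u @ v)"
  using foldr_fg_cons_norm[OF fg_norm_reduced, of u v] by (simp add: fg_norm_def)

lemma fg_norm_append_right [simp]: "fg_norm (u @ fg_norm v) = fg_norm (u @ v)"
  using fg_norm_id[OF fg_norm_reduced, of v] by (simp add: fg_norm_def)

lemma fg_inv_Nil [simp]: "fg_inv [] = []"
  by (simp add: fg_inv_def)

lemma fg_inv_append: "fg_inv (u @ v) = fg_inv v @ fg_inv u"
  by (simp add: fg_inv_def)

lemma fg_inv_Cons: "fg_inv (x # w) = fg_inv w @ [(fst x, \<not> snd x)]"
  by (cases x) (simp add: fg_inv_def)

lemma fg_inv_inv [simp]: "fg_inv (fg_inv w) = w"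
  by (induction w) (simp_all add: fg_inv_Cons fg_inv_append)

lemma length_fg_inv [simp]: "length (fg_inv w) = length w"
  by (simp add: fg_inv_def)

lemma fg_inv_eq_Nil [simp]: "fg_inv w = [] \<longleftrightarrow> w = []"
  by (simp add: fg_inv_def)

lemma fst_set_fg_inv [simp]: "fst ` set (fg_inv w) = fst ` set w"
  by (force simp: fg_inv_def image_image split: prod.splits)

lemma last_fg_inv: "w \<noteq> [] \<Longrightarrow> last (fg_inv w) = (fst (hd w), \<not> snd (hd w))"
  by (simp add: fg_inv_def last_rev hd_map case_prod_beta)

lemma fg_reduced_inv [simp]: "fg_reduced (fg_inv w) = fg_reduced w"
proof -
  have "fg_reduced w \<Longrightarrow> fg_reduced (fg_inv w)" for w :: "'a fword"
  proof (induction w)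
    case (Cons x w)
    then show ?case
      by (cases "w = []") (auto simp: fg_inv_Cons fg_reduced_append last_fg_inv fg_reduced_Cons)
  qed simp
  then show ?thesis by (metis fg_inv_inv)
qed

lemma fg_norm_inv_append [simp]: "fg_norm (fg_inv w @ w) = []"
proof (induction w)
  case (Cons x w)
  have "fg_norm ((fst x, \<not> snd x) # x # w) = fg_norm w"
    by (simp add: fg_norm_Cons fg_cons_cancel)
  then have "fg_norm (fg_inv (x # w) @ x # w) = fg_norm (fg_inv w @ fg_norm w)"
    by (metis append.assoc append_Cons append_Nil fg_inv_Cons fg_norm_append_right)
  then show ?case using Cons by simp
qed simp

lemma fg_norm_append_inv [simp]: "fg_norm (w @ fg_inv w) = []"
  using fg_norm_inv_append[of "fg_inv w"] by simp

lemma set_fg_cons: "set (fg_cons x w) \<subseteq> insert x (set w)"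
  by (cases w) (auto simp: fg_cons_def)

lemma set_fg_norm: "set (fg_norm w) \<subseteq> set w"
proof (induction w)
  case (Cons x w) then show ?case using set_fg_cons[of x "fg_norm w"] by (auto simp: fg_norm_Cons)
qed simp

lemma free_group_sel:
  "carrier (free_group Y) = {w. fg_reduced w \<and> fst ` set w \<subseteq> Y}"
  "monoid.mult (free_group Y) u v = fg_norm (u @ v)"
  "monoid.one (free_group Y) = []"
  by (simp_all add: free_group_def)

lemma free_group_group: "group (free_group Y)"
proof (rule groupI)
  fix x y assume "x \<in> carrier (free_group Y)" "y \<in> carrier (free_group Y)"
  then show "x \<otimes>\<^bsub>free_group Y\<^esub> y \<in> carrier (free_group Y)"
    using set_fg_norm[of "x @ y"] by (fastforce simp: free_group_sel)
next
  fix x assume "x \<in> carrier (free_group Y)"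
  then show "\<exists>y\<in>carrier (free_group Y). y \<otimes>\<^bsub>free_group Y\<^esub> x = \<one>\<^bsub>free_group Y\<^esub>"
    by (intro bexI[of _ "fg_inv x"]) (auto simp: free_group_sel)
qed (auto simp: free_group_sel fg_norm_id)

lemma free_group_inv:
  "w \<in> carrier (free_group Y) \<Longrightarrow> inv\<^bsub>free_group Y\<^esub> w = fg_inv w"
  by (rule group.inv_equality[OF free_group_group]) (auto simp: free_group_sel)

lemma fg_norm_eq_Nil_iff:
  assumes "fg_reduced u" "fg_reduced v" "fg_norm (fg_inv u @ v) = []"
  shows "u = v"
  by (metis append_Nil append_Nil2 append_assoc assms fg_norm_append_inv fg_norm_append_left
      fg_norm_append_right fg_norm_id)

lemma fg_norm_fg_inv: "fg_norm (fg_inv w) = fg_inv (fg_norm w)"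
proof -
  have "fg_norm (fg_inv (fg_inv (fg_norm w)) @ fg_norm (fg_inv w)) = []"
    by simp
  then show ?thesis by (metis fg_norm_eq_Nil_iff fg_norm_reduced fg_reduced_inv)
qed

section \<open>Evaluation of words in a group and normal closures\<close>

fun word_eval :: "('g, 'm) monoid_scheme \<Rightarrow> ('a \<Rightarrow> 'g) \<Rightarrow> 'a fword \<Rightarrow> 'g" where
  "word_eval G f [] = \<one>\<^bsub>G\<^esub>"
| "word_eval G f (x # w) = (if snd x then inv\<^bsub>G\<^esub> (f (fst x)) else f (fst x)) \<otimes>\<^bsub>G\<^esub> word_eval G f w"

context group begin

lemma word_eval_closed:
  "(\<And>x. x \<in> fst ` set w \<Longrightarrow> f x \<in> carrier G) \<Longrightarrow> word_eval G f w \<in> carrier G"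
  by (induction w) auto

lemma word_eval_append:
  assumes "\<And>x. x \<in> fst ` set u \<Longrightarrow> f x \<in> carrier G" "\<And>x. x \<in> fst ` set v \<Longrightarrow> f x \<in> carrier G"
  shows "word_eval G f (u @ v) = word_eval G f u \<otimes> word_eval G f v"
  using assms by (induction u) (auto simp: word_eval_closed m_assoc)

lemma word_eval_norm:
  assumes "\<And>x. x \<in> fst ` set w \<Longrightarrow> f x \<in> carrier G"
  shows "word_eval G f (fg_norm w) = word_eval G f w"
  using assms
proof (induction w)
  case (Cons x w)
  have f: "f y \<in> carrier G" if "y \<in> fst ` set (fg_norm w)" for y
    using that Cons.prems set_fg_norm[of w] by auto
  have "word_eval G f (fg_cons x (fg_norm w)) = word_eval G f (x # fg_norm w)"
  proof (cases "fg_norm w")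
    case (Cons y ys)
    have "word_eval G f ys \<in> carrier G" by (rule word_eval_closed) (use f Cons in auto)
    moreover have "f (fst y) \<in> carrier G" using f Cons by simp
    ultimately have e: "f (fst y) \<otimes> (inv f (fst y) \<otimes> word_eval G f ys) = word_eval G f ys"
      "inv f (fst y) \<otimes> (f (fst y) \<otimes> word_eval G f ys) = word_eval G f ys"
      by (simp_all add: m_assoc[symmetric])
    show ?thesis
      by (cases "snd x"; cases "snd y") (auto simp: Cons fg_cons_def e)
  qed (simp add: fg_cons_def)
  then show ?case using Cons by (simp add: fg_norm_Cons)
qed simp

lemma word_eval_hom:
  assumes "\<And>x. x \<in> Y \<Longrightarrow> f x \<in> carrier G"
  shows "word_eval G f \<in> hom (free_group Y) G"
proof (rule homI)
  fix u assume "u \<in> carrier (free_group Y)"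
  then show "word_eval G f u \<in> carrier G"
    using assms by (auto simp: free_group_sel intro!: word_eval_closed)
next
  fix u v assume uv: "u \<in> carrier (free_group Y)" "v \<in> carrier (free_group Y)"
  then have f: "x \<in> fst ` set u \<Longrightarrow> f x \<in> carrier G" "x \<in> fst ` set v \<Longrightarrow> f x \<in> carrier G" for x
    using assms by (auto simp: free_group_sel)
  then show "word_eval G f (u \<otimes>\<^bsub>free_group Y\<^esub> v) = word_eval G f u \<otimes> word_eval G f v"
    by (subst free_group_sel, subst word_eval_norm) (auto intro!: word_eval_append)
qed

lemma normal_closure_normal:
  assumes "R \<subseteq> carrier G" shows "normal_closure G R \<lhd> G"
  unfolding normal_closure_def
proof (rule normal_generateI)
  show "{g \<otimes> r \<otimes> inv g |g r. g \<in> carrier G \<and> r \<in> R} \<subseteq> carrier G" using assms by auto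
  fix h g assume "h \<in> {g \<otimes> r \<otimes> inv g |g r. g \<in> carrier G \<and> r \<in> R}" and g: "g \<in> carrier G"
  then obtain k r where k: "k \<in> carrier G" "r \<in> R" "h = k \<otimes> r \<otimes> inv k" by auto
  then have "g \<otimes> h \<otimes> inv g = (g \<otimes> k) \<otimes> r \<otimes> inv (g \<otimes> k)"
    using g assms by (simp add: m_assoc inv_mult_group subset_iff)
  then show "g \<otimes> h \<otimes> inv g \<in> {g \<otimes> r \<otimes> inv g |g r. g \<in> carrier G \<and> r \<in> R}"
    using k g by blast
qed

lemma normal_closure_contains: "r \<in> R \<Longrightarrow> R \<subseteq> carrier G \<Longrightarrow> r \<in> normal_closure G R"
  unfolding normal_closure_def
  by (rule generate.incl, rule CollectI, rule exI[of _ \<one>], rule exI[of _ r]) auto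

lemma normal_closure_least:
  assumes "N \<lhd> G" "R \<subseteq> N" shows "normal_closure G R \<subseteq> N"
proof -
  interpret N: normal N G by fact
  show ?thesis unfolding normal_closure_def
    by (rule generate_subgroup_incl) (use assms N.inv_op_closed2 N.subgroup_axioms in auto)
qed

end

section \<open>Groups given by generators and relators\<close>

context
  fixes Y :: "'a set" and R :: "'a fword set"
  assumes R: "R \<subseteq> carrier (free_group Y)"
begin

interpretation F: group "free_group Y" by (rule free_group_group)

interpretation N: normal "normal_closure (free_group Y) R" "free_group Y"
  by (rule F.normal_closure_normal[OF R])

text \<open>Normalizing inside the definition gives every word over the generators a class, reduced
  or not, so that concatenations can be handled without reducing them.\<close>

definition pres_class :: "'a fword \<Rightarrow> 'a fword set" where
  "pres_class w = normal_closure (free_group Y) R #>\<^bsub>free_group Y\<^esub> fg_norm w"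

lemma presented_group_group: "group (presented_group Y R)"
  unfolding presented_group_def by (rule N.factorgroup_is_group)

lemma carrier_presented_group:
  "carrier (presented_group Y R) = pres_class ` {w. fst ` set w \<subseteq> Y}"
proof -
  have "carrier (presented_group Y R) =
      (\<lambda>w. normal_closure (free_group Y) R #>\<^bsub>free_group Y\<^esub> w) ` carrier (free_group Y)"
    by (auto simp: presented_group_def FactGroup_def RCOSETS_def)
  also have "carrier (free_group Y) = fg_norm ` {w. fst ` set w \<subseteq> Y}"
    using set_fg_norm by (fastforce simp: free_group_sel fg_norm_id image_iff)
  finally show ?thesis by (simp add: image_image pres_class_def)
qed

lemma fg_norm_in_carrier: "fst ` set w \<subseteq> Y \<Longrightarrow> fg_norm w \<in> carrier (free_group Y)"
  using set_fg_norm[of w] by (auto simp: free_group_sel)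

lemma pres_class_append:
  assumes "fst ` set u \<subseteq> Y" "fst ` set v \<subseteq> Y"
  shows "pres_class (u @ v) = pres_class u \<otimes>\<^bsub>presented_group Y R\<^esub> pres_class v"
  using N.rcos_sum[OF fg_norm_in_carrier[OF assms(1)] fg_norm_in_carrier[OF assms(2)]]
  by (simp add: presented_group_def pres_class_def free_group_sel)

lemma pres_class_Nil: "pres_class [] = \<one>\<^bsub>presented_group Y R\<^esub>"
proof -
  have "normal_closure (free_group Y) R #>\<^bsub>free_group Y\<^esub> \<one>\<^bsub>free_group Y\<^esub> = normal_closure (free_group Y) R"
    by (rule F.coset_mult_one[OF N.subset])
  then show ?thesis
    by (simp add: presented_group_def pres_class_def free_group_sel)
qed

lemma pres_class_norm: "pres_class (fg_norm w) = pres_class w"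
  by (simp add: pres_class_def fg_norm_id)

lemma pres_class_inv:
  assumes "fst ` set w \<subseteq> Y"
  shows "pres_class (fg_inv w) = inv\<^bsub>presented_group Y R\<^esub> pres_class w"
proof -
  have "pres_class (fg_inv w) \<otimes>\<^bsub>presented_group Y R\<^esub> pres_class w = \<one>\<^bsub>presented_group Y R\<^esub>"
    using assms by (metis pres_class_append fst_set_fg_inv pres_class_norm fg_norm_inv_append pres_class_Nil)
  moreover have "pres_class w \<in> carrier (presented_group Y R)"
    "pres_class (fg_inv w) \<in> carrier (presented_group Y R)"
    using assms by (auto simp: carrier_presented_group)
  ultimately show ?thesis
    using group.inv_equality[OF presented_group_group] by metis
qed

lemma pres_class_relator: "r \<in> R \<Longrightarrow> pres_class r = \<one>\<^bsub>presented_group Y R\<^esub>"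
proof -
  assume r: "r \<in> R"
  have "fg_reduced r" using r R by (auto simp: free_group_sel)
  moreover have "r \<in> normal_closure (free_group Y) R"
    by (rule F.normal_closure_contains[OF r R])
  ultimately show ?thesis
    by (simp add: pres_class_def fg_norm_id presented_group_def N.rcos_const)
qed

text \<open>Von Dyck's theorem: the kernel of the evaluation is normal and contains the relators,
  hence their normal closure. All later invariants of elements of \<open>Gamma\<close> come from
  this.\<close>

lemma pres_class_eval:
  assumes G: "group G" and f: "\<And>x. x \<in> Y \<Longrightarrow> f x \<in> carrier G"
    and rel: "\<And>r. r \<in> R \<Longrightarrow> word_eval G f r = \<one>\<^bsub>G\<^esub>"
    and uv: "fst ` set u \<subseteq> Y" "fst ` set v \<subseteq> Y" and eq: "pres_class u = pres_class v"
  shows "word_eval G f u = word_eval G f v"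
proof -
  interpret G: group G by fact
  have h: "word_eval G f \<in> hom (free_group Y) G" using f by (rule G.word_eval_hom)
  interpret H: group_hom "free_group Y" G "word_eval G f"
    by unfold_locales (rule h)
  have "normal_closure (free_group Y) R \<subseteq> kernel (free_group Y) G (word_eval G f)"
    using R rel by (intro F.normal_closure_least H.normal_kernel) (auto simp: kernel_def)
  moreover obtain n where n: "n \<in> normal_closure (free_group Y) R" "fg_norm u = n \<otimes>\<^bsub>free_group Y\<^esub> fg_norm v"
  proof -
    have "fg_norm u \<in> pres_class v"
      using F.rcos_self[OF fg_norm_in_carrier[OF uv(1)] N.is_subgroup] eq by (simp add: pres_class_def)
    then show ?thesis using that by (auto simp: pres_class_def r_coset_def)
  qed
  ultimately have "word_eval G f n = \<one>\<^bsub>G\<^esub>" "n \<in> carrier (free_group Y)"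
    by (auto simp: kernel_def)
  then have "word_eval G f (fg_norm u) = word_eval G f (fg_norm v)"
    using n H.hom_mult[of n "fg_norm v"] fg_norm_in_carrier[OF uv(2)] H.hom_closed by simp
  then show ?thesis
    using uv f by (subst (asm) (1 2) G.word_eval_norm) auto
qed

end

section \<open>The automorphism and turn weights\<close>

text \<open>Seen as an evaluation in the free group on all letters, the lift inherits its invariance
  under free reduction from \<open>word_eval_norm\<close>.\<close>

lemma fg_lift_word_eval:
  "fg_lift f w = word_eval (free_group UNIV) (\<lambda>x. fg_norm (f x)) w"
proof (induction w)
  case (Cons x w)
  have "fg_norm (f (fst x)) \<in> carrier (free_group UNIV)" by (simp add: free_group_sel)
  then have "inv\<^bsub>free_group UNIV\<^esub> fg_norm (f (fst x)) = fg_norm (fg_inv (f (fst x)))"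
    by (simp add: free_group_inv fg_norm_fg_inv)
  then show ?case by (simp add: Cons.IH[symmetric] fg_lift_def free_group_sel case_prod_beta)
qed (simp add: fg_lift_def free_group_sel)

lemma fg_lift_append: "fg_lift f (u @ v) = fg_norm (fg_lift f u @ fg_lift f v)"
  by (simp add: fg_lift_def)

lemma fg_lift_norm [simp]: "fg_lift f (fg_norm w) = fg_lift f w"
  unfolding fg_lift_word_eval
  by (rule group.word_eval_norm[OF free_group_group]) (simp add: free_group_sel)

lemma fg_norm_lift [simp]: "fg_norm (fg_lift f w) = fg_lift f w"
  by (simp add: fg_lift_def fg_norm_id)

lemma fg_lift_reduced [simp]: "fg_reduced (fg_lift f w)"
  by (simp add: fg_lift_def)

lemma fg_lift_Nil [simp]: "fg_lift f [] = []"
  by (simp add: fg_lift_def)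

lemma fg_lift_inv: "fg_lift f (fg_inv w) = fg_inv (fg_lift f w)"
proof -
  have "fg_norm (fg_inv (fg_inv (fg_lift f w)) @ fg_lift f (fg_inv w)) = fg_lift f (w @ fg_inv w)"
    by (simp add: fg_lift_append)
  also have "\<dots> = fg_lift f (fg_norm (w @ fg_inv w))" by (simp only: fg_lift_norm)
  finally have "fg_norm (fg_inv (fg_inv (fg_lift f w)) @ fg_lift f (fg_inv w)) = []" by simp
  then show ?thesis by (metis fg_norm_eq_Nil_iff fg_lift_reduced fg_reduced_inv)
qed

section \<open>Words in a, b, c and the inverse automorphism\<close>

definition F3_word :: "nat fword \<Rightarrow> bool" where
  "F3_word w \<longleftrightarrow> fst ` set w \<subseteq> {0, 1, 2}"

lemma F3_word_simps [simp]:
  "F3_word []" "F3_word (x # w) \<longleftrightarrow> fst x \<in> {0, 1, 2} \<and> F3_word w"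
  "F3_word (u @ v) \<longleftrightarrow> F3_word u \<and> F3_word v" "F3_word (fg_inv w) \<longleftrightarrow> F3_word w"
  by (auto simp: F3_word_def)

lemma F3_word_norm: "F3_word w \<Longrightarrow> F3_word (fg_norm w)"
  using set_fg_norm[of w] unfolding F3_word_def by (meson image_mono order_trans)

lemma F3_word_lift: "(\<And>x. F3_word (f x)) \<Longrightarrow> F3_word (fg_lift f w)"
  unfolding fg_lift_def by (rule F3_word_norm) (induction w, auto)

text \<open>The inverse of \<open>phi\<close>: besides b to a and c to b it needs a preimage of a,
  which is c a^-1 because ab b^-1 = a.\<close>

definition psi :: "nat fword \<Rightarrow> nat fword" where
  "psi = fg_lift (\<lambda>x. if x = 0 then [(2, False), (0, True)] else if x = 1 then [(0, False)]
                      else [(1, False)])"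

lemma F3_word_phi [simp]: "F3_word (phi w)" and F3_word_psi [simp]: "F3_word (psi w)"
  unfolding phi_def psi_def by (rule F3_word_lift; simp)+

lemma phi_simps [simp]:
  "phi (fg_norm w) = phi w" "fg_norm (phi w) = phi w" "fg_reduced (phi w)" "phi [] = []"
  "phi (fg_inv w) = fg_inv (phi w)"
  by (simp_all add: phi_def fg_lift_inv)

lemma phi_append: "phi (u @ v) = fg_norm (phi u @ phi v)"
  unfolding phi_def by (rule fg_lift_append)

lemma psi_simps [simp]:
  "psi (fg_norm w) = psi w" "fg_norm (psi w) = psi w" "fg_reduced (psi w)" "psi [] = []"
  "psi (fg_inv w) = fg_inv (psi w)"
  by (simp_all add: psi_def fg_lift_inv)

lemma psi_append: "psi (u @ v) = fg_norm (psi u @ psi v)"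
  unfolding psi_def by (rule fg_lift_append)

lemma letter_cases:
  assumes "fst x \<in> {0, 1, 2}"
  obtains "x = (0::nat, False)" | "x = (0, True)" | "x = (1, False)" | "x = (1, True)"
    | "x = (2, False)" | "x = (2, True)"
  using assms by (cases x; cases "snd x") auto

lemma psi_phi: "F3_word w \<Longrightarrow> psi (phi w) = fg_norm w"
proof (induction w)
  case (Cons x w)
  have x: "fst x \<in> {0, 1, 2}" using Cons.prems by simp
  have "psi (phi [x]) = [x]"
    by (cases rule: letter_cases[OF x])
      (simp_all add: phi_def psi_def fg_lift_def fg_norm_def fg_cons_def fg_inv_def)
  then have "psi (phi (x # w)) = fg_norm ([x] @ psi (phi w))"
    using phi_append[of "[x]" w] psi_append[of "phi [x]" "phi w"] by simp
  then show ?case using Cons fg_norm_append_right[of "[x]" w] by simp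
qed simp

lemma phi_psi: "F3_word w \<Longrightarrow> phi (psi w) = fg_norm w"
proof (induction w)
  case (Cons x w)
  have x: "fst x \<in> {0, 1, 2}" using Cons.prems by simp
  have "phi (psi [x]) = [x]"
    by (cases rule: letter_cases[OF x])
      (simp_all add: phi_def psi_def fg_lift_def fg_norm_def fg_cons_def fg_inv_def)
  then have "phi (psi (x # w)) = fg_norm ([x] @ phi (psi w))"
    using psi_append[of "[x]" w] phi_append[of "psi [x]" "psi w"] by simp
  then show ?case using Cons fg_norm_append_right[of "[x]" w] by simp
qed simp

text \<open>Between the images of consecutive letters of a reduced word only b b^-1 can cancel, at
  the subwords a c^-1 and c a^-1, and the cancellation never spreads. Looking one letter ahead
  therefore produces the reduced image directly. The same holds for \<open>red_psi\<close> with the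
  subwords a b and b^-1 a^-1.\<close>

fun red_phi :: "nat fword \<Rightarrow> nat fword" where
  "red_phi [] = []"
| "red_phi ((n, s) # w) =
    (if n = 0 then
       (if s then (1, True) # red_phi w
        else if w \<noteq> [] \<and> hd w = (2, True) then tl (red_phi w) else (1, False) # red_phi w)
     else if n = 1 then (2, s) # red_phi w
     else if s then (1, True) # (0, True) # red_phi w
     else if w \<noteq> [] \<and> hd w = (0, True) then (0, False) # tl (red_phi w)
     else (0, False) # (1, False) # red_phi w)"

fun red_psi :: "nat fword \<Rightarrow> nat fword" where
  "red_psi [] = []"
| "red_psi ((n, s) # w) =
    (if n = 0 then
       (if s then (0, False) # (2, True) # red_psi w
        else if w \<noteq> [] \<and> hd w = (1, False) then (2, False) # tl (red_psi w)
        else (2, False) # (0, True) # red_psi w)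
     else if n = 1 then
       (if \<not> s then (0, False) # red_psi w
        else if w \<noteq> [] \<and> hd w = (0, True) then tl (red_psi w) else (0, True) # red_psi w)
     else (1, s) # red_psi w)"

lemma fg_cons_cases:
  "fg_cons x w = (if w \<noteq> [] \<and> fst x = fst (hd w) \<and> snd x \<noteq> snd (hd w) then tl w else x # w)"
  by (cases w) (auto simp: fg_cons_def)

text \<open>The first letter of the image depends on at most two letters of the word. This is all
  that the finite case checks for \<open>phi_eq_red_phi\<close> and \<open>turn_sum_phi_step\<close>
  have to know about the remaining word.\<close>

lemma red_phi_hd:
  assumes "F3_word w" "w \<noteq> []"
  shows "red_phi w \<noteq> []" "hd (red_phi w) =
    (if hd w = (0, False) then (if tl w \<noteq> [] \<and> hd (tl w) = (2, True) then (0, True) else (1, False))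
     else if hd w = (0, True) then (1, True) else if fst (hd w) = 1 then (2, snd (hd w))
     else if snd (hd w) then (1, True) else (0, False))"
proof -
  obtain x v where w: "w = x # v" using assms by (cases w) auto
  show "red_phi w \<noteq> []" "hd (red_phi w) =
    (if hd w = (0, False) then (if tl w \<noteq> [] \<and> hd (tl w) = (2, True) then (0, True) else (1, False))
     else if hd w = (0, True) then (1, True) else if fst (hd w) = 1 then (2, snd (hd w))
     else if snd (hd w) then (1, True) else (0, False))"
    using assms by (cases x; cases v; auto simp: w)+
qed

lemma red_psi_hd:
  assumes "F3_word w" "w \<noteq> []"
  shows "red_psi w \<noteq> []" "hd (red_psi w) =
    (if hd w = (1, True) then (if tl w \<noteq> [] \<and> hd (tl w) = (0, True) then (2, True) else (0, True))
     else if hd w = (0, True) \<or> hd w = (1, False) then (0, False) else if hd w = (0, False) then (2, False)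
     else (1, snd (hd w)))"
proof -
  obtain x v where w: "w = x # v" using assms by (cases w) auto
  show "red_psi w \<noteq> []" "hd (red_psi w) =
    (if hd w = (1, True) then (if tl w \<noteq> [] \<and> hd (tl w) = (0, True) then (2, True) else (0, True))
     else if hd w = (0, True) \<or> hd w = (1, False) then (0, False) else if hd w = (0, False) then (2, False)
     else (1, snd (hd w)))"
    using assms by (cases x; cases v; auto simp: w)+
qed

lemma phi_Cons:
  "phi (x # w) = foldr fg_cons (if snd x then fg_inv (if fst x = 0 then [(1, False)] else if fst x = 1 then [(2, False)]
      else [(0, False), (1, False)]) else (if fst x = 0 then [(1, False)] else if fst x = 1 then [(2, False)]
      else [(0, False), (1, False)])) (phi w)"
  by (cases x) (simp add: phi_def fg_lift_def fg_norm_def)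

lemma psi_Cons:
  "psi (x # w) = foldr fg_cons (if snd x then fg_inv (if fst x = 0 then [(2, False), (0, True)] else if fst x = 1 then [(0, False)]
      else [(1, False)]) else (if fst x = 0 then [(2, False), (0, True)] else if fst x = 1 then [(0, False)]
      else [(1, False)])) (psi w)"
  by (cases x) (simp add: psi_def fg_lift_def fg_norm_def)

lemma phi_eq_red_phi: "F3_word w \<Longrightarrow> fg_reduced w \<Longrightarrow> phi w = red_phi w"
proof (induction w)
  case (Cons x w)
  then have IH: "phi w = red_phi w" by (simp add: fg_reduced_Cons)
  have x: "fst x \<in> {0, 1, 2}" and w: "F3_word w" using Cons.prems by auto
  show ?case
  proof (cases w)
    case Nil
    show ?thesis using x by (cases rule: letter_cases[of x])
      (simp_all add: Nil phi_Cons fg_cons_cases fg_inv_def)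
  next
    case (Cons y v)
    have y: "fst y \<in> {0, 1, 2}" and v: "F3_word v" using w Cons by auto
    have red: "\<not> (fst x = fst y \<and> snd x \<noteq> snd y)" "v \<noteq> [] \<Longrightarrow> \<not> (fst y = fst (hd v) \<and> snd y \<noteq> snd (hd v))"
      using Cons.prems Cons by (auto simp: fg_reduced_Cons)
    note hd = red_phi_hd[OF w] red_phi_hd[OF v]
    show ?thesis
    proof (cases "v = []")
      case True
      show ?thesis
        unfolding phi_Cons IH using red hd(1,2) True
        by (cases rule: letter_cases[OF x]; cases rule: letter_cases[OF y])
           (simp_all add: Cons fg_cons_cases fg_inv_def split: if_splits)
    next
      case False
      show ?thesis
        unfolding phi_Cons IH using red(1) red(2)[OF False] hd(1,2) hd(3,4)[OF False] False
        by (cases rule: letter_cases[OF x]; cases rule: letter_cases[OF y])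
           (simp_all add: Cons fg_cons_cases fg_inv_def split: if_splits)
    qed
  qed
qed simp

lemma psi_eq_red_psi: "F3_word w \<Longrightarrow> fg_reduced w \<Longrightarrow> psi w = red_psi w"
proof (induction w)
  case (Cons x w)
  then have IH: "psi w = red_psi w" by (simp add: fg_reduced_Cons)
  have x: "fst x \<in> {0, 1, 2}" and w: "F3_word w" using Cons.prems by auto
  show ?case
  proof (cases w)
    case Nil
    show ?thesis using x by (cases rule: letter_cases[of x])
      (simp_all add: Nil psi_Cons fg_cons_cases fg_inv_def)
  next
    case (Cons y v)
    have y: "fst y \<in> {0, 1, 2}" and v: "F3_word v" using w Cons by auto
    have red: "\<not> (fst x = fst y \<and> snd x \<noteq> snd y)" "v \<noteq> [] \<Longrightarrow> \<not> (fst y = fst (hd v) \<and> snd y \<noteq> snd (hd v))"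
      using Cons.prems Cons by (auto simp: fg_reduced_Cons)
    note hd = red_psi_hd[OF w] red_psi_hd[OF v]
    show ?thesis
    proof (cases "v = []")
      case True
      show ?thesis
        unfolding psi_Cons IH using red hd(1,2) True
        by (cases rule: letter_cases[OF x]; cases rule: letter_cases[OF y])
           (simp_all add: Cons fg_cons_cases fg_inv_def split: if_splits)
    next
      case False
      show ?thesis
        unfolding psi_Cons IH using red(1) red(2)[OF False] hd(1,2) hd(3,4)[OF False] False
        by (cases rule: letter_cases[OF x]; cases rule: letter_cases[OF y])
           (simp_all add: Cons fg_cons_cases fg_inv_def split: if_splits)
    qed
  qed
qed simp

text \<open>Bounded cancellation: at the junction at most one pair of letters disappears, hence the
  2.\<close>

lemma length_red_psi_append:
  assumes "F3_word (u @ v)"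
  shows "length (red_psi u) + length (red_psi v) \<le> length (red_psi (u @ v)) + 2"
  using assms
proof (induction u)
  case (Cons x u)
  have IH: "length (red_psi u) + length (red_psi v) \<le> length (red_psi (u @ v)) + 2" using Cons by simp
  obtain n s where x: "x = (n, s)" by (cases x)
  show ?case
  proof (cases "u = []")
    case True
    have "v \<noteq> [] \<Longrightarrow> length (red_psi v) > 0" using red_psi_hd(1)[of v] Cons.prems by simp
    then show ?thesis by (auto simp: True x)
  next
    case False
    then have "length (red_psi u) > 0" "length (red_psi (u @ v)) > 0"
      using red_psi_hd(1)[of u] red_psi_hd(1)[of "u @ v"] Cons.prems by auto
    then show ?thesis using IH False
      by (cases "red_psi u"; cases "red_psi (u @ v)") (auto simp: x)
  qed
qed simp

lemma length_psi_append:
  assumes "F3_word (u @ v)" "fg_reduced (u @ v)"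
  shows "length (psi u) + length (psi v) \<le> length (psi (u @ v)) + 2"
  using length_red_psi_append[OF assms(1)] assms
  by (simp add: psi_eq_red_psi fg_reduced_append)

lemma length_fg_cons: "length (fg_cons x w) \<le> Suc (length w)"
  by (cases w) (auto simp: fg_cons_def)

lemma length_fg_norm: "length (fg_norm w) \<le> length w"
proof (induction w)
  case (Cons x w) then show ?case using length_fg_cons[of x "fg_norm w"] by (simp add: fg_norm_Cons)
qed simp

lemma length_phi: "length (phi w) \<le> 2 * length w"
proof -
  have "length (concat (map (\<lambda>(x, s). if s then fg_inv (if x = 0 then [(1, False)] else if x = 1 then [(2, False)]
      else [(0, False), (1, False)]) else (if x = 0 then [(1, False)] else if x = 1 then [(2, False)]
      else [(0, False), (1, False)])) (w :: nat fword))) \<le> 2 * length w"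
    by (induction w) auto
  then show ?thesis unfolding phi_def fg_lift_def
    using length_fg_norm order_trans by blast
qed

section \<open>Weights of two-letter subwords\<close>

definition letter_index :: "nat \<times> bool \<Rightarrow> nat" where
  "letter_index x = 2 * fst x + (if snd x then 1 else 0)"

text \<open>The weights of the two-letter subwords (rows and columns ordered as
  \<open>a, a\<inverse>, b, b\<inverse>, c, c\<inverse>\<close>) solve the linear program expressing that the weighted count of
  two-letter subwords grows under \<open>phi\<close> by at least the length of the word, up to the
  telescoping potential \<open>turn_pot\<close> of the first letter.\<close>

definition turn_weight :: "nat \<times> bool \<Rightarrow> nat \<times> bool \<Rightarrow> int" where
  "turn_weight x y = [[2, 0, 10, 3, -4, 0], [0, 2, -4, -5, -6, 10], [-5, 3, 3, 0, 7, 5],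
     [-4, 10, 0, 3, -4, 0], [10, 0, 0, 5, 4, 0], [-6, -4, -4, 7, 0, 4]] ! letter_index x ! letter_index y"

definition turn_pot :: "nat \<times> bool \<Rightarrow> int" where
  "turn_pot x = [0, 3, 4, -1, 2, 11] ! letter_index x"

fun turn_sum :: "nat fword \<Rightarrow> int" where
  "turn_sum (x # y # w) = turn_weight x y + turn_sum (y # w)"
| "turn_sum _ = 0"

lemma turn_sum_Cons: "turn_sum (x # w) = (if w = [] then 0 else turn_weight x (hd w)) + turn_sum w"
  by (cases w) auto

lemma turn_weight_bound:
  assumes "fst x \<in> {0, 1, 2}" "fst y \<in> {0, 1, 2}"
  shows "\<bar>turn_weight x y\<bar> \<le> 10"
  by (cases rule: letter_cases[OF assms(1)]; cases rule: letter_cases[OF assms(2)])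
     (simp_all add: turn_weight_def letter_index_def)

text \<open>Two sides of a polygon run through a common segment in opposite directions; this
  symmetry gives the segment the same weight from both of them.\<close>

lemma turn_weight_inv:
  assumes "fst x \<in> {0, 1, 2}" "fst y \<in> {0, 1, 2}"
  shows "turn_weight (fst y, \<not> snd y) (fst x, \<not> snd x) = turn_weight x y"
  by (cases rule: letter_cases[OF assms(1)]; cases rule: letter_cases[OF assms(2)])
     (simp_all add: turn_weight_def letter_index_def)

lemma turn_sum_append:
  "turn_sum (u @ v) = turn_sum u + turn_sum v + (if u = [] \<or> v = [] then 0 else turn_weight (last u) (hd v))"
  by (induction u rule: induct_list012) (auto simp: turn_sum_Cons)

lemma turn_sum_inv: "F3_word w \<Longrightarrow> turn_sum (fg_inv w) = turn_sum w"
proof (induction w)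
  case (Cons x w)
  show ?case
  proof (cases "w = []")
    case False
    then have "fst (hd w) \<in> {0, 1, 2}" using Cons.prems by (cases w) auto
    then show ?thesis
      using Cons False by (simp add: fg_inv_Cons turn_sum_append last_fg_inv turn_sum_Cons turn_weight_inv)
  qed (simp add: fg_inv_Cons)
qed simp

lemma turn_sum_bound: "F3_word w \<Longrightarrow> \<bar>turn_sum w\<bar> \<le> 10 * int (length w)"
proof (induction w rule: induct_list012)
  case (3 x y zs)
  then show ?case using turn_weight_bound[of x y] by auto
qed auto

lemma turn_sum_append_le:
  assumes "F3_word (u @ v)"
  shows "\<bar>turn_sum (u @ v) - turn_sum u - turn_sum v\<bar> \<le> 10"
proof (cases "u = [] \<or> v = []")
  case False
  then have "fst (last u) \<in> {0, 1, 2}" "fst (hd v) \<in> {0, 1, 2}"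
    using assms by (auto simp: F3_word_def subset_iff)
  then show ?thesis using False turn_weight_bound by (simp add: turn_sum_append)
qed auto

text \<open>Stripping \<open>x\<close> changes both counts only near the beginning, in a way
  determined by \<open>x\<close>, \<open>y\<close>, \<open>z\<close> and the head of the image of
  \<open>z # w\<close>. What remains is a finite list of inequalities, the constraints of the linear
  program; the summand 1 is the contribution of \<open>x\<close> to the length, and the potentials
  telescope along the word.\<close>

lemma turn_sum_phi_step:
  assumes "fst x \<in> {0, 1, 2}" "fst y \<in> {0, 1, 2}" "fst z \<in> {0, 1, 2}" "F3_word w"
    "\<not> (fst x = fst y \<and> snd x \<noteq> snd y)" "\<not> (fst y = fst z \<and> snd y \<noteq> snd z)"
  shows "turn_sum (red_phi (x # y # z # w)) - turn_weight x y + turn_pot y \<ge>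
     turn_sum (red_phi (y # z # w)) + 1 + turn_pot x"
proof -
  have h: "red_phi (z # w) \<noteq> []" using red_phi_hd(1)[of "z # w"] assms by simp
  note hd = red_phi_hd(2)[of "z # w"]
  show ?thesis
    using assms(4-6) h hd
    by (cases rule: letter_cases[OF assms(1)]; cases rule: letter_cases[OF assms(2)];
        cases rule: letter_cases[OF assms(3)])
       (simp_all add: turn_sum_Cons turn_weight_def turn_pot_def letter_index_def split: if_splits)
qed

text \<open>The constant 60 has to absorb only the words of length one and two, to which the step
  does not apply. Since \<open>turn_pot\<close> is at least -1, removing it afterwards turns 60 into
  61.\<close>

lemma turn_sum_red_phi:
  "F3_word w \<Longrightarrow> fg_reduced w \<Longrightarrow> w \<noteq> [] \<Longrightarrow>
     turn_sum (red_phi w) - turn_sum w \<ge> int (length w) + turn_pot (hd w) - 60"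
proof (induction w)
  case (Cons x w)
  have x: "fst x \<in> {0, 1, 2}" using Cons.prems by simp
  show ?case
  proof (cases w)
    case Nil
    then show ?thesis by (cases rule: letter_cases[OF x])
      (simp_all add: turn_weight_def turn_pot_def letter_index_def)
  next
    case w: (Cons y v)
    have y: "fst y \<in> {0, 1, 2}" using Cons.prems w by simp
    show ?thesis
    proof (cases v)
      case Nil
      then show ?thesis using w by (cases rule: letter_cases[OF x]; cases rule: letter_cases[OF y])
        (simp_all add: turn_weight_def turn_pot_def letter_index_def)
    next
      case v: (Cons z u)
      have "turn_sum (red_phi (x # y # z # u)) - turn_weight x y + turn_pot y \<ge>
         turn_sum (red_phi (y # z # u)) + 1 + turn_pot x"
        using Cons.prems by (intro turn_sum_phi_step) (auto simp: w v)
      moreover have "turn_sum (red_phi (y # z # u)) - turn_sum (y # z # u) \<ge> int (length (y # z # u)) + turn_pot y - 60"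
        using Cons by (simp add: w v)
      ultimately show ?thesis by (simp add: w v del: red_phi.simps)
    qed
  qed
qed simp

lemma turn_sum_phi:
  assumes "F3_word w" "fg_reduced w"
  shows "turn_sum (phi w) - turn_sum w \<ge> int (length w) - 61"
proof (cases "w = []")
  case False
  have "fst (hd w) \<in> {0, 1, 2}" using False assms by (cases w) auto
  then have "turn_pot (hd w) \<ge> -1"
    by (cases rule: letter_cases) (simp_all add: turn_pot_def letter_index_def)
  then show ?thesis using turn_sum_red_phi[OF assms False] by (simp add: phi_eq_red_phi[OF assms])
qed simp

section \<open>A linear isoperimetric inequality\<close>

lemma fg_norm_left_cancel:
  assumes "fg_norm (w @ u) = fg_norm (w @ v)" shows "fg_norm u = fg_norm v"
proof -
  have "fg_norm (fg_inv w @ fg_norm (w @ u)) = fg_norm (fg_inv w @ fg_norm (w @ v))" using assms by simp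
  then have "fg_norm (fg_norm (fg_inv w @ w) @ u) = fg_norm (fg_norm (fg_inv w @ w) @ v)"
    by (simp only: fg_norm_append_left fg_norm_append_right append.assoc)
  then show ?thesis by simp
qed

lemma fg_norm_append_cong:
  assumes "fg_norm u = fg_norm u'" "fg_norm v = fg_norm v'"
  shows "fg_norm (u @ v) = fg_norm (u' @ v')"
proof -
  have "fg_norm (u @ v) = fg_norm (fg_norm u @ fg_norm v)" by simp
  also have "\<dots> = fg_norm (fg_norm u' @ fg_norm v')" by (simp only: assms)
  finally show ?thesis by simp
qed

lemma fg_norm_cancel_mid: "fg_norm (u @ w @ fg_inv w @ v) = fg_norm (u @ v)"
proof (rule fg_norm_append_cong[OF refl])
  have "fg_norm (w @ fg_inv w @ v) = fg_norm (fg_norm (w @ fg_inv w) @ v)"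
    by (simp only: fg_norm_append_left append.assoc)
  then show "fg_norm (w @ fg_inv w @ v) = fg_norm v" by simp
qed

lemma fg_norm_trivial_mid:
  assumes "fg_norm m = []" shows "fg_norm (u @ m @ v) = fg_norm (u @ v)"
proof (rule fg_norm_append_cong[OF refl])
  show "fg_norm (m @ v) = fg_norm v"
    using fg_norm_append_left[of m v] by (simp add: assms)
qed

lemma cancellation_split:
  assumes "fg_reduced u" "fg_reduced v"
  shows "\<exists>u' s v'. u = u' @ s \<and> v = fg_inv s @ v' \<and> fg_reduced (u' @ v')"
  using assms
proof (induction v arbitrary: u)
  case Nil
  then show ?case by (intro exI[of _ u] exI[of _ "[]"]) simp
next
  case (Cons y v)
  show ?case
  proof (cases "u = [] \<or> \<not> (fst (last u) = fst y \<and> snd (last u) \<noteq> snd y)")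
    case True
    then show ?thesis using Cons.prems
      by (intro exI[of _ u] exI[of _ "[]"] exI[of _ "y # v"]) (auto simp: fg_reduced_append)
  next
    case False
    then have "last u = (fst y, \<not> snd y)" by (cases "last u") auto
    then have "u = butlast u @ [(fst y, \<not> snd y)]" using False append_butlast_last_id[of u] by simp
    then obtain u0 where u: "u = u0 @ [(fst y, \<not> snd y)]" by blast
    have "fg_reduced u0" using Cons.prems(1) by (simp add: u fg_reduced_append)
    then obtain u' s v' where *: "u0 = u' @ s" "v = fg_inv s @ v'" "fg_reduced (u' @ v')"
      using Cons fg_reduced_tl by blast
    have "y # v = fg_inv (s @ [(fst y, \<not> snd y)]) @ v'"
      by (simp add: fg_inv_append * ) (simp add: fg_inv_def)
    then show ?thesis using * u by (metis append.assoc)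
  qed
qed

section \<open>Corridor sides, exchanges of pairings and cancellation\<close>

type_synonym side = "int \<times> nat fword"

text \<open>The number of relators of the corridor that shows the side \<open>w\<close>. A corridor
  has one relator per letter of its bottom; the visible side is the top for type 1, so its bottom is
  \<open>psi w\<close>, and it is the bottom itself for type -1.\<close>

definition side_len :: "int \<Rightarrow> nat fword \<Rightarrow> nat" where
  "side_len \<tau> w = (if \<tau> = 1 then length (psi w) else length (fg_norm w))"

text \<open>Minimality under one exchange: the two corridors with sides \<open>g\<close> and
  \<open>h\<close> are replaced by one that runs around everything between them and by one around
  \<open>B\<close> alone.\<close>

definition pairs_minimal :: "side list \<Rightarrow> bool" where
  "pairs_minimal ps \<longleftrightarrow> (\<forall>A g B h C \<tau>. ps = A @ [(\<tau>, g)] @ B @ [(\<tau>, h)] @ C \<longrightarrow> \<tau> \<noteq> 0 \<longrightarrow>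
     side_len \<tau> g + side_len \<tau> h \<le>
       side_len \<tau> (g @ concat (map snd B) @ h) + side_len \<tau> (concat (map snd B)))"

definition side_ok :: "side \<Rightarrow> bool" where
  "side_ok p \<longleftrightarrow> fst p \<in> {-1, 0, 1} \<and> fg_reduced (snd p) \<and> F3_word (snd p) \<and> (fst p = 0 \<longrightarrow> length (snd p) \<le> 1)"

lemma side_len_norm:
  assumes "fg_norm u = fg_norm v" shows "side_len \<tau> u = side_len \<tau> v"
proof -
  have "psi u = psi v" using psi_simps(1)[of u] psi_simps(1)[of v] assms by simp
  then show ?thesis by (simp add: side_len_def assms)
qed

lemma side_len_inv: "side_len \<tau> (fg_inv u) = side_len \<tau> u"
  by (simp add: side_len_def fg_norm_fg_inv)

lemma side_len_append_le: "side_len \<tau> (u @ v) \<le> side_len \<tau> u + side_len \<tau> v"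
proof -
  have "length (fg_norm (fg_norm u @ fg_norm v)) \<le> length (fg_norm u) + length (fg_norm v)"
    using length_fg_norm[of "fg_norm u @ fg_norm v"] by simp
  moreover have "length (psi (u @ v)) \<le> length (psi u) + length (psi v)"
    unfolding psi_append using length_fg_norm[of "psi u @ psi v"] by simp
  ultimately show ?thesis by (simp add: side_len_def)
qed

lemma side_len_append_ge:
  assumes "F3_word (u @ v)" "fg_reduced (u @ v)"
  shows "side_len \<tau> u + side_len \<tau> v \<le> side_len \<tau> (u @ v) + 2"
  using length_psi_append[OF assms] assms by (simp add: side_len_def fg_norm_id fg_reduced_append)

lemma length_le_side_len:
  assumes "F3_word s" "fg_reduced s" shows "length s \<le> 2 * side_len \<tau> s"
proof -
  have "length s \<le> 2 * length (psi s)"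
    using length_phi[of "psi s"] phi_psi[OF assms(1)] assms(2) by (simp add: fg_norm_id)
  then show ?thesis using assms by (simp add: side_len_def fg_norm_id)
qed

text \<open>The hypothesis on positions says that \<open>s\<close> in the first side and its inverse
  in the second are the same segment of the tree. Then \<open>r\<close>, the sides \<open>B\<close>
  and \<open>l'\<close> close up, and the exchange would produce the sides
  \<open>l @ u' @ r'\<close> and the inverse of \<open>l' @ r\<close>, from which both copies of
  \<open>s\<close> are gone. Minimality forbids a large saving.\<close>

lemma overlap_bound:
  assumes p: "pairs_minimal (A @ [(\<tau>, l @ u' @ s @ r)] @ B @ [(\<tau>, l' @ fg_inv s @ r')])" "\<tau> \<noteq> 0"
    and ok: "side_ok (\<tau>, l @ u' @ s @ r)" "side_ok (\<tau>, l' @ fg_inv s @ r')"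
    and pos: "fg_norm (concat (map snd A) @ l @ u' @ s) =
              fg_norm (concat (map snd A) @ (l @ u' @ s @ r) @ concat (map snd B) @ l')"
  shows "length s \<le> 8"
proof -
  let ?Y = "concat (map snd B)"
  have "fg_norm ((concat (map snd A) @ l @ u' @ s) @ []) = fg_norm ((concat (map snd A) @ l @ u' @ s) @ (r @ ?Y @ l'))"
    using pos by simp
  then have rYl: "fg_norm (r @ ?Y @ l') = []" using fg_norm_left_cancel by (metis fg_norm_Nil)
  have Y: "fg_norm ?Y = fg_norm (fg_inv r @ fg_inv l')"
  proof -
    have "fg_norm (fg_inv r @ (r @ ?Y @ l') @ fg_inv l') = fg_norm (fg_inv r @ fg_inv l')"
      by (rule fg_norm_trivial_mid[OF rYl])
    moreover have "fg_norm (fg_inv r @ (r @ ?Y @ l') @ fg_inv l') = fg_norm ?Y"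
      using fg_norm_cancel_mid[of "[]" "fg_inv r" "?Y @ l' @ fg_inv l'"] fg_norm_cancel_mid[of ?Y l' "[]"] by simp
    ultimately show ?thesis by simp
  qed
  have gYh: "fg_norm ((l @ u' @ s @ r) @ ?Y @ (l' @ fg_inv s @ r')) = fg_norm ((l @ u') @ r')"
  proof -
    have "fg_norm ((l @ u' @ s) @ (r @ ?Y @ l') @ (fg_inv s @ r')) = fg_norm ((l @ u' @ s) @ (fg_inv s @ r'))"
      by (rule fg_norm_trivial_mid[OF rYl])
    also have "\<dots> = fg_norm ((l @ u') @ r')" using fg_norm_cancel_mid[of "l @ u'" s r'] by simp
    finally show ?thesis by simp
  qed
  have main: "side_len \<tau> (l @ u' @ s @ r) + side_len \<tau> (l' @ fg_inv s @ r') \<le>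
      side_len \<tau> ((l @ u') @ r') + side_len \<tau> (fg_inv r @ fg_inv l')"
    using p(1)[unfolded pairs_minimal_def, rule_format, of A \<tau> "l @ u' @ s @ r" B "l' @ fg_inv s @ r'" "[]"] p(2)
      side_len_norm[OF gYh] side_len_norm[OF Y] by simp
  have red: "fg_reduced (l @ u' @ s @ r)" "fg_reduced (l' @ fg_inv s @ r')" "F3_word (l @ u' @ s @ r)" "F3_word (l' @ fg_inv s @ r')"
    using ok by (auto simp: side_ok_def)
  have sub: "fg_reduced (s @ r)" "fg_reduced (fg_inv s @ r')" "fg_reduced s"
    using red by (simp_all add: fg_reduced_append)
  have 1: "side_len \<tau> (l @ u') + side_len \<tau> (s @ r) \<le> side_len \<tau> (l @ u' @ s @ r) + 2"
    using side_len_append_ge[of "l @ u'" "s @ r" \<tau>] red by simp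
  have 2: "side_len \<tau> s + side_len \<tau> r \<le> side_len \<tau> (s @ r) + 2"
    using side_len_append_ge[of s r \<tau>] red sub by simp
  have 3: "side_len \<tau> l' + side_len \<tau> (fg_inv s @ r') \<le> side_len \<tau> (l' @ fg_inv s @ r') + 2"
    using side_len_append_ge[of l' "fg_inv s @ r'" \<tau>] red by simp
  have 4: "side_len \<tau> (fg_inv s) + side_len \<tau> r' \<le> side_len \<tau> (fg_inv s @ r') + 2"
    using side_len_append_ge[of "fg_inv s" r' \<tau>] red sub by simp
  \<comment> \<open>Cutting the two sides around \<open>s\<close> uses four junctions with a loss of
    at most 2 each. So \<open>s\<close> has side length at most 4, and its length is at most twice
    that.\<close>
  have "2 * side_len \<tau> s \<le> 8"
    using main 1 2 3 4 side_len_append_le[of \<tau> "l @ u'" r'] side_len_append_le[of \<tau> "fg_inv r" "fg_inv l'"]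
    unfolding side_len_inv by linarith
  then show ?thesis using length_le_side_len[of s \<tau>] red sub by simp
qed

text \<open>The sides of a polygon in the tree of \<open>F3\<close> are cancelled against each other with a stack
  of remaining pieces: an entry \<open>(A, \<tau>, l, u, r)\<close> is the piece \<open>u\<close> of the side \<open>l @ u @ r\<close> of type
  \<open>\<tau>\<close> following the sides \<open>A\<close>. Every cancellation empties an entry or ends the treatment of the
  current side, so that there are at most two of them per side on average.\<close>

type_synonym entry = "side list \<times> int \<times> nat fword \<times> nat fword \<times> nat fword"

definition stack_word :: "entry list \<Rightarrow> nat fword" where
  "stack_word st = concat (rev (map (\<lambda>(A, \<tau>, l, u, r). u) st))"

text \<open>The equation locates the piece in the tree: it starts where the path spelled by the
  deeper entries ends. This is what allows two cancelling pieces to be recognized as one segment in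
  \<open>overlap_bound\<close>.\<close>

fun stack_ok :: "side list \<Rightarrow> entry list \<Rightarrow> bool" where
  "stack_ok P [] = True"
| "stack_ok P ((A, \<tau>, l, u, r) # st) \<longleftrightarrow> (\<exists>B. P = A @ [(\<tau>, l @ u @ r)] @ B) \<and> u \<noteq> [] \<and>
     fg_norm (concat (map snd A) @ l) = stack_word st \<and> stack_ok P st"

definition stack_sum :: "entry list \<Rightarrow> int" where
  "stack_sum st = (\<Sum>(A, \<tau>, l, u, r)\<leftarrow>st. \<tau> * turn_sum u)"

lemma stack_word_simps [simp]:
  "stack_word [] = []" "stack_word ((A, \<tau>, l, u, r) # st) = stack_word st @ u"
  by (simp_all add: stack_word_def)

lemma stack_sum_simps [simp]:
  "stack_sum [] = 0" "stack_sum ((A, \<tau>, l, u, r) # st) = \<tau> * turn_sum u + stack_sum st"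
  by (simp_all add: stack_sum_def)

lemma stack_ok_mono: "stack_ok P st \<Longrightarrow> stack_ok (P @ Q) st"
  by (induction P st rule: stack_ok.induct) auto

text \<open>Splitting off \<open>s\<close> costs 10 on each side. For opposite types the two values
  of \<open>turn_sum s\<close> cancel; for equal types \<open>s\<close> has at most 8 letters and
  each value is at most 80; if a boundary letter is involved, \<open>s\<close> contains no
  two-letter subword. The worst case is 2 times 10 plus 2 times 80.\<close>

lemma fold_cost:
  assumes t: "\<tau> \<in> {-1, 0, 1}" "\<tau>' \<in> {-1, 0, 1 :: int}"
    and F: "F3_word (u' @ s)" "F3_word (fg_inv s @ v')"
    and same: "\<tau> = \<tau>' \<Longrightarrow> \<tau> \<noteq> 0 \<Longrightarrow> length s \<le> 8"
    and zero: "\<tau> = 0 \<or> \<tau>' = 0 \<Longrightarrow> length s \<le> 1"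
  shows "\<tau> * turn_sum (u' @ s) + \<tau>' * turn_sum (fg_inv s @ v') \<le> \<tau> * turn_sum u' + \<tau>' * turn_sum v' + 180"
proof -
  have 1: "\<bar>turn_sum (u' @ s) - turn_sum u' - turn_sum s\<bar> \<le> 10"
    by (rule turn_sum_append_le[OF F(1)])
  have 2: "\<bar>turn_sum (fg_inv s @ v') - turn_sum s - turn_sum v'\<bar> \<le> 10"
    using turn_sum_append_le[OF F(2)] F turn_sum_inv[of s] by simp
  have 3: "\<bar>turn_sum s\<bar> \<le> 80" if "\<tau> = \<tau>'" "\<tau> \<noteq> 0"
    using turn_sum_bound[of s] F same[OF that] by simp
  have 4: "turn_sum s = 0" if "\<tau> = 0 \<or> \<tau>' = 0"
    using zero[OF that] by (cases s rule: turn_sum.cases) auto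
  show ?thesis
  proof -
    consider "\<tau> = 0 \<or> \<tau>' = 0" | "\<tau> = \<tau>'" "\<tau> \<noteq> 0" | "\<tau> = - \<tau>'" "\<tau> \<noteq> 0" using t by auto
    then show ?thesis
    proof cases
      case 1
      show ?thesis using t \<open>\<bar>turn_sum (u' @ s) - _ - _\<bar> \<le> 10\<close> 2 4[OF 1] by auto
    next
      case 2
      show ?thesis using t \<open>\<bar>turn_sum (u' @ s) - _ - _\<bar> \<le> 10\<close>
          \<open>\<bar>turn_sum (fg_inv s @ v') - _ - _\<bar> \<le> 10\<close> 3[OF 2] 2 by auto
    next
      case 3
      show ?thesis using t \<open>\<bar>turn_sum (u' @ s) - _ - _\<bar> \<le> 10\<close>
          \<open>\<bar>turn_sum (fg_inv s @ v') - _ - _\<bar> \<le> 10\<close> 3 by auto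
    qed
  qed
qed

text \<open>Amortization with the potential of 180 per entry: a cancellation that empties the top
  entry is paid for by its removal. The last cancellation and the entry pushed for the rest of the
  new side account for the 2.\<close>

lemma stack_push:
  assumes "pairs_minimal (P @ [(\<tau>, g)])" "\<forall>p\<in>set (P @ [(\<tau>, g)]). side_ok p"
    and "stack_ok P st" "fg_reduced (stack_word st)" "g = l' @ v"
    and "fg_norm (concat (map snd P) @ l') = stack_word st"
  shows "\<exists>st'. stack_ok (P @ [(\<tau>, g)]) st' \<and> fg_reduced (stack_word st') \<and>
      stack_word st' = fg_norm (stack_word st @ v) \<and>
      stack_sum st + \<tau> * turn_sum v + 180 * int (length st') \<le> stack_sum st' + 180 * (int (length st) + 2)"
  using assms(3-6)
proof (induction st arbitrary: l' v)
  case Nil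
  have "fg_reduced g" using assms(2) by (simp add: side_ok_def)
  then have rv: "fg_reduced v" using Nil by (simp add: fg_reduced_append)
  show ?case
  proof (cases "v = []")
    case True
    then show ?thesis by (intro exI[of _ "[]"]) simp
  next
    case False
    then show ?thesis using Nil rv
      by (intro exI[of _ "[(P, \<tau>, l', v, [])]"]) (simp add: fg_norm_id)
  qed
next
  case (Cons e st)
  obtain A \<tau>i l u r where e: "e = (A, \<tau>i, l, u, r)" by (cases e)
  from Cons.prems(1) obtain B where P: "P = A @ [(\<tau>i, l @ u @ r)] @ B" and u: "u \<noteq> []"
    and Al: "fg_norm (concat (map snd A) @ l) = stack_word st" and st: "stack_ok P st" by (auto simp: e)
  have rg: "fg_reduced g" using assms(2) by (simp add: side_ok_def)
  have redu: "fg_reduced (stack_word st)" "fg_reduced u" "fg_reduced v"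
    using Cons.prems rg by (simp_all add: e fg_reduced_append)
  from cancellation_split[OF redu(2,3)] obtain u' s v' where
    s: "u = u' @ s" "v = fg_inv s @ v'" "fg_reduced (u' @ v')" by blast
  have oki: "side_ok (\<tau>i, l @ u @ r)" and okg: "side_ok (\<tau>, g)" using assms(2) by (auto simp: P)
  have gl: "g = l' @ fg_inv s @ v'" using Cons.prems(3) s by simp
  have pos: "fg_norm (concat (map snd P) @ l') = stack_word st @ u" using Cons.prems(4) by (simp add: e)
  have pos2: "fg_norm (concat (map snd A) @ l @ u) = stack_word st @ u"
  proof -
    have "fg_norm ((concat (map snd A) @ l) @ u) = fg_norm (stack_word st @ u)"
      using Al by (metis fg_norm_append_left)
    also have "\<dots> = stack_word st @ u" using Cons.prems(2) by (simp add: e fg_norm_id)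
    finally show ?thesis by simp
  qed
  have cost: "\<tau>i * turn_sum (u' @ s) + \<tau> * turn_sum (fg_inv s @ v') \<le> \<tau>i * turn_sum u' + \<tau> * turn_sum v' + 180"
  proof (rule fold_cost)
    show "\<tau>i \<in> {-1, 0, 1}" "\<tau> \<in> {-1, 0, 1}" "F3_word (u' @ s)" "F3_word (fg_inv s @ v')"
      using oki okg by (auto simp: side_ok_def s gl)
    show "length s \<le> 8" if "\<tau>i = \<tau>" "\<tau>i \<noteq> 0"
    proof (rule overlap_bound)
      show "pairs_minimal (A @ [(\<tau>, l @ u' @ s @ r)] @ B @ [(\<tau>, l' @ fg_inv s @ v')])"
        using assms(1) by (simp add: P gl s that)
      show "\<tau> \<noteq> 0" using that by simp
      show "side_ok (\<tau>, l @ u' @ s @ r)" "side_ok (\<tau>, l' @ fg_inv s @ v')" using oki okg that by (simp_all add: s gl)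
      show "fg_norm (concat (map snd A) @ l @ u' @ s) =
              fg_norm (concat (map snd A) @ (l @ u' @ s @ r) @ concat (map snd B) @ l')"
        using pos pos2 by (simp add: P s)
    qed
    show "length s \<le> 1" if "\<tau>i = 0 \<or> \<tau> = 0"
      using that oki okg by (auto simp: side_ok_def s gl)
  qed
  have pos': "fg_norm (concat (map snd P) @ l' @ fg_inv s) = stack_word st @ u'"
  proof -
    have "fg_norm ((concat (map snd P) @ l') @ fg_inv s) = fg_norm ((stack_word st @ u) @ fg_inv s)"
      using pos by (metis fg_norm_append_left)
    also have "\<dots> = fg_norm (stack_word st @ u')"
      using fg_norm_cancel_mid[of "stack_word st @ u'" s "[]"] by (simp add: s)
    also have "\<dots> = stack_word st @ u'"
    proof (rule fg_norm_id)
      have "fg_reduced ((stack_word st @ u') @ s)" using Cons.prems(2) by (simp add: e s(1))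
      then show "fg_reduced (stack_word st @ u')" using fg_reduced_append by blast
    qed
    finally show ?thesis by simp
  qed
  have word: "fg_norm (stack_word (e # st) @ v) = fg_norm (stack_word st @ u' @ v')"
    using fg_norm_cancel_mid[of "stack_word st @ u'" s v'] by (simp add: e s)
  show ?case
  proof (cases "u' = []")
    case True
    have "\<exists>st'. stack_ok (P @ [(\<tau>, g)]) st' \<and> fg_reduced (stack_word st') \<and>
      stack_word st' = fg_norm (stack_word st @ v') \<and>
      stack_sum st + \<tau> * turn_sum v' + 180 * int (length st') \<le> stack_sum st' + 180 * (int (length st) + 2)"
      by (rule Cons.IH[of "l' @ fg_inv s"]) (use st redu gl pos' True in auto)
    then show ?thesis using word True cost by (auto simp: e s)
  next
    case False
    define st1 where "st1 = (A, \<tau>i, l, u', s @ r) # st"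
    have ok1: "stack_ok (P @ [(\<tau>, g)]) st1"
      using stack_ok_mono[OF st] Al False by (auto simp: st1_def P s)
    have w1: "stack_word st1 = stack_word st @ u'" by (simp add: st1_def)
    have red1: "fg_reduced (stack_word st1 @ v')"
      using Cons.prems(2) s(3) False by (auto simp: w1 e s fg_reduced_append)
    show ?thesis
    proof (cases "v' = []")
      case True
      then show ?thesis using ok1 red1 word w1 cost
        by (intro exI[of _ st1]) (auto simp: fg_norm_id st1_def e s)
    next
      case v': False
      define st2 where "st2 = (P, \<tau>, l' @ fg_inv s, v', []) # st1"
      have "stack_ok (P @ [(\<tau>, g)]) st2" using ok1 v' pos' w1 gl by (simp add: st2_def)
      moreover have "stack_word st2 = fg_norm (stack_word (e # st) @ v)" "fg_reduced (stack_word st2)"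
        using word red1 w1 by (simp_all add: st2_def fg_norm_id)
      moreover have "stack_sum (e # st) + \<tau> * turn_sum v + 180 * int (length st2) \<le> stack_sum st2 + 180 * (int (length (e # st)) + 2)"
        using cost by (simp add: st2_def st1_def e s)
      ultimately show ?thesis by blast
    qed
  qed
qed

lemma polygon_inequality:
  assumes "pairs_minimal ps" "\<forall>p\<in>set ps. side_ok p" "fg_norm (concat (map snd ps)) = []"
  shows "(\<Sum>(\<tau>, g)\<leftarrow>ps. \<tau> * turn_sum g) \<le> 360 * int (length ps)"
proof -
  have "\<exists>st. stack_ok P st \<and> fg_reduced (stack_word st) \<and> stack_word st = fg_norm (concat (map snd P)) \<and>
     (\<Sum>(\<tau>, g)\<leftarrow>P. \<tau> * turn_sum g) + 180 * int (length st) \<le> stack_sum st + 360 * int (length P)"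
    if "ps = P @ Q" for P Q
    using that
  proof (induction P arbitrary: Q rule: rev_induct)
    case Nil
    then show ?case by (intro exI[of _ "[]"]) simp
  next
    case (snoc p P)
    obtain \<tau> g where p: "p = (\<tau>, g)" by (cases p)
    from snoc.IH[of "p # Q"] snoc.prems obtain st where st: "stack_ok P st" "fg_reduced (stack_word st)"
      "stack_word st = fg_norm (concat (map snd P))"
      "(\<Sum>(\<tau>, g)\<leftarrow>P. \<tau> * turn_sum g) + 180 * int (length st) \<le> stack_sum st + 360 * int (length P)" by auto
    have min: "pairs_minimal (P @ [(\<tau>, g)])"
      unfolding pairs_minimal_def
    proof (intro allI impI)
      fix A g' B h C \<sigma>
      assume "P @ [(\<tau>, g)] = A @ [(\<sigma>, g')] @ B @ [(\<sigma>, h)] @ C" "\<sigma> \<noteq> 0"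
      then have "ps = A @ [(\<sigma>, g')] @ B @ [(\<sigma>, h)] @ (C @ Q)" using snoc.prems p
        by (metis append.assoc)
      then show "side_len \<sigma> g' + side_len \<sigma> h \<le> side_len \<sigma> (g' @ concat (map snd B) @ h) + side_len \<sigma> (concat (map snd B))"
        using assms(1) \<open>\<sigma> \<noteq> 0\<close> unfolding pairs_minimal_def by blast
    qed
    have ok: "\<forall>p\<in>set (P @ [(\<tau>, g)]). side_ok p" using assms(2) snoc.prems p by auto
    from stack_push[OF min ok st(1,2), of "[]" g] st(3) obtain st' where
      st': "stack_ok (P @ [(\<tau>, g)]) st'" "fg_reduced (stack_word st')" "stack_word st' = fg_norm (stack_word st @ g)"
      "stack_sum st + \<tau> * turn_sum g + 180 * int (length st') \<le> stack_sum st' + 180 * (int (length st) + 2)" by auto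
    show ?case
      by (rule exI[of _ st']) (use st' st(3,4) in \<open>auto simp: p\<close>)
  qed
  from this[of ps "[]"] obtain st where st: "stack_ok ps st" "stack_word st = []"
     "(\<Sum>(\<tau>, g)\<leftarrow>ps. \<tau> * turn_sum g) + 180 * int (length st) \<le> stack_sum st + 360 * int (length ps)"
    using assms(3) by auto
  have "st = []" using st(1,2) by (cases st) auto
  then show ?thesis using st(3) by simp
qed

text \<open>A word in the generators of \<open>Gamma\<close> with a non-crossing pairing of its letters \<open>t\<close> and
  \<open>t\<inverse>\<close>. A paired couple is a corridor of relators with bottom \<open>w\<close> and top \<open>phi w\<close>.\<close>

datatype item = Letter "nat \<times> bool" | Up "item list" | Down "item list"

fun item_val :: "item \<Rightarrow> nat fword" and items_val :: "item list \<Rightarrow> nat fword" where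
  "item_val (Letter x) = [x]"
| "item_val (Up ws) = phi (items_val ws)"
| "item_val (Down ws) = psi (items_val ws)"
| "items_val [] = []"
| "items_val (i # ws) = fg_norm (item_val i @ items_val ws)"

fun item_word :: "item \<Rightarrow> nat fword" and items_word :: "item list \<Rightarrow> nat fword" where
  "item_word (Letter x) = [x]"
| "item_word (Up ws) = (3, False) # items_word ws @ [(3, True)]"
| "item_word (Down ws) = (3, True) # items_word ws @ [(3, False)]"
| "items_word [] = []"
| "items_word (i # ws) = item_word i @ items_word ws"

fun item_ok :: "item \<Rightarrow> bool" and items_ok :: "item list \<Rightarrow> bool" where
  "item_ok (Letter x) \<longleftrightarrow> fst x \<in> {0, 1, 2}"
| "item_ok (Up ws) \<longleftrightarrow> items_ok ws"
| "item_ok (Down ws) \<longleftrightarrow> items_ok ws"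
| "items_ok [] \<longleftrightarrow> True"
| "items_ok (i # ws) \<longleftrightarrow> item_ok i \<and> items_ok ws"

text \<open>One relator per letter of the bottom; for \<open>Down\<close> the bottom is the outer
  side, hence \<open>psi\<close>.\<close>

fun item_area :: "item \<Rightarrow> nat" and items_area :: "item list \<Rightarrow> nat" where
  "item_area (Letter x) = 0"
| "item_area (Up ws) = length (items_val ws) + items_area ws"
| "item_area (Down ws) = length (psi (items_val ws)) + items_area ws"
| "items_area [] = 0"
| "items_area (i # ws) = item_area i + items_area ws"

fun item_type :: "item \<Rightarrow> int" where
  "item_type (Letter x) = 0" | "item_type (Up ws) = 1" | "item_type (Down ws) = -1"

definition item_side :: "item \<Rightarrow> side" where
  "item_side i = (item_type i, item_val i)"

lemma item_val_reduced [simp]: "fg_reduced (item_val i)" and items_val_reduced [simp]: "fg_reduced (items_val ws)"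
  by (cases i; simp) (cases ws; simp)

lemma items_append:
  "items_val (u @ v) = fg_norm (items_val u @ items_val v)"
  "items_word (u @ v) = items_word u @ items_word v"
  "items_ok (u @ v) \<longleftrightarrow> items_ok u \<and> items_ok v"
  "items_area (u @ v) = items_area u + items_area v"
  by (induction u) (auto simp: fg_norm_id)

lemma items_F3: "item_ok i \<Longrightarrow> F3_word (item_val i)" "items_ok ws \<Longrightarrow> F3_word (items_val ws)"
  by (induction i and ws rule: item_val_items_val.induct) (auto intro!: F3_word_norm)

lemma concat_item_sides: "fg_norm (concat (map snd (map item_side ws))) = items_val ws"
proof (induction ws)
  case (Cons i ws)
  have "fg_norm (concat (map snd (map item_side (i # ws)))) =
      fg_norm (item_val i @ fg_norm (concat (map snd (map item_side ws))))"
    by (simp add: item_side_def)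
  then show ?case by (simp only: Cons.IH items_val.simps)
qed simp

text \<open>The affine action of the semidirect product on the set \<open>F3\<close>: t acts by
  \<open>phi\<close>, the other letters by left translation.\<close>

definition F3_act :: "nat \<times> bool \<Rightarrow> nat fword \<Rightarrow> nat fword" where
  "F3_act x w = (if fst x = 3 then (if snd x then psi w else phi w) else fg_norm (x # w))"

lemma F3_act_simps:
  "F3_act (3, False) w = phi w" "F3_act (3, True) w = psi w"
  "fst x \<in> {0, 1, 2} \<Longrightarrow> F3_act x w = fg_norm (x # w)"
  by (auto simp: F3_act_def)

text \<open>A paired word acts as a left translation. Evaluating at the identity shows that its
  value depends on the word alone and not on the pairing, which makes pairings of one word
  comparable.\<close>

lemma foldr_F3_act:
  "item_ok i \<Longrightarrow> F3_word g \<Longrightarrow> fg_reduced g \<Longrightarrow> foldr F3_act (item_word i) g = fg_norm (item_val i @ g)"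
  "items_ok ws \<Longrightarrow> F3_word g \<Longrightarrow> fg_reduced g \<Longrightarrow> foldr F3_act (items_word ws) g = fg_norm (items_val ws @ g)"
proof (induction i and ws arbitrary: g and g rule: item_word_items_word.induct)
  case (2 ws)
  have "foldr F3_act (item_word (Up ws)) g = phi (foldr F3_act (items_word ws) (psi g))" by (simp add: F3_act_simps)
  also have "\<dots> = fg_norm (phi (items_val ws) @ phi (psi g))"
    using 2 by (simp add: phi_append)
  also have "\<dots> = fg_norm (item_val (Up ws) @ g)" using 2 by (simp add: phi_psi)
  finally show ?case .
next
  case (3 ws)
  have "foldr F3_act (item_word (Down ws)) g = psi (foldr F3_act (items_word ws) (phi g))" by (simp add: F3_act_simps)
  also have "\<dots> = fg_norm (psi (items_val ws) @ psi (phi g))"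
    using 3 by (simp add: psi_append)
  also have "\<dots> = fg_norm (item_val (Down ws) @ g)" using 3 by (simp add: psi_phi)
  finally show ?case .
next
  case (5 i ws)
  have "F3_word (fg_norm (items_val ws @ g))" using 5 items_F3(2)[of ws] by (intro F3_word_norm) auto
  then show ?case using 5 by simp
qed (auto simp: fg_norm_id F3_act_simps)

lemma items_val_cong:
  assumes "items_ok ws" "items_ok ws'" "items_word ws = items_word ws'"
  shows "items_val ws = items_val ws'"
  using foldr_F3_act(2)[OF assms(1), of "[]"] foldr_F3_act(2)[OF assms(2), of "[]"] assms(3)
  by (simp add: fg_norm_id)

definition min_area :: "item list \<Rightarrow> bool" where
  "min_area ws \<longleftrightarrow> items_ok ws \<and>
     (\<forall>ws'. items_ok ws' \<longrightarrow> items_word ws' = items_word ws \<longrightarrow> items_area ws \<le> items_area ws')"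

lemma min_areaD: "min_area ws \<Longrightarrow> items_ok ws' \<Longrightarrow> items_word ws' = items_word ws \<Longrightarrow> items_area ws \<le> items_area ws'"
  and min_area_ok: "min_area ws \<Longrightarrow> items_ok ws"
  by (auto simp: min_area_def)

lemma min_area_sub:
  assumes "min_area (xs @ ys @ zs)" shows "min_area ys"
  unfolding min_area_def
proof (intro conjI allI impI)
  show "items_ok ys" using min_area_ok[OF assms] by (simp add: items_append)
  fix ws' assume "items_ok ws'" "items_word ws' = items_word ys"
  then show "items_area ys \<le> items_area ws'"
    using min_areaD[OF assms, of "xs @ ws' @ zs"] min_area_ok[OF assms] by (simp add: items_append)
qed

text \<open>Changing the pairing inside a corridor leaves the value of the enclosed word fixed, so
  the enclosing corridor keeps its area.\<close>

lemma min_area_inner: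
  assumes "min_area [Up ws] \<or> min_area [Down ws]" shows "min_area ws"
  unfolding min_area_def
proof (intro conjI allI impI)
  show ok: "items_ok ws" using assms by (auto simp: min_area_def)
  fix ws' assume ws': "items_ok ws'" "items_word ws' = items_word ws"
  have "items_val ws' = items_val ws" using items_val_cong[OF ws'(1) ok ws'(2)] .
  then show "items_area ws \<le> items_area ws'"
    using assms min_areaD[of "[Up ws]" "[Up ws']"] min_areaD[of "[Down ws]" "[Down ws']"] ws' by auto
qed

text \<open>The competitor is another pairing of the same word: t a t^-1 B t b t^-1 is read as one
  corridor around a t^-1 B t b, inside which t^-1 B t is a corridor of the other kind.\<close>

lemma pairs_minimal_items:
  assumes "min_area ws"
    "map item_side ws = A @ [(\<tau>, g)] @ B @ [(\<tau>, h)] @ C" "\<tau> \<noteq> 0"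
  shows "side_len \<tau> g + side_len \<tau> h \<le>
       side_len \<tau> (g @ concat (map snd B) @ h) + side_len \<tau> (concat (map snd B))"
proof -
  from assms(2) obtain wA i wB k wC where ws: "ws = wA @ [i] @ wB @ [k] @ wC"
    and i: "item_side i = (\<tau>, g)" and k: "item_side k = (\<tau>, h)" and B: "B = map item_side wB"
    by (auto simp: map_eq_append_conv map_eq_Cons_conv append_eq_map_conv Cons_eq_map_conv)
  have "min_area ([i] @ wB @ [k])" using min_area_sub[of wA "[i] @ wB @ [k]" wC] assms(1) ws by simp
  note min = this
  have okk: "item_ok i" "items_ok wB" "item_ok k" using min_area_ok[OF min] by (auto simp: items_append)
  have Y: "fg_norm (concat (map snd B)) = items_val wB" unfolding B by (rule concat_item_sides)
  have psiY: "psi (concat (map snd B)) = psi (items_val wB)" using psi_simps(1) Y by metis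
  show ?thesis
  proof (cases i)
    case (Letter x)
    then show ?thesis using i assms(3) by (simp add: item_side_def)
  next
    case (Up a)
    then have t: "\<tau> = 1" and g: "g = phi (items_val a)" using i by (auto simp: item_side_def)
    then obtain b where b: "k = Up b" using k by (cases k) (auto simp: item_side_def)
    then have h: "h = phi (items_val b)" using k by (auto simp: item_side_def)
    have ok: "F3_word (items_val a)" "F3_word (items_val b)" using okk Up b items_F3(2) by auto
    have "items_area ([i] @ wB @ [k]) \<le> items_area [Up (a @ [Down wB] @ b)]"
      by (rule min_areaD[OF min]) (use okk Up b in \<open>auto simp: items_append\<close>)
    then have "length (items_val a) + length (items_val b) \<le>
      length (fg_norm (items_val a @ psi (items_val wB) @ items_val b)) + length (psi (items_val wB))"
      by (simp add: items_append Up b)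
    moreover have "psi (g @ concat (map snd B) @ h) = fg_norm (items_val a @ psi (items_val wB) @ items_val b)"
      by (simp add: psi_append g h psi_phi ok psiY)
    ultimately show ?thesis by (simp add: side_len_def t psi_phi ok g h psiY fg_norm_id)
  next
    case (Down a)
    then have t: "\<tau> = -1" and g: "g = psi (items_val a)" using i by (auto simp: item_side_def)
    then obtain b where b: "k = Down b" using k by (cases k) (auto simp: item_side_def)
    then have h: "h = psi (items_val b)" using k by (auto simp: item_side_def)
    have ok: "F3_word (items_val wB)" using okk items_F3(2) by auto
    have "items_area ([i] @ wB @ [k]) \<le> items_area [Down (a @ [Up wB] @ b)]"
      by (rule min_areaD[OF min]) (use okk Down b in \<open>auto simp: items_append\<close>)
    moreover have "psi (items_val (a @ [Up wB] @ b)) = fg_norm (g @ items_val wB @ h)"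
      by (simp add: items_append psi_append psi_phi ok g h fg_norm_id)
    ultimately have "length g + length h \<le> length (fg_norm (g @ items_val wB @ h)) + length (items_val wB)"
      by (simp add: items_append Down b g h)
    moreover have "fg_norm (g @ concat (map snd B) @ h) = fg_norm (g @ items_val wB @ h)"
      using Y by (metis fg_norm_append_cong fg_norm_id items_val_reduced)
    ultimately show ?thesis using Y by (simp add: side_len_def t g h)
  qed
qed

text \<open>The polygon inside a corridor has that corridor as an additional side. If it is compared
  with an inner corridor, t xs (t^-1 a t) ys t^-1 is read as (t xs t^-1) a (t ys t^-1), and likewise
  with t and t^-1 exchanged.\<close>

lemma pairs_minimal_closed:
  assumes min: "min_area [n]" and n: "n = Up ws \<and> \<sigma> = -1 \<or> n = Down ws \<and> \<sigma> = 1"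
  shows "pairs_minimal (map item_side ws @ [(\<sigma>, fg_inv (items_val ws))])"
  unfolding pairs_minimal_def
proof (intro allI impI)
  have minws: "min_area ws" using min n by (intro min_area_inner) auto
  fix A g B h C \<tau>
  assume eq: "map item_side ws @ [(\<sigma>, fg_inv (items_val ws))] = A @ [(\<tau>, g)] @ B @ [(\<tau>, h)] @ C" and \<tau>: "\<tau> \<noteq> 0"
  show "side_len \<tau> g + side_len \<tau> h \<le> side_len \<tau> (g @ concat (map snd B) @ h) + side_len \<tau> (concat (map snd B))"
  proof (cases C rule: rev_cases)
    case (snoc C' c)
    then have "map item_side ws = A @ [(\<tau>, g)] @ B @ [(\<tau>, h)] @ C'" using eq
      by (metis append.assoc butlast_snoc)
    then show ?thesis by (rule pairs_minimal_items[OF minws _ \<tau>])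
  next
    \<comment> \<open>Here the second side of the pair is the enclosing corridor itself; otherwise
      both lie in \<open>ws\<close> and the previous lemma applies.\<close>
    case Nil
    have "(map item_side ws) @ [(\<sigma>, fg_inv (items_val ws))] = (A @ [(\<tau>, g)] @ B) @ [(\<tau>, h)]" using eq Nil by simp
    then have e: "map item_side ws = A @ [(\<tau>, g)] @ B" and t: "\<tau> = \<sigma>" and h: "h = fg_inv (items_val ws)"
      unfolding append1_eq_conv by auto
    from e obtain xs i ys where ws: "ws = xs @ [i] @ ys" and i: "item_side i = (\<tau>, g)" and B: "B = map item_side ys"
      by (auto simp: map_eq_append_conv map_eq_Cons_conv append_eq_map_conv Cons_eq_map_conv)
    have okk: "items_ok xs" "item_ok i" "items_ok ys" using min_area_ok[OF minws] ws by (auto simp: items_append)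
    have Y: "fg_norm (concat (map snd B)) = items_val ys" unfolding B by (rule concat_item_sides)
    have gv: "g = item_val i" using i by (simp add: item_side_def)
    have val: "items_val ws = fg_norm (items_val xs @ g @ items_val ys)"
      by (simp add: ws items_append gv)
    have rest: "fg_norm (g @ concat (map snd B) @ h) = fg_norm (fg_inv (items_val xs))"
    proof -
      let ?z = "g @ items_val ys"
      have "h = fg_norm (fg_inv (items_val xs @ ?z))" by (simp add: h val fg_norm_fg_inv)
      then have hh: "fg_norm h = fg_norm (fg_inv ?z @ fg_inv (items_val xs))" by (simp add: fg_inv_append fg_norm_id)
      have "fg_norm ((g @ concat (map snd B)) @ h) = fg_norm (?z @ (fg_inv ?z @ fg_inv (items_val xs)))"
        by (rule fg_norm_append_cong[OF _ hh]) (rule fg_norm_append_cong, simp_all add: Y fg_norm_id)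
      also have "\<dots> = fg_norm (fg_inv (items_val xs))" using fg_norm_cancel_mid[of "[]" ?z] by simp
      finally show ?thesis by simp
    qed
    have goal: "side_len \<tau> g + side_len \<tau> (items_val ws) \<le> side_len \<tau> (items_val xs) + side_len \<tau> (items_val ys)"
      using n
    proof (elim disjE conjE)
      assume n: "n = Up ws" "\<sigma> = -1"
      then obtain a where a: "i = Down a" using i t by (cases i) (auto simp: item_side_def)
      have "items_area [n] \<le> items_area ([Up xs] @ a @ [Up ys])"
        by (rule min_areaD[OF min]) (use okk n a ws in \<open>auto simp: items_append\<close>)
      then have "length (items_val ws) + length g \<le> length (items_val xs) + length (items_val ys)"
        by (simp add: n ws items_append a gv)
      then show ?thesis by (simp add: side_len_def t n fg_norm_id gv)
    next
      assume n: "n = Down ws" "\<sigma> = 1"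
      then obtain a where a: "i = Up a" using i t by (cases i) (auto simp: item_side_def)
      have "F3_word (items_val a)" using okk a items_F3(2) by auto
      then have pg: "psi g = items_val a" by (simp add: gv a psi_phi fg_norm_id)
      have "items_area [n] \<le> items_area ([Down xs] @ a @ [Down ys])"
        by (rule min_areaD[OF min]) (use okk n a ws in \<open>auto simp: items_append\<close>)
      then have "length (psi (items_val ws)) + length (psi g) \<le> length (psi (items_val xs)) + length (psi (items_val ys))"
        unfolding pg by (simp add: n ws items_append a)
      then show ?thesis by (simp add: side_len_def t n)
    qed
    have "side_len \<tau> h = side_len \<tau> (items_val ws)" by (simp add: h side_len_inv)
    moreover have "side_len \<tau> (g @ concat (map snd B) @ h) = side_len \<tau> (items_val xs)"
      using side_len_norm[OF rest] side_len_inv by simp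
    moreover have "side_len \<tau> (concat (map snd B)) = side_len \<tau> (items_val ys)"
      by (rule side_len_norm) (simp add: Y fg_norm_id)
    ultimately show ?thesis using goal by simp
  qed
qed

text \<open>The total over all corridors of the weighted count of the top minus that of the
  bottom.\<close>

fun item_gain :: "item \<Rightarrow> int" and items_gain :: "item list \<Rightarrow> int" where
  "item_gain (Letter x) = 0"
| "item_gain (Up ws) = turn_sum (phi (items_val ws)) - turn_sum (items_val ws) + items_gain ws"
| "item_gain (Down ws) = turn_sum (items_val ws) - turn_sum (psi (items_val ws)) + items_gain ws"
| "items_gain [] = 0"
| "items_gain (i # ws) = item_gain i + items_gain ws"

text \<open>Each corridor loses the constant 61 of \<open>turn_sum_phi\<close>, and there are fewer
  corridors than letters, since each of them uses two letters t.\<close>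

lemma area_le_gain:
  "item_ok i \<Longrightarrow> int (item_area i) \<le> item_gain i + 61 * int (length (item_word i))"
  "items_ok ws \<Longrightarrow> int (items_area ws) \<le> items_gain ws + 61 * int (length (items_word ws))"
proof (induction i and ws rule: item_word_items_word.induct)
  case (2 ws)
  then have "turn_sum (phi (items_val ws)) - turn_sum (items_val ws) \<ge> int (length (items_val ws)) - 61"
    using turn_sum_phi[OF items_F3(2)] by simp
  then show ?case using 2 by simp
next
  case (3 ws)
  then have "phi (psi (items_val ws)) = items_val ws" using phi_psi[OF items_F3(2)] by (simp add: fg_norm_id)
  then have "turn_sum (items_val ws) - turn_sum (psi (items_val ws)) \<ge> int (length (psi (items_val ws))) - 61"
    using turn_sum_phi[of "psi (items_val ws)"] by simp
  then show ?case using 3 by simp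
qed auto

section \<open>Summation over all polygons\<close>

definition side_sum :: "side list \<Rightarrow> int" where
  "side_sum ps = (\<Sum>(\<tau>, g)\<leftarrow>ps. \<tau> * turn_sum g)"

lemma side_ok_item: "item_ok i \<Longrightarrow> side_ok (item_side i)"
  using items_F3(1)[of i] by (cases i) (auto simp: side_ok_def item_side_def)

lemma side_ok_items: "items_ok ws \<Longrightarrow> \<forall>p\<in>set (map item_side ws). side_ok p"
  by (induction ws) (auto simp: side_ok_item)

text \<open>The number of sides of all enclosed polygons; the summand 1 is the side of the enclosing
  corridor.\<close>

fun item_size :: "item \<Rightarrow> nat" and items_size :: "item list \<Rightarrow> nat" where
  "item_size (Letter x) = 0"
| "item_size (Up ws) = length ws + 1 + items_size ws"
| "item_size (Down ws) = length ws + 1 + items_size ws"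
| "items_size [] = 0"
| "items_size (i # ws) = item_size i + items_size ws"

lemma items_size_le:
  "item_size i + 1 \<le> 2 * length (item_word i)"
  "items_size ws + length ws \<le> 2 * length (items_word ws)"
  by (induction i and ws rule: item_word_items_word.induct) auto

lemma closed_polygon:
  assumes min: "min_area [n]" and n: "n = Up ws \<and> \<sigma> = -1 \<or> n = Down ws \<and> \<sigma> = 1"
  shows "side_sum (map item_side ws) + \<sigma> * turn_sum (items_val ws) \<le> 360 * (int (length ws) + 1)"
proof -
  have ok: "items_ok ws" using min_area_ok[OF min] n by auto
  have "(\<Sum>(\<tau>, g)\<leftarrow>map item_side ws @ [(\<sigma>, fg_inv (items_val ws))]. \<tau> * turn_sum g) \<le>
     360 * int (length (map item_side ws @ [(\<sigma>, fg_inv (items_val ws))]))"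
  proof (rule polygon_inequality[OF pairs_minimal_closed[OF min n]])
    show "\<forall>p\<in>set (map item_side ws @ [(\<sigma>, fg_inv (items_val ws))]). side_ok p"
      using side_ok_items[OF ok] items_F3(2)[OF ok] n by (auto simp: side_ok_def)
    have "fg_norm (concat (map snd (map item_side ws)) @ fg_inv (items_val ws)) = fg_norm (items_val ws @ fg_inv (items_val ws))"
      using concat_item_sides[of ws] by (metis fg_norm_append_left)
    then show "fg_norm (concat (map snd (map item_side ws @ [(\<sigma>, fg_inv (items_val ws))]))) = []" by simp
  qed
  then show ?thesis using turn_sum_inv[OF items_F3(2)[OF ok]] by (simp add: side_sum_def)
qed

text \<open>Regrouping: the top and the bottom of a corridor are sides of the two polygons adjacent
  to it, so the gain is the sum of the signed side sums of all polygons. The left hand side takes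
  away the outermost polygon, and \<open>closed_polygon\<close> bounds the enclosed ones.\<close>

lemma gain_le:
  "min_area [i] \<Longrightarrow> item_gain i - item_type i * turn_sum (item_val i) \<le> 360 * int (item_size i)"
  "min_area ws \<Longrightarrow> items_gain ws - side_sum (map item_side ws) \<le> 360 * int (items_size ws)"
proof (induction i and ws rule: item_word_items_word.induct)
  case (2 ws)
  have "min_area ws" using 2 by (intro min_area_inner) auto
  with 2 closed_polygon[of "Up ws" ws "-1"] show ?case by simp
next
  case (3 ws)
  have "min_area ws" using 3 by (intro min_area_inner) auto
  with 3 closed_polygon[of "Down ws" ws 1] show ?case by simp
next
  case (5 i ws)
  have "min_area [i]" "min_area ws"
    using 5 min_area_sub[of "[]" "[i]" ws] min_area_sub[of "[i]" ws "[]"] by auto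
  with 5 show ?case by (simp add: side_sum_def item_side_def)
qed (auto simp: side_sum_def)

text \<open>All polygons together, the outermost one included, have at most twice as many sides as
  the word has letters; the constant is 2 times 360 plus 61.\<close>

theorem area_linear:
  assumes "min_area ws" "items_val ws = []"
  shows "items_area ws \<le> 781 * length (items_word ws)"
proof -
  have ok: "items_ok ws" by (rule min_area_ok[OF assms(1)])
  have "side_sum (map item_side ws) \<le> 360 * int (length (map item_side ws))"
    unfolding side_sum_def
  proof (rule polygon_inequality)
    show "pairs_minimal (map item_side ws)"
      unfolding pairs_minimal_def using pairs_minimal_items[OF assms(1)] by blast
    show "fg_norm (concat (map snd (map item_side ws))) = []" using concat_item_sides assms(2) by simp
  qed (rule side_ok_items[OF ok])
  then have "int (items_area ws) \<le> 781 * int (length (items_word ws))"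
    using gain_le(2)[OF assms(1)] area_le_gain(2)[OF ok] items_size_le(2)[of ws] by simp
  then show ?thesis by linarith
qed

text \<open>Every word is a sequence of paired words separated by unpaired letters \<open>t\<close>, or by
  unpaired letters \<open>t\<inverse>\<close>.\<close>

definition t_exponent :: "nat fword \<Rightarrow> int" where
  "t_exponent w = (\<Sum>x\<leftarrow>w. if fst x = 3 then (if snd x then -1 else 1) else 0)"

lemma items_exist_general:
  "fst ` set w \<subseteq> {0, 1, 2, 3} \<Longrightarrow> \<exists>b I Is. items_ok I \<and> (\<forall>J\<in>set Is. items_ok J) \<and>
     w = items_word I @ concat (map (\<lambda>J. (3, b) # items_word J) Is) \<and>
     t_exponent w = (if b then -1 else 1) * int (length Is)"
proof (induction w)
  case Nil
  then show ?case by (intro exI[of _ False] exI[of _ "[]"]) (simp add: t_exponent_def)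
next
  case (Cons x w)
  then obtain b I Is where I: "items_ok I" "\<forall>J\<in>set Is. items_ok J"
    "w = items_word I @ concat (map (\<lambda>J. (3, b) # items_word J) Is)"
    "t_exponent w = (if b then -1 else 1) * int (length Is)" by auto
  have te: "t_exponent (x # w) = (if fst x = 3 then (if snd x then -1 else 1) else 0) + t_exponent w"
    by (simp add: t_exponent_def)
  show ?case
  proof (cases "fst x = 3")
    case False
    then show ?thesis using I Cons.prems te
      by (intro exI[of _ b] exI[of _ "Letter x # I"] exI[of _ Is]) auto
  next
    case x3: True
    show ?thesis
    proof (cases Is)
      case Nil
      then show ?thesis using I te x3
        by (intro exI[of _ "snd x"] exI[of _ "[]"] exI[of _ "[I]"]) (cases x, auto)
    next
      case (Cons J Js)
      show ?thesis
      proof (cases "b = snd x")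
        case True
        then show ?thesis using I te x3 Cons
          by (intro exI[of _ b] exI[of _ "[]"] exI[of _ "I # Is"]) (cases x, auto)
      next
        \<comment> \<open>A letter opposite to the unpaired ones is paired with the first of these
          and encloses the paired word \<open>I\<close> between them.\<close>
        case False
        then show ?thesis using I te x3 Cons
          by (intro exI[of _ b] exI[of _ "(if b then Up I else Down I) # J"] exI[of _ Js]) (cases x, auto)
      qed
    qed
  qed
qed

lemma items_exist:
  assumes "fst ` set w \<subseteq> {0, 1, 2, 3}" "t_exponent w = 0"
  obtains ws where "min_area ws" "items_word ws = w"
proof -
  obtain b I Is where I: "items_ok I" "w = items_word I @ concat (map (\<lambda>J. (3, b) # items_word J) Is)"
    "t_exponent w = (if b then -1 else 1) * int (length Is)"
    using items_exist_general[OF assms(1)] by blast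
  have "Is = []" using I(3) assms(2) by (cases b) auto
  then have "items_ok I \<and> items_word I = w" using I by simp
  from ex_has_least_nat[of "\<lambda>ws. items_ok ws \<and> items_word ws = w", OF this, of items_area]
  obtain ws where "items_ok ws \<and> items_word ws = w"
    "\<forall>ws'. items_ok ws' \<and> items_word ws' = w \<longrightarrow> items_area ws \<le> items_area ws'" by blast
  then show ?thesis using that unfolding min_area_def by blast
qed

section \<open>Fillings of closed walks\<close>

text \<open>The 1-chain of a walk as an antisymmetric function on ordered pairs. A pause contributes
  nothing and a backtracking step cancels. Each edge is counted in both orders, whence the factors 2
  in the sums over pairs.\<close>

fun walk_chain :: "'v list \<Rightarrow> 'v \<times> 'v \<Rightarrow> int" where
  "walk_chain (x # y # zs) p =
     of_bool (p = (x, y)) - of_bool (p = (y, x)) + walk_chain (y # zs) p"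
| "walk_chain _ p = 0"

lemma walk_chain_append:
  "walk_chain (xs @ [x] @ ys) p = walk_chain (xs @ [x]) p + walk_chain (x # ys) p"
proof (induction xs rule: induct_list012)
  case (2 a)
  then show ?case by (cases ys) auto
qed (auto simp: neq_Nil_conv)

lemma walk_chain_rev: "walk_chain (rev xs) p = - walk_chain xs p"
proof (induction xs rule: induct_list012)
  case (3 x y zs)
  have "walk_chain (rev (x # y # zs)) p = walk_chain (rev zs @ [y] @ [x]) p" by simp
  also have "\<dots> = walk_chain (rev (y # zs)) p + walk_chain [y, x] p"
    using walk_chain_append[of "rev zs" y "[x]" p] by simp
  finally show ?case using 3 by simp
qed auto

lemma walk_chain_antisym: "walk_chain xs (u, v) = - walk_chain xs (v, u)"
proof (induction xs rule: induct_list012)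
  case (3 x y zs)
  from 3(2) show ?case by (simp add: conj_commute)
qed simp_all

lemma walk_chain_support: "walk_chain xs (u, v) \<noteq> 0 \<Longrightarrow> u \<in> set xs \<and> v \<in> set xs"
proof (induction xs rule: induct_list012)
  case (3 x y zs)
  then show ?case
    by (cases "walk_chain (y # zs) (u, v) = 0") (auto simp: of_bool_def split: if_splits)
qed auto

lemma walk_chain_outside: "p \<notin> set xs \<times> set xs \<Longrightarrow> walk_chain xs p = 0"
proof (rule ccontr)
  assume a: "p \<notin> set xs \<times> set xs" and "walk_chain xs p \<noteq> 0"
  then show False using walk_chain_support[of xs "fst p" "snd p"] by (cases p) auto
qed

text \<open>The discrete form of integrating a gradient along a path; on closed walks the pairing
  vanishes.\<close>

lemma walk_chain_pairing:
  assumes "finite A" "set xs \<subseteq> A" "xs \<noteq> []"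
  shows "(\<Sum>p\<in>A \<times> A. walk_chain xs p * (f (snd p) - f (fst p))) = 2 * (f (last xs) - f (hd xs) :: int)"
  using assms(2,3)
proof (induction xs rule: induct_list012)
  case (3 x y zs)
  have fin: "finite (A \<times> A)" using assms(1) by simp
  have *: "(\<Sum>p\<in>A \<times> A. of_bool (p = q) * (f (snd p) - f (fst p))) = f (snd q) - f (fst q)"
    if "q \<in> A \<times> A" for q
  proof -
    have "(\<Sum>p\<in>A \<times> A. of_bool (p = q) * (f (snd p) - f (fst p))) =
        (\<Sum>p\<in>A \<times> A. if p = q then f (snd p) - f (fst p) else 0)"
      by (rule sum.cong) auto
    then show ?thesis using that fin by simp
  qed
  have "(\<Sum>p\<in>A \<times> A. walk_chain (x # y # zs) p * (f (snd p) - f (fst p))) =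
     (\<Sum>p\<in>A \<times> A. of_bool (p = (x, y)) * (f (snd p) - f (fst p)))
     - (\<Sum>p\<in>A \<times> A. of_bool (p = (y, x)) * (f (snd p) - f (fst p)))
     + (\<Sum>p\<in>A \<times> A. walk_chain (y # zs) p * (f (snd p) - f (fst p)))"
    unfolding sum_subtractf[symmetric] sum.distrib[symmetric]
    by (rule sum.cong) (auto simp: algebra_simps)
  also have "\<dots> = (f y - f x) - (f x - f y) + 2 * (f (last (y # zs)) - f y)"
    using * 3 by simp
  finally show ?case by simp
qed auto

lemma walk_chain_norm_le:
  assumes "finite A"
  shows "(\<Sum>p\<in>A \<times> A. \<bar>walk_chain xs p\<bar>) \<le> 2 * int (length xs - 1)"
proof (induction xs rule: induct_list012)
  case (3 x y zs)
  have fin: "finite (A \<times> A)" using assms by simp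
  have *: "(\<Sum>p\<in>A \<times> A. of_bool (p = q)) \<le> (1::int)" for q
  proof -
    have "(\<Sum>p\<in>A \<times> A. of_bool (p = q)) = (\<Sum>p\<in>A \<times> A. if p = q then 1 else (0::int))"
      by (rule sum.cong) auto
    then show ?thesis using fin by simp
  qed
  have "(\<Sum>p\<in>A \<times> A. \<bar>walk_chain (x # y # zs) p\<bar>) \<le>
    (\<Sum>p\<in>A \<times> A. of_bool (p = (x, y)) + of_bool (p = (y, x)) + \<bar>walk_chain (y # zs) p\<bar>)"
  proof (rule sum_mono)
    have *: "\<bar>a - b + c\<bar> \<le> a + b + \<bar>c\<bar>" if "a \<ge> 0" "b \<ge> 0" for a b c :: int
      using that by linarith
    show "\<bar>walk_chain (x # y # zs) p\<bar> \<le> of_bool (p = (x, y)) + of_bool (p = (y, x)) + \<bar>walk_chain (y # zs) p\<bar>" for p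
      unfolding walk_chain.simps by (rule *) simp_all
  qed
  also have "\<dots> \<le> 1 + 1 + 2 * int (length (y # zs) - 1)"
    unfolding sum.distrib using *[of "(x, y)"] *[of "(y, x)"] 3 by linarith
  finally show ?case by (simp del: walk_chain.simps)
qed auto

lemma walk_chain_map:
  "walk_chain (map x [0..<Suc n]) p
     = (\<Sum>m<n. of_bool (p = (x m, x (Suc m))) - of_bool (p = (x (Suc m), x m)))"
proof (induction n)
  case (Suc n)
  have "map x [0..<Suc (Suc n)] = map x [0..<n] @ [x n] @ [x (Suc n)]" by simp
  then show ?case using walk_chain_append[of "map x [0..<n]" "x n" "[x (Suc n)]" p] Suc by simp
qed simp

lemma walk_chain_divergence:
  assumes "finite A" "set xs \<subseteq> A" "xs \<noteq> []"
  shows "(\<Sum>v\<in>A. walk_chain xs (u, v)) = of_bool (u = hd xs) - of_bool (u = last xs)"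
  using assms(2,3)
proof (induction xs rule: induct_list012)
  case (3 x y zs)
  have *: "(\<Sum>v\<in>A. of_bool (u = a \<and> v = b)) = (of_bool (u = a) :: int)" if "b \<in> A" for a b
  proof -
    have "(\<Sum>v\<in>A. of_bool (u = a \<and> v = b)) = (\<Sum>v\<in>A. if v = b then of_bool (u = a) else (0::int))"
      by (rule sum.cong) auto
    then show ?thesis using that assms(1) by simp
  qed
  show ?case using 3 * by (simp add: sum.distrib sum_subtractf)
qed auto

text \<open>The last axiom makes \<open>d\<close> the path metric of the graph joining points at
  distance 1, as is the case for a word metric.\<close>

locale nat_metric =
  fixes d :: "'v \<Rightarrow> 'v \<Rightarrow> nat"
  assumes d_eq_0 [simp]: "d x y = 0 \<longleftrightarrow> x = y"
    and d_sym: "d x y = d y x"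
    and d_tri: "d x z \<le> d x y + d y z"
    and d_step: "d x y = Suc n \<Longrightarrow> \<exists>z. d x z = 1 \<and> d z y = n"
begin

section \<open>Walks and integer cycles\<close>

lemma d_self [simp]: "d x x = 0" by simp

definition is_walk :: "'v list \<Rightarrow> bool" where
  "is_walk xs \<longleftrightarrow> xs \<noteq> [] \<and> successively (\<lambda>x y. d x y \<le> 1) xs"

definition closed_walk :: "'v list \<Rightarrow> bool" where
  "closed_walk xs \<longleftrightarrow> is_walk xs \<and> hd xs = last xs"

lemma is_walk_append:
  "is_walk (xs @ [x] @ ys) \<longleftrightarrow> is_walk (xs @ [x]) \<and> is_walk (x # ys)"
proof -
  have "successively P (xs @ [x] @ ys) \<longleftrightarrow> successively P (xs @ [x]) \<and> successively P (x # ys)" for P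
    using successively_append_iff[of P "xs @ [x]" ys] by (cases ys) auto
  then show ?thesis by (simp add: is_walk_def)
qed

lemma is_walk_rev: "is_walk (rev xs) \<longleftrightarrow> is_walk xs"
proof -
  have "(\<lambda>x y. d y x \<le> 1) = (\<lambda>x y. d x y \<le> 1)"
    by (intro ext, subst d_sym) (rule refl)
  then show ?thesis unfolding is_walk_def successively_rev rev_is_Nil_conv by (rule arg_cong)
qed

lemma walk_dist: "is_walk (x # xs) \<Longrightarrow> y \<in> set (x # xs) \<Longrightarrow> d x y \<le> length xs"
proof (induction xs arbitrary: x)
  case (Cons z zs)
  then have w: "is_walk (z # zs)" "d x z \<le> 1" by (auto simp: is_walk_def)
  show ?case
  proof (cases "y = x")
    case False
    then have "d z y \<le> length zs" using Cons w by auto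
    then show ?thesis using d_tri[of x y z] w by simp
  qed simp
qed simp

lemma walk_dist_any:
  assumes "is_walk xs" "x \<in> set xs" "y \<in> set xs"
  shows "d x y \<le> length xs"
proof -
  have *: "d x y \<le> length xs" if "is_walk xs" "xs = as @ x # bs" "y \<in> set (x # bs)" for x y xs as bs
    using walk_dist[of x bs y] that is_walk_append[of as x bs] by simp
  obtain as bs where ab: "xs = as @ x # bs" using assms(2) by (metis split_list)
  show ?thesis
  proof (cases "y \<in> set (x # bs)")
    case True then show ?thesis using *[OF assms(1) ab] by simp
  next
    case False
    then have "y \<in> set as" using assms ab by auto
    then obtain cs ds where cd: "as = cs @ y # ds" by (metis split_list)
    then have "xs = cs @ y # (ds @ x # bs)" using ab by simp
    from *[OF assms(1) this, of x] show ?thesis by (subst d_sym) simp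
  qed
qed

text \<open>Closed walks carry the integer 1-cycles: a successor function along positive edges has a
  periodic orbit, which is a simple cycle dominated by the given chain.\<close>

lemma cycle_decomposition:
  assumes "finite A" and "\<And>u v. z (u, v) = - z (v, u)"
    and "\<And>p. p \<notin> A \<times> A \<Longrightarrow> z p = 0"
    and "\<And>u v. z (u, v) \<noteq> 0 \<Longrightarrow> d u v \<le> 1"
    and "\<And>u. u \<in> A \<Longrightarrow> (\<Sum>v\<in>A. z (u, v)) = 0"
  shows "\<exists>Cs. (\<forall>c\<in>set Cs. closed_walk c) \<and> (\<forall>p. z p = (\<Sum>c\<leftarrow>Cs. walk_chain c p))
      \<and> int (\<Sum>c\<leftarrow>Cs. length c) \<le> (\<Sum>p\<in>A \<times> A. \<bar>z p :: int\<bar>)"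
  using assms(2-5)
proof (induction "nat (\<Sum>p\<in>A \<times> A. \<bar>z p\<bar>)" arbitrary: z rule: less_induct)
  case less
  show ?case
  proof (cases "\<forall>p. z p = 0")
    case True
    then show ?thesis by (intro exI[of _ "[]"]) simp
  next
    case False
    \<comment> \<open>The sum over the edges at a vertex is zero, so a positive edge entering it
      forces a positive edge leaving it.\<close>
    have out: "\<exists>v\<in>A. z (u, v) > 0" if "z (w, u) > 0" for u w
    proof (rule ccontr)
      assume "\<not> ?thesis"
      then have np: "\<And>v. v \<in> A \<Longrightarrow> z (u, v) \<le> 0" by force
      have A: "u \<in> A" "w \<in> A" using that less.prems(2)[of "(w, u)"] by auto
      have "(\<Sum>v\<in>A. z (u, v)) < (\<Sum>v\<in>A. 0)"
      proof (rule sum_strict_mono_ex1)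
        show "\<exists>a\<in>A. z (u, a) < 0"
          using A that less.prems(1)[of u w] by (intro bexI[of _ w]) auto
      qed (use assms(1) np in auto)
      then show False using less.prems(4)[OF A(1)] by simp
    qed
    define nx where "nx u = (SOME v. z (u, v) > 0)" for u
    have nx: "z (u, nx u) > 0" if "z (w, u) > 0" for u w
      unfolding nx_def using out[OF that] by (metis someI_ex)
    obtain u0 w0 where pos0: "z (w0, u0) > 0"
    proof -
      from False obtain u v where "z (u, v) \<noteq> 0" by auto
      then have "z (u, v) > 0 \<or> z (v, u) > 0" using less.prems(1)[of u v] by linarith
      then show ?thesis using that by blast
    qed
    define y where "y i = (nx ^^ i) u0" for i
    have ypos: "\<exists>w. z (w, y i) > 0" for i
    proof (induction i)
      case 0 then show ?case using pos0 by (auto simp: y_def)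
    next
      case (Suc i)
      then obtain w where "z (w, y i) > 0" by blast
      from nx[OF this] show ?case by (auto simp: y_def)
    qed
    have ystep: "z (y i, y (Suc i)) > 0" for i
    proof -
      obtain w where "z (w, y i) > 0" using ypos by blast
      from nx[OF this] show ?thesis by (simp add: y_def)
    qed
    have yA: "y i \<in> A" for i using ystep[of i] less.prems(2)[of "(y i, y (Suc i))"] by auto
    have "\<not> inj y"
      using finite_subset[of "range y" A] yA assms(1) finite_imageD[of y UNIV] by auto
    then obtain i j where ij: "i < j" "y i = y j"
      by (metis injI linorder_neqE_nat)
    \<comment> \<open>The least return time makes the cycle simple. Its edges are then distinct and
      carry positive coefficients, and subtracting it lowers the norm by exactly twice its number of
      edges.\<close>
    define k where "k = (LEAST k. 0 < k \<and> y (i + k) = y i)"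
    have "\<exists>k. 0 < k \<and> y (i + k) = y i" using ij by (intro exI[of _ "j - i"]) auto
    from LeastI_ex[OF this] have k: "0 < k" "y (i + k) = y i" unfolding k_def by auto
    have kmin: "y (i + m) \<noteq> y i" if "0 < m" "m < k" for m
      using not_less_Least[of m "\<lambda>k. 0 < k \<and> y (i + k) = y i"] that unfolding k_def by auto
    define x where "x m = y (i + m)" for m
    have xshift: "x (m + l) = (nx ^^ l) (x m)" for m l
      by (induction l) (simp_all add: x_def y_def)
    have xne: "x m \<noteq> x m'" if "m < m'" "m' < k" for m m'
    proof
      assume "x m = x m'"
      then have "x (m + (k - m')) = x (m' + (k - m'))" by (simp only: xshift)
      then have eq: "y (i + (m + (k - m'))) = y i" using that k by (simp add: x_def)
      have "0 < m + (k - m')" "m + (k - m') < k" using that by auto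
      from kmin[OF this] eq show False by (rule notE)
    qed
    have xinj: "inj_on x {..<k}"
    proof (rule inj_onI)
      fix m m' assume "m \<in> {..<k}" "m' \<in> {..<k}" "x m = x m'"
      then show "m = m'" using xne[of m m'] xne[of m' m] by (cases m m' rule: linorder_cases) auto
    qed
    define c where "c = map x [0..<Suc k]"
    have xpos: "z (x m, x (Suc m)) > 0" for m using ystep[of "i + m"] by (simp add: x_def)
    have xk: "x k = x 0" using k by (simp add: x_def)
    have cw: "closed_walk c"
    proof -
      have "d (x m) (x (Suc m)) \<le> 1" for m using xpos[of m] by (intro less.prems(3)) simp
      then have "successively (\<lambda>x y. d x y \<le> 1) c"
        by (simp add: c_def successively_conv_nth del: upt_Suc)
      moreover have "hd c = x 0" "last c = x k" by (simp_all add: c_def hd_map last_map del: upt_Suc)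
      moreover have "c \<noteq> []" by (simp add: c_def)
      ultimately show ?thesis unfolding closed_walk_def is_walk_def using xk by simp
    qed
    define E where "E = (\<lambda>m. (x m, x (Suc m))) ` {..<k}"
    have Einj: "inj_on (\<lambda>m. (x m, x (Suc m))) {..<k}" using xinj by (auto simp: inj_on_def)
    have Epos: "z p > 0" if "p \<in> E" for p using that xpos by (auto simp: E_def)
    have Esum: "(\<Sum>m<k. of_bool (p = (x m, x (Suc m)))) = (of_bool (p \<in> E) :: int)" for p
    proof -
      have "(\<Sum>m<k. of_bool (p = (x m, x (Suc m)))) = (\<Sum>q\<in>E. of_bool (p = q) :: int)"
        unfolding E_def by (subst sum.reindex[OF Einj]) simp
      also have "\<dots> = (\<Sum>q\<in>E. if q = p then 1 else 0)" by (rule sum.cong) auto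
      finally show ?thesis by (simp add: E_def)
    qed
    have chc: "walk_chain c (u, v) = of_bool ((u, v) \<in> E) - of_bool ((v, u) \<in> E)" for u v
      using Esum[of "(u, v)"] Esum[of "(v, u)"]
      unfolding c_def walk_chain_map sum_subtractf by (simp add: prod_eq_iff conj_commute)
    have EA: "E \<subseteq> A \<times> A" using yA by (auto simp: E_def x_def)
    have cardE: "card E = k" unfolding E_def using card_image[OF Einj] by simp
    have Eno: "(v, u) \<notin> E" if "(u, v) \<in> E" for u v
      using Epos[OF that] Epos[of "(v, u)"] less.prems(1)[of u v] by auto
    define z' where "z' p = z p - walk_chain c p" for p
    have absz: "\<bar>z' p\<bar> = \<bar>z p\<bar> - (of_bool (p \<in> E) + of_bool (prod.swap p \<in> E))" for p
    proof (cases p)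
      case (Pair u v)
      show ?thesis
        using Epos[of "(u, v)"] Epos[of "(v, u)"] Eno[of u v] less.prems(1)[of u v]
        by (auto simp: Pair z'_def chc)
    qed
    have fin: "finite (A \<times> A)" using assms(1) by simp
    have s1: "(\<Sum>p\<in>A \<times> A. of_bool (p \<in> E)) = int k"
    proof -
      have "(\<Sum>p\<in>A \<times> A. of_bool (p \<in> E)) = (\<Sum>p\<in>A \<times> A. if p \<in> E then 1 else (0::int))"
        by (rule sum.cong) auto
      also have "\<dots> = int (card ((A \<times> A) \<inter> E))" using fin by (simp add: sum.If_cases)
      finally show ?thesis using EA cardE by (simp add: Int_absorb1)
    qed
    have s2: "(\<Sum>p\<in>A \<times> A. of_bool (prod.swap p \<in> E)) = int k"
    proof -
      have "(\<Sum>p\<in>A \<times> A. of_bool (prod.swap p \<in> E)) = (\<Sum>p\<in>prod.swap ` (A \<times> A). of_bool (p \<in> E) :: int)"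
        by (subst sum.reindex) auto
      then show ?thesis using s1 by (simp add: product_swap)
    qed
    have norm: "(\<Sum>p\<in>A \<times> A. \<bar>z' p\<bar>) = (\<Sum>p\<in>A \<times> A. \<bar>z p\<bar>) - 2 * int k"
      unfolding absz sum_subtractf sum.distrib s1 s2 by simp
    have nonneg: "(\<Sum>p\<in>A \<times> A. \<bar>z' p\<bar>) \<ge> 0" by (rule sum_nonneg) simp
    have "\<exists>Cs. (\<forall>c\<in>set Cs. closed_walk c) \<and> (\<forall>p. z' p = (\<Sum>c\<leftarrow>Cs. walk_chain c p))
      \<and> int (\<Sum>c\<leftarrow>Cs. length c) \<le> (\<Sum>p\<in>A \<times> A. \<bar>z' p :: int\<bar>)"
    proof (rule less.hyps)
      show "nat (\<Sum>p\<in>A \<times> A. \<bar>z' p\<bar>) < nat (\<Sum>p\<in>A \<times> A. \<bar>z p\<bar>)"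
        using norm nonneg k by linarith
      show "z' (u, v) = - z' (v, u)" for u v
        using less.prems(1)[of u v] walk_chain_antisym[of c u v] by (simp add: z'_def)
      show "z' p = 0" if "p \<notin> A \<times> A" for p
        using that less.prems(2)[OF that] EA by (cases p) (auto simp: z'_def chc)
      show "d u v \<le> 1" if "z' (u, v) \<noteq> 0" for u v
      proof (rule less.prems(3))
        show "z (u, v) \<noteq> 0"
          using that Epos[of "(u, v)"] Epos[of "(v, u)"] less.prems(1)[of u v]
          by (auto simp: z'_def chc of_bool_def split: if_splits)
      qed
      fix u assume u: "u \<in> A"
      have 1: "(\<Sum>v\<in>A. of_bool ((u, v) \<in> E)) = (\<Sum>m<k. of_bool (u = x m) :: int)"
      proof -
        have "(\<Sum>v\<in>A. of_bool ((u, v) \<in> E)) = (\<Sum>v\<in>A. \<Sum>m<k. of_bool ((u, v) = (x m, x (Suc m))) :: int)"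
          by (simp only: Esum)
        also have "\<dots> = (\<Sum>m<k. \<Sum>v\<in>A. if v = x (Suc m) then of_bool (u = x m) else 0)"
          by (subst sum.swap) (intro sum.cong, auto)
        also have "\<dots> = (\<Sum>m<k. of_bool (u = x m))" using assms(1) yA by (intro sum.cong) (auto simp: x_def)
        finally show ?thesis .
      qed
      have 2: "(\<Sum>v\<in>A. of_bool ((v, u) \<in> E)) = (\<Sum>m<k. of_bool (u = x (Suc m)) :: int)"
      proof -
        have "(\<Sum>v\<in>A. of_bool ((v, u) \<in> E)) = (\<Sum>v\<in>A. \<Sum>m<k. of_bool ((v, u) = (x m, x (Suc m))) :: int)"
          by (simp only: Esum)
        also have "\<dots> = (\<Sum>m<k. \<Sum>v\<in>A. if v = x m then of_bool (u = x (Suc m)) else 0)"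
          by (subst sum.swap) (intro sum.cong, auto)
        also have "\<dots> = (\<Sum>m<k. of_bool (u = x (Suc m)))" using assms(1) yA by (intro sum.cong) (auto simp: x_def)
        finally show ?thesis .
      qed
      have 3: "(\<Sum>m<k. of_bool (u = x (Suc m)) :: int) = (\<Sum>m<k. of_bool (u = x m))"
      proof -
        have "(\<Sum>m<n. of_bool (u = x (Suc m)) :: int) = (\<Sum>m<n. of_bool (u = x m)) + of_bool (u = x n) - of_bool (u = x 0)" for n
          by (induction n) auto
        from this[of k] show ?thesis using xk by simp
      qed
      show "(\<Sum>v\<in>A. z' (u, v)) = 0"
        unfolding z'_def chc sum_subtractf 1 2 3 using less.prems(4)[OF u] by simp
    qed
    then obtain Cs where Cs: "\<forall>c\<in>set Cs. closed_walk c" "\<forall>p. z' p = (\<Sum>c\<leftarrow>Cs. walk_chain c p)"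
      "int (\<Sum>c\<leftarrow>Cs. length c) \<le> (\<Sum>p\<in>A \<times> A. \<bar>z' p :: int\<bar>)" by blast
    show ?thesis
    proof (intro exI conjI allI ballI)
      show "closed_walk e" if "e \<in> set (c # Cs)" for e using that cw Cs by auto
      show "z p = (\<Sum>c\<leftarrow>c # Cs. walk_chain c p)" for p
        using Cs(2)[rule_format, of p] by (simp add: z'_def)
      \<comment> \<open>As a list the cycle has k + 1 vertices, which is at most the 2 k by which
        the norm has dropped.\<close>
      have "length c = Suc k" by (simp add: c_def)
      then show "int (\<Sum>c\<leftarrow>c # Cs. length c) \<le> (\<Sum>p\<in>A \<times> A. \<bar>z p\<bar>)"
        using Cs(3) norm k by simp
    qed
  qed
qed

lemma walk_chain_adj: "is_walk xs \<Longrightarrow> walk_chain xs (u, v) \<noteq> 0 \<Longrightarrow> d u v \<le> 1"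
proof (induction xs rule: induct_list012)
  case (3 x y zs)
  then have "is_walk (y # zs)" "d x y \<le> 1" by (auto simp: is_walk_def)
  then show ?case using 3 d_sym[of x y]
    by (cases "walk_chain (y # zs) (u, v) = 0") (auto simp: of_bool_def split: if_splits)
qed auto

text \<open>Closed walks of bounded length play the role of 2-cells; only the chains have to
  agree.\<close>

definition is_filling :: "nat \<Rightarrow> ('v \<times> 'v \<Rightarrow> int) \<Rightarrow> 'v list list \<Rightarrow> bool" where
  "is_filling N z Ls \<longleftrightarrow> (\<forall>l\<in>set Ls. closed_walk l \<and> length l \<le> N) \<and>
     (\<forall>p. z p = (\<Sum>l\<leftarrow>Ls. walk_chain l p))"

definition linear_fillings :: "nat \<Rightarrow> nat \<Rightarrow> bool" where
  "linear_fillings N K \<longleftrightarrow>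
     (\<forall>xs. closed_walk xs \<longrightarrow> (\<exists>Ls. is_filling N (walk_chain xs) Ls \<and> length Ls \<le> K * length xs))"

lemma sum_list_chain_cycle:
  assumes "\<forall>l\<in>set Ls. closed_walk l" "finite A" "\<forall>l\<in>set Ls. set l \<subseteq> A"
  defines "z \<equiv> \<lambda>p. \<Sum>l\<leftarrow>Ls. walk_chain l p"
  shows "z (u, v) = - z (v, u)" "p \<notin> A \<times> A \<Longrightarrow> z p = 0" "z (u, v) \<noteq> 0 \<Longrightarrow> d u v \<le> 1"
    "(\<Sum>v\<in>A. z (u, v)) = 0"
    "(\<Sum>p\<in>A \<times> A. z p * (f (snd p) - f (fst p))) = 0"
proof -
  have "z (u, v) = - z (v, u) \<and> (p \<notin> A \<times> A \<longrightarrow> z p = 0) \<and> (z (u, v) \<noteq> 0 \<longrightarrow> d u v \<le> 1)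
    \<and> (\<Sum>v\<in>A. z (u, v)) = 0 \<and> (\<Sum>p\<in>A \<times> A. z p * (f (snd p) - f (fst p))) = 0"
    using assms(1,3) unfolding z_def
  proof (induction Ls)
    case (Cons l Ls)
    then have l: "is_walk l" "hd l = last l" "set l \<subseteq> A" "l \<noteq> []" by (auto simp: closed_walk_def is_walk_def)
    let ?z = "\<lambda>p. \<Sum>l\<leftarrow>Ls. walk_chain l p"
    have IH: "?z (u, v) = - ?z (v, u)" "p \<notin> A \<times> A \<longrightarrow> ?z p = 0" "?z (u, v) \<noteq> 0 \<longrightarrow> d u v \<le> 1"
      "(\<Sum>v\<in>A. ?z (u, v)) = 0" "(\<Sum>p\<in>A \<times> A. ?z p * (f (snd p) - f (fst p))) = 0"
      using Cons by auto
    have 2: "p \<notin> A \<times> A \<longrightarrow> walk_chain l p = 0" using l walk_chain_outside[of p l] by auto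
    have 3: "walk_chain l (u, v) \<noteq> 0 \<longrightarrow> d u v \<le> 1" using walk_chain_adj[OF l(1)] by blast
    have 4: "(\<Sum>v\<in>A. walk_chain l (u, v)) = 0"
      using walk_chain_divergence[OF assms(2) l(3,4)] l(2) by simp
    have 5: "(\<Sum>p\<in>A \<times> A. walk_chain l p * (f (snd p) - f (fst p))) = 0"
      using walk_chain_pairing[OF assms(2) l(3,4), of f] l(2) by simp
    have "?z (u, v) = 0 \<Longrightarrow> walk_chain l (u, v) = 0 \<Longrightarrow> walk_chain l (u, v) + ?z (u, v) = 0" by simp
    then have 6: "walk_chain l (u, v) + ?z (u, v) \<noteq> 0 \<longrightarrow> d u v \<le> 1" using IH(3) 3 by blast
    show ?case
      using IH(1,2,4,5) 2 4 5 6 walk_chain_antisym[of l u v]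
      by (simp add: sum.distrib distrib_right)
  qed simp
  then show "z (u, v) = - z (v, u)" "p \<notin> A \<times> A \<Longrightarrow> z p = 0" "z (u, v) \<noteq> 0 \<Longrightarrow> d u v \<le> 1"
    "(\<Sum>v\<in>A. z (u, v)) = 0"
    "(\<Sum>p\<in>A \<times> A. z p * (f (snd p) - f (fst p))) = 0" by blast+
qed

text \<open>The linear bound for closed walks passes to sums of them through
  \<open>cycle_decomposition\<close>, with the norm of the cycle in place of the length. The norm
  sees the cancellation between the walks, which makes it efficient to refill a part of a
  filling.\<close>

lemma cycle_filling:
  assumes lf: "linear_fillings N K" and Ls: "\<forall>l\<in>set Ls. closed_walk l" "finite A" "\<forall>l\<in>set Ls. set l \<subseteq> A"
  shows "\<exists>Ls'. is_filling N (\<lambda>p. \<Sum>l\<leftarrow>Ls. walk_chain l p) Ls' \<and>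
    int (length Ls') \<le> int K * (\<Sum>p\<in>A \<times> A. \<bar>\<Sum>l\<leftarrow>Ls. walk_chain l p\<bar>)"
proof -
  let ?z = "\<lambda>p. \<Sum>l\<leftarrow>Ls. walk_chain l p"
  note cyc = sum_list_chain_cycle[OF Ls]
  from cycle_decomposition[OF Ls(2) cyc(1-4)] obtain Cs where Cs: "\<forall>c\<in>set Cs. closed_walk c"
    "\<forall>p. ?z p = (\<Sum>c\<leftarrow>Cs. walk_chain c p)"
    "int (\<Sum>c\<leftarrow>Cs. length c) \<le> (\<Sum>p\<in>A \<times> A. \<bar>?z p\<bar>)" by auto
  have "\<exists>Ls'. is_filling N (\<lambda>p. \<Sum>c\<leftarrow>Cs. walk_chain c p) Ls' \<and> length Ls' \<le> K * (\<Sum>c\<leftarrow>Cs. length c)"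
    using Cs(1)
  proof (induction Cs)
    case Nil
    then show ?case by (intro exI[of _ "[]"]) (simp add: is_filling_def)
  next
    case (Cons c Cs)
    then obtain L1 where L1: "is_filling N (\<lambda>p. \<Sum>c\<leftarrow>Cs. walk_chain c p) L1" "length L1 \<le> K * (\<Sum>c\<leftarrow>Cs. length c)"
      by auto
    from Cons lf obtain L2 where L2: "is_filling N (walk_chain c) L2" "length L2 \<le> K * length c"
      unfolding linear_fillings_def by auto
    show ?case
      by (rule exI[of _ "L2 @ L1"]) (use L1 L2 in \<open>auto simp: is_filling_def algebra_simps\<close>)
  qed
  then obtain Ls' where "is_filling N ?z Ls'" "length Ls' \<le> K * (\<Sum>c\<leftarrow>Cs. length c)"
    using Cs(2) by (auto simp: is_filling_def)
  moreover from this(2) have "int (length Ls') \<le> int K * int (\<Sum>c\<leftarrow>Cs. length c)"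
    by (metis of_nat_mono of_nat_mult)
  ultimately show ?thesis using Cs(3) by (meson mult_left_mono of_nat_0_le_iff order_trans)
qed

section \<open>Geodesics\<close>

definition is_geodesic :: "(nat \<Rightarrow> 'v) \<Rightarrow> nat \<Rightarrow> bool" where
  "is_geodesic g n \<longleftrightarrow> (\<forall>i\<le>n. \<forall>j\<le>n. i \<le> j \<longrightarrow> d (g i) (g j) = j - i)"

lemma geodesic_dist:
  assumes "is_geodesic g n" "i \<le> j" "j \<le> n"
  shows "d (g i) (g j) = j - i" "d (g j) (g i) = j - i"
proof -
  show "d (g i) (g j) = j - i" using assms unfolding is_geodesic_def by (meson order_trans)
  then show "d (g j) (g i) = j - i" by (subst d_sym)
qed

lemma geodesic_rev:
  assumes "is_geodesic g n" shows "is_geodesic (\<lambda>i. g (n - i)) n"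
  unfolding is_geodesic_def
proof (intro allI impI)
  fix i j assume "i \<le> n" "j \<le> n" "i \<le> j"
  then show "d (g (n - i)) (g (n - j)) = j - i"
    using geodesic_dist(2)[OF assms, of "n - j" "n - i"] by simp
qed

lemma geodesic_shift:
  assumes "is_geodesic g n" "k + m \<le> n" shows "is_geodesic (\<lambda>i. g (k + i)) m"
  unfolding is_geodesic_def
proof (intro allI impI)
  fix i j assume "i \<le> m" "j \<le> m" "i \<le> j"
  then show "d (g (k + i)) (g (k + j)) = j - i"
    using geodesic_dist(1)[OF assms(1), of "k + i" "k + j"] assms(2) by simp
qed

lemma geodesic_exists: "\<exists>g. is_geodesic g (d x y) \<and> g 0 = x \<and> g (d x y) = y"
proof (induction "d x y" arbitrary: x)
  case 0
  then show ?case by (intro exI[of _ "\<lambda>_. x"]) (auto simp: is_geodesic_def)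
next
  case (Suc n)
  obtain z where z: "d x z = 1" "d z y = n" using d_step[of x y n] Suc(2) by auto
  from Suc(1)[of z] z obtain g where g: "is_geodesic g n" "g 0 = z" "g n = y" by auto
  have *: "d x (g k) = Suc k" if "k \<le> n" for k
    using d_tri[of x "g k" z] d_tri[of x y "g k"] geodesic_dist(1)[OF g(1), of 0 k]
      geodesic_dist(1)[OF g(1), of k n] z g that Suc(2) by simp
  show ?case unfolding Suc(2)[symmetric]
    by (rule exI[of _ "case_nat x g"])
       (use g * in \<open>auto simp: is_geodesic_def split: nat.splits\<close>)
qed

lemma geodesic_walk:
  assumes "is_geodesic g n" shows "is_walk (map g [0..<Suc n])"
  unfolding is_walk_def successively_conv_nth
proof (intro conjI allI impI)
  fix i assume "Suc i < length (map g [0..<Suc n])"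
  then show "d (map g [0..<Suc n] ! i) (map g [0..<Suc n] ! Suc i) \<le> 1"
    using geodesic_dist(1)[OF assms, of i "Suc i"] by (simp del: upt_Suc)
qed simp

end

section \<open>Linear fillings imply the four-point condition\<close>

context nat_metric begin

text \<open>In a minimal filling of a closed walk consisting of a geodesic and a walk far away from a
  point \<open>g i0\<close> of it, let \<open>a s\<close> be the number of loops meeting the ball of radius \<open>s\<close> around this
  point. The boundary of this part of the filling consists of a geodesic piece, which is no longer
  than the rest, and the rest is carried by the loops leaving the ball. Hence \<open>a\<close> grows
  exponentially.\<close>

lemma walk_chain_upt_split:
  assumes "b \<le> m" "m < e"
  shows "walk_chain (map g [b..<e]) p = walk_chain (map g [b..<Suc m]) p + walk_chain (map g [m..<e]) p"
proof -
  have e: "[b..<e] = [b..<m] @ [m..<e]" using upt_add_eq_append[of b m "e - m"] assms by simp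
  have c: "[m..<e] = m # [Suc m..<e]" using assms by (simp add: upt_conv_Cons)
  have "map g [b..<e] = map g [b..<m] @ [g m] @ map g [Suc m..<e]" unfolding e c by simp
  moreover have "map g [b..<Suc m] = map g [b..<m] @ [g m]" using assms by simp
  moreover have "map g [m..<e] = g m # map g [Suc m..<e]" unfolding c by simp
  ultimately show ?thesis using walk_chain_append[of "map g [b..<m]" "g m" "map g [Suc m..<e]" p] by metis
qed

lemma filling_growth:
  assumes lf: "linear_fillings N K" and N: "N \<ge> 1" and K: "K \<ge> 1"
    and g: "is_geodesic g n" and i0: "i0 \<le> n"
    and q: "is_walk q" "hd q = g 0" "last q = g n"
    and far: "\<And>v. v \<in> set q \<Longrightarrow> j * N < d (g i0) v"
  shows "(4 * K * N) ^ j \<le> (4 * K * N - 1) ^ j * (2 * K * length q)"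
proof -
  define c where "c = map g [0..<n] @ [g n] @ tl (rev q)"
  have qne: "q \<noteq> []" using q by (auto simp: is_walk_def)
  have rq: "rev q = g n # tl (rev q)"
    using qne q(3) by (metis hd_rev list.collapse rev_is_Nil_conv)
  have geol: "map g [0..<Suc n] = map g [0..<n] @ [g n]" by simp
  have cw: "closed_walk c"
  proof -
    have "is_walk (map g [0..<n] @ [g n])" using geodesic_walk[OF g] by simp
    moreover have "is_walk (g n # tl (rev q))" using q(1) rq is_walk_rev by metis
    ultimately have "is_walk c" unfolding c_def using is_walk_append by blast
    moreover have "hd c = g 0" by (cases n) (simp_all add: c_def hd_append upt_rec)
    moreover have "last c = g 0"
      using q(2) qne rq unfolding c_def by (metis last_appendR last_rev append_Cons append_Nil list.distinct(1))
    ultimately show ?thesis by (simp add: closed_walk_def)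
  qed
  define z where "z = walk_chain c"
  have z: "z p = walk_chain (map g [0..<Suc n]) p - walk_chain q p" for p
    unfolding z_def c_def walk_chain_append geol[symmetric] rq[symmetric] walk_chain_rev by simp
  have lenc: "length c = n + length q" using qne by (simp add: c_def) 
  have nq: "n < length q"
  proof -
    have "d (hd q) (last q) \<le> length (tl q)"
      using walk_dist[of "hd q" "tl q" "last q"] q(1) qne by simp
    then have "n \<le> length q - 1" using q geodesic_dist(1)[OF g, of 0 n] by simp
    then show ?thesis using qne by (cases q) auto
  qed
  obtain L0 where L0: "is_filling N z L0" "length L0 \<le> K * length c"
    using lf cw unfolding linear_fillings_def z_def by blast
  obtain Ls where Ls: "is_filling N z Ls" and min: "\<And>Ls'. is_filling N z Ls' \<Longrightarrow> length Ls \<le> length Ls'"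
    using ex_has_least_nat[of "is_filling N z" L0 length] L0(1) by blast
  have lenLs: "length Ls \<le> 2 * K * length q"
  proof -
    have "length Ls \<le> K * length c" using min[OF L0(1)] L0(2) by linarith
    also have "\<dots> \<le> K * (2 * length q)" using lenc nq by (intro mult_left_mono) auto
    finally show ?thesis by (simp add: algebra_simps)
  qed
  define A where "A = (\<Union>l\<in>set Ls. set l) \<union> set (map g [0..<Suc n])"
  have finA: "finite A" by (simp add: A_def)
  define P where "P s l \<longleftrightarrow> (\<exists>v\<in>set l. d (g i0) v \<le> s)" for s l
  define F where "F s = filter (P s) Ls" for s
  define a where "a s = length (F s)" for s
  have LsD: "closed_walk l" "length l \<le> N" "is_walk l" "set l \<subseteq> A" if "l \<in> set Ls" for l
    using Ls that by (auto simp: is_filling_def closed_walk_def A_def)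
  have key: "0 < a s \<and> (N \<le> s \<longrightarrow> a s \<le> 4 * K * N * (a s - a (s - N)))"
    if s: "s \<le> j * N" for s
  proof -
    have far': "s < d (g i0) v" if "v \<in> set q" for v using far[OF that] s by simp
    \<comment> \<open>The endpoints of \<open>g\<close> lie on \<open>q\<close>, outside the ball,
      so the ball of radius \<open>s\<close> meets \<open>g\<close> only strictly inside it, and
      \<open>seg\<close> fits.\<close>
    have i1: "s < i0" using far'[of "g 0"] q(2) qne geodesic_dist(2)[OF g, of 0 i0] i0 by (metis diff_zero hd_in_set le0)
    have i2: "i0 + s < n" using far'[of "g n"] q(3) qne geodesic_dist(1)[OF g i0 order_refl] last_in_set[OF qne] by simp
    define zs where "zs p = (\<Sum>l\<leftarrow>F s. walk_chain l p)" for p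
    define T where "T = {p. d (g i0) (fst p) \<le> s \<or> d (g i0) (snd p) \<le> s}"
    define x where "x m = g (i0 - Suc s + m)" for m
    define seg where "seg = map x [0..<Suc (2 * s + 2)]"
    have Fsub: "set (F s) \<subseteq> set Ls" by (auto simp: F_def)
    note cyc = sum_list_chain_cycle[of "F s" A, folded zs_def]
    have Fc: "\<forall>l\<in>set (F s). closed_walk l" "\<forall>l\<in>set (F s). set l \<subseteq> A"
      using Fsub LsD(1,4) by blast+
    have split: "(\<Sum>l\<leftarrow>Ls. h l) = (\<Sum>l\<leftarrow>F s. h l) + (\<Sum>l\<leftarrow>filter (\<lambda>l. \<not> P s l) Ls. h l)" for h :: "'v list \<Rightarrow> int"
      unfolding F_def by (induction Ls) auto
    have zz: "z p = zs p + (\<Sum>l\<leftarrow>filter (\<lambda>l. \<not> P s l) Ls. walk_chain l p)" for p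
      using Ls split[of "\<lambda>l. walk_chain l p"] unfolding is_filling_def zs_def by metis
    \<comment> \<open>The loops meeting the ball may be replaced by an efficient filling of their
      sum; by minimality this cannot reduce their number.\<close>
    have le1: "int (a s) \<le> int K * (\<Sum>p\<in>A \<times> A. \<bar>zs p\<bar>)"
    proof -
      obtain L' where L': "is_filling N zs L'" "int (length L') \<le> int K * (\<Sum>p\<in>A \<times> A. \<bar>zs p\<bar>)"
        using cycle_filling[OF lf Fc(1) finA Fc(2)] unfolding zs_def by blast
      have "is_filling N z (L' @ filter (\<lambda>l. \<not> P s l) Ls)"
        using L'(1) LsD zz by (auto simp: is_filling_def)
      from min[OF this] have "length Ls \<le> length L' + length (filter (\<lambda>l. \<not> P s l) Ls)" by simp
      moreover have "length Ls = a s + length (filter (\<lambda>l. \<not> P s l) Ls)"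
        unfolding a_def F_def by (simp add: sum_length_filter_compl)
      ultimately have "a s \<le> length L'" by simp
      then show ?thesis using L'(2) by simp
    qed

    have xd: "d (g i0) (x m) = (if m \<le> Suc s then Suc s - m else m - Suc s)" if "m \<le> 2 * s + 2" for m
      using that i1 i2 geodesic_dist(2)[OF g, of "i0 - Suc s + m" i0] geodesic_dist(1)[OF g, of i0 "i0 - Suc s + m"]
      by (auto simp: x_def)
    \<comment> \<open>On the edges that meet the ball the other loops and \<open>q\<close>
      contribute nothing, so the sum of the loops of \<open>F s\<close> agrees there with the
      geodesic, whose only edges of this kind are those of \<open>seg\<close>.\<close>
    have onT: "zs p = walk_chain seg p" if pT: "p \<in> T" for p
    proof -
      have 0: "(\<Sum>l\<leftarrow>Ms. walk_chain l p) = 0" if "\<forall>l\<in>set Ms. \<not> P s l" for Ms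
        using that
      proof (induction Ms)
        case (Cons l Ms)
        then have "p \<notin> set l \<times> set l" using pT by (auto simp: P_def T_def)
        then show ?case using Cons by (simp add: walk_chain_outside)
      qed simp
      have q0: "walk_chain q p = 0"
      proof (rule walk_chain_outside)
        show "p \<notin> set q \<times> set q" using far' pT by (force simp: T_def)
      qed
      have out: "walk_chain (map g [b..<e]) p = 0" if "\<forall>i\<in>{b..<e}. s < d (g i0) (g i)" for b e
      proof (rule walk_chain_outside)
        show "p \<notin> set (map g [b..<e]) \<times> set (map g [b..<e])" using that pT by (force simp: T_def)
      qed
      have seg: "seg = map g [i0 - Suc s..<Suc (i0 + Suc s)]"
      proof -
        have "[i0 - Suc s..<Suc (i0 + Suc s)] = map (\<lambda>m. m + (i0 - Suc s)) [0..<Suc (2 * s + 2)]"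
          unfolding map_add_upt using i1 by (intro arg_cong2[where f = upt]) auto
        then have "map g [i0 - Suc s..<Suc (i0 + Suc s)] = map (\<lambda>m. g (m + (i0 - Suc s))) [0..<Suc (2 * s + 2)]"
          by (simp add: o_def del: upt_Suc)
        also have "\<dots> = seg" unfolding seg_def x_def by (simp only: add.commute)
        finally show ?thesis ..
      qed
      have "walk_chain (map g [0..<Suc n]) p =
          walk_chain (map g [0..<Suc (i0 - Suc s)]) p + walk_chain (map g [i0 - Suc s..<Suc n]) p"
        by (rule walk_chain_upt_split) (use i1 i2 in auto)
      also have "walk_chain (map g [0..<Suc (i0 - Suc s)]) p = 0"
      proof (rule out, rule ballI)
        fix i assume "i \<in> {0..<Suc (i0 - Suc s)}"
        then show "s < d (g i0) (g i)" using geodesic_dist(2)[OF g, of i i0] i0 i1 by auto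
      qed
      also have "walk_chain (map g [i0 - Suc s..<Suc n]) p = walk_chain seg p + walk_chain (map g [i0 + Suc s..<Suc n]) p"
        unfolding seg by (rule walk_chain_upt_split) (use i2 in auto)
      also have "walk_chain (map g [i0 + Suc s..<Suc n]) p = 0"
      proof (rule out, rule ballI)
        fix i assume "i \<in> {i0 + Suc s..<Suc n}"
        then show "s < d (g i0) (g i)" using geodesic_dist(1)[OF g, of i0 i] by auto
      qed
      finally have "walk_chain (map g [0..<Suc n]) p = walk_chain seg p" by simp
      then show ?thesis using zz[of p] z[of p] q0 0[of "filter (\<lambda>l. \<not> P s l) Ls"] by simp
    qed
    have offT: "walk_chain seg p = 0" if "p \<notin> T" for p
      unfolding seg_def walk_chain_map
    proof (rule sum.neutral, rule ballI)
      fix m assume "m \<in> {..<2 * s + 2}"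
      then have "d (g i0) (x m) \<le> s \<or> d (g i0) (x (Suc m)) \<le> s" using xd[of m] xd[of "Suc m"] by auto
      then have "p \<noteq> (x m, x (Suc m))" "p \<noteq> (x (Suc m), x m)" using that by (auto simp: T_def)
      then show "of_bool (p = (x m, x (Suc m))) - of_bool (p = (x (Suc m), x m)) = (0::int)" by simp
    qed
    define R where "R p = zs p - walk_chain seg p" for p
    have segA: "set seg \<subseteq> A" using i1 i2 by (auto simp: seg_def x_def A_def simp del: upt_Suc)
    have seg_walk: "is_walk seg"
    proof -
      have "is_geodesic x (2 * s + 2)" unfolding x_def by (rule geodesic_shift[OF g]) (use i1 i2 in simp)
      then show ?thesis unfolding seg_def by (rule geodesic_walk)
    qed
    \<comment> \<open>The remainder \<open>R\<close> has to close up the geodesic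
      \<open>seg\<close>. Pairing with the distance from its initial point, which changes by at most
      1 along an edge, detects the full length of \<open>seg\<close>, and the cycle
      \<open>zs\<close> pairs to zero.\<close>
    have Rlow: "2 * int (2 * s + 2) \<le> (\<Sum>p\<in>A \<times> A. \<bar>R p\<bar>)"
    proof -
      define f where "f v = int (d (x 0) v)" for v
      have 1: "(\<Sum>p\<in>A \<times> A. zs p * (f (snd p) - f (fst p))) = 0"
        using cyc(5)[OF Fc(1) finA Fc(2)] .
      have "hd seg = x 0" "last seg = x (2 * s + 2)" "seg \<noteq> []"
        by (simp_all add: seg_def hd_map last_map del: upt_Suc)
      moreover have "d (x 0) (x (2 * s + 2)) = 2 * s + 2"
        unfolding x_def using i1 i2 by (subst geodesic_dist(1)[OF g]) auto
      ultimately have 2: "(\<Sum>p\<in>A \<times> A. walk_chain seg p * (f (snd p) - f (fst p))) = 2 * int (2 * s + 2)"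
        using walk_chain_pairing[OF finA segA, of f] by (simp add: f_def)
      have "2 * int (2 * s + 2) = - (\<Sum>p\<in>A \<times> A. R p * (f (snd p) - f (fst p)))"
        using 1 2 by (simp add: R_def left_diff_distrib sum_subtractf)
      also have "\<dots> \<le> (\<Sum>p\<in>A \<times> A. \<bar>R p * (f (snd p) - f (fst p))\<bar>)"
        using sum_abs[of "\<lambda>p. R p * (f (snd p) - f (fst p))" "A \<times> A"] by linarith
      also have "\<dots> \<le> (\<Sum>p\<in>A \<times> A. \<bar>R p\<bar>)"
      proof (rule sum_mono)
        fix p
        show "\<bar>R p * (f (snd p) - f (fst p))\<bar> \<le> \<bar>R p\<bar>"
        proof (cases "R p = 0")
          case False
          then have "zs p \<noteq> 0 \<or> walk_chain seg p \<noteq> 0" by (auto simp: R_def)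
          then have "d (fst p) (snd p) \<le> 1"
            using cyc(3)[OF Fc(1) finA Fc(2), of "fst p" "snd p"] walk_chain_adj[OF seg_walk, of "fst p" "snd p"] by auto
          then have "\<bar>f (snd p) - f (fst p)\<bar> \<le> 1"
            using d_tri[of "x 0" "snd p" "fst p"] d_tri[of "x 0" "fst p" "snd p"] d_sym[of "fst p" "snd p"]
            by (simp add: f_def)
          then show ?thesis using mult_left_mono[of "\<bar>f (snd p) - f (fst p)\<bar>" 1 "\<bar>R p\<bar>"] by (simp add: abs_mult)
        qed simp
      qed
      finally show ?thesis by simp
    qed
    have zsR: "(\<Sum>p\<in>A \<times> A. \<bar>zs p\<bar>) \<le> 2 * (\<Sum>p\<in>A \<times> A. \<bar>R p\<bar>)"
    proof -
      have "(\<Sum>p\<in>A \<times> A. \<bar>zs p\<bar>) \<le> (\<Sum>p\<in>A \<times> A. \<bar>walk_chain seg p\<bar> + \<bar>R p\<bar>)"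
        by (rule sum_mono) (simp add: R_def)
      also have "\<dots> = (\<Sum>p\<in>A \<times> A. \<bar>walk_chain seg p\<bar>) + (\<Sum>p\<in>A \<times> A. \<bar>R p\<bar>)" by (rule sum.distrib)
      also have "(\<Sum>p\<in>A \<times> A. \<bar>walk_chain seg p\<bar>) \<le> 2 * int (2 * s + 2)"
        using walk_chain_norm_le[OF finA, of seg] by (simp add: seg_def del: upt_Suc)
      finally show ?thesis using Rlow by linarith
    qed
    have Rz: "R p = (if p \<in> T then 0 else zs p)" for p
      using onT[of p] offT[of p] by (simp add: R_def)
    have pos: "0 < a s"
    proof (rule ccontr)
      assume "\<not> 0 < a s"
      then have "F s = []" by (simp add: a_def)
      then have "R p = 0" for p using Rz[of p] by (simp add: zs_def)
      then show False using Rlow by simp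
    qed
    have "a s \<le> 4 * K * N * (a s - a (s - N))" if Ns: "N \<le> s"
    proof -
      define D where "D = filter (\<lambda>l. P s l \<and> \<not> P (s - N) l) Ls"
      \<comment> \<open>Only the loops in \<open>D\<close> contribute to \<open>R\<close>: a loop
        meeting the smaller ball has length at most \<open>N\<close>, so it stays in the ball of
        radius \<open>s\<close>, where \<open>R\<close> vanishes.\<close>
      have PP: "P s l" if "P (s - N) l" for l using that by (force simp: P_def)
      have lenD: "a s = a (s - N) + length D"
        unfolding a_def F_def D_def using PP by (induction Ls) auto
      have zsD: "\<bar>R p\<bar> \<le> (\<Sum>l\<leftarrow>D. \<bar>walk_chain l p\<bar>)" for p
      proof (cases "p \<in> T")
        case True
        have "0 \<le> (\<Sum>l\<leftarrow>D. \<bar>walk_chain l p\<bar>)" by (rule sum_list_nonneg) auto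
        then show ?thesis unfolding Rz[of p] using True by simp
      next
        case False
        have "\<bar>\<Sum>l\<leftarrow>filter (P s) Ms. walk_chain l p\<bar> \<le> (\<Sum>l\<leftarrow>filter (\<lambda>l. P s l \<and> \<not> P (s - N) l) Ms. \<bar>walk_chain l p\<bar>)"
          if "set Ms \<subseteq> set Ls" for Ms
          using that
        proof (induction Ms)
          case (Cons l Ms)
          have "walk_chain l p = 0" if "P (s - N) l"
          proof (rule walk_chain_outside)
            obtain v where v: "v \<in> set l" "d (g i0) v \<le> s - N" using \<open>P (s - N) l\<close> by (auto simp: P_def)
            have "d (g i0) w \<le> s" if "w \<in> set l" for w
              using walk_dist_any[OF LsD(3) v(1) that] LsD(2)[of l] Cons.prems d_tri[of "g i0" w v] v(2) Ns by auto
            then show "p \<notin> set l \<times> set l" using False by (auto simp: T_def)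
          qed
          then show ?case using Cons PP[of l] by auto
        qed simp
        from this[of Ls] show ?thesis using Rz[of p] False by (simp add: zs_def F_def D_def)
      qed
      have sumD: "(\<Sum>p\<in>A \<times> A. \<Sum>l\<leftarrow>Ms. \<bar>walk_chain l p\<bar>) \<le> int (2 * N) * int (length Ms)" if "set Ms \<subseteq> set Ls" for Ms
        using that
      proof (induction Ms)
        case (Cons l Ms)
        have "(\<Sum>p\<in>A \<times> A. \<bar>walk_chain l p\<bar>) \<le> 2 * int N"
          using walk_chain_norm_le[OF finA, of l] LsD(2)[of l] Cons.prems by auto
        then show ?case using Cons by (simp add: sum.distrib algebra_simps)
      qed simp
      have "int (a s) \<le> int K * (2 * (\<Sum>p\<in>A \<times> A. \<bar>R p\<bar>))"
        using le1 zsR mult_left_mono[OF zsR, of "int K"] by linarith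
      moreover have "(\<Sum>p\<in>A \<times> A. \<bar>R p\<bar>) \<le> (\<Sum>p\<in>A \<times> A. \<Sum>l\<leftarrow>D. \<bar>walk_chain l p\<bar>)"
        by (rule sum_mono) (rule zsD)
      moreover have "\<dots> \<le> int (2 * N) * int (length D)" by (rule sumD) (auto simp: D_def)
      ultimately have "int (a s) \<le> int K * (2 * (int (2 * N) * int (length D)))"
        by (meson mult_left_mono of_nat_0_le_iff order_trans zero_le_numeral)
      then have "int (a s) \<le> int (4 * K * N * length D)"
        by (simp add: algebra_simps)
      then have "a s \<le> 4 * K * N * length D" by (simp only: of_nat_le_iff)
      then show ?thesis using lenD by simp
    qed
    then show ?thesis using pos by blast
  qed
  define M where "M = 4 * K * N"
  have M: "M \<ge> 4" using N K by (simp add: M_def)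
  \<comment> \<open>The recursion in \<open>key\<close> says that M times the count at radius s - N
    is at most M - 1 times the count at radius s, that is, geometric growth.\<close>
  have "M ^ i \<le> (M - 1) ^ i * a (i * N)" if "i \<le> j" for i
    using that
  proof (induction i)
    case 0
    then show ?case using key[of 0] by simp
  next
    case (Suc i)
    have "a (Suc i * N) \<le> M * (a (Suc i * N) - a (i * N))"
      using key[of "Suc i * N"] mult_le_mono1[OF Suc.prems, of N] by (simp add: M_def)
    then have "a (Suc i * N) \<le> M * a (Suc i * N) - M * a (i * N)"
      by (simp only: diff_mult_distrib2)
    moreover have "0 < a (Suc i * N)"
      using key[of "Suc i * N"] mult_le_mono1[OF Suc.prems, of N] by simp
    ultimately have "M * a (i * N) \<le> M * a (Suc i * N) - a (Suc i * N)" by linarith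
    then have "M * a (i * N) \<le> (M - 1) * a (Suc i * N)"
      by (simp only: diff_mult_distrib mult_1)
    then have "(M - 1) ^ i * (M * a (i * N)) \<le> (M - 1) ^ i * ((M - 1) * a (Suc i * N))" by simp
    moreover have "M * M ^ i \<le> M * ((M - 1) ^ i * a (i * N))" using Suc by simp
    ultimately have "M * M ^ i \<le> (M - 1) ^ i * ((M - 1) * a (Suc i * N))"
      by (metis mult.left_commute order_trans)
    then show ?case by (simp only: power_Suc mult.assoc mult.left_commute)
  qed
  from this[of j] have "M ^ j \<le> (M - 1) ^ j * a (j * N)" by simp
  also have "\<dots> \<le> (M - 1) ^ j * (2 * K * length q)"
    using order_trans[OF length_filter_le lenLs, of "P (j * N)"] by (intro mult_left_mono) (auto simp: a_def F_def)
  finally show ?thesis by (simp add: M_def)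
qed

section \<open>Short detours around a ball\<close>

definition avoiding :: "'v \<Rightarrow> nat \<Rightarrow> 'v \<Rightarrow> 'v \<Rightarrow> nat \<Rightarrow> bool" where
  "avoiding p r a b n \<longleftrightarrow> (\<exists>xs. is_walk xs \<and> hd xs = a \<and> last xs = b \<and> length xs \<le> Suc n \<and>
     (\<forall>v\<in>set xs. r \<le> d p v))"

lemma avoiding_trans:
  assumes "avoiding p r a b n" "avoiding p r b c m" shows "avoiding p r a c (n + m)"
proof -
  obtain xs ys where xs: "is_walk xs" "hd xs = a" "last xs = b" "length xs \<le> Suc n" "\<forall>v\<in>set xs. r \<le> d p v"
    and ys: "is_walk ys" "hd ys = b" "last ys = c" "length ys \<le> Suc m" "\<forall>v\<in>set ys. r \<le> d p v"
    using assms unfolding avoiding_def by blast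
  have ne: "xs \<noteq> []" "ys \<noteq> []" using xs ys by (auto simp: is_walk_def)
  have x: "butlast xs @ [b] = xs" using ne xs(3) append_butlast_last_id by blast
  have y: "b # tl ys = ys" using ne ys(2) list.collapse by blast
  let ?w = "butlast xs @ [b] @ tl ys"
  have w: "?w = xs @ tl ys" using x by (metis append.assoc)
  have "is_walk ?w" using is_walk_append[of "butlast xs" b "tl ys"] x y xs(1) ys(1) by simp
  moreover have "hd ?w = a" unfolding w using ne xs by simp
  moreover have "last ?w = c" using y ys(3) by (metis append_Cons append_Nil last_appendR list.distinct(1))
  moreover have "length ?w \<le> Suc (n + m)" unfolding w using ne xs(4) ys(4) by (cases ys) auto
  moreover have "\<forall>v\<in>set ?w. r \<le> d p v" unfolding w using xs(5) ys(5) ne by (auto dest: list.set_sel(2))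
  ultimately show ?thesis unfolding avoiding_def by blast
qed

lemma avoiding_sym:
  assumes "avoiding p r a b n" shows "avoiding p r b a n"
proof -
  from assms obtain xs where xs: "is_walk xs" "hd xs = a" "last xs = b" "length xs \<le> Suc n" "\<forall>v\<in>set xs. r \<le> d p v"
    unfolding avoiding_def by blast
  have "hd (rev xs) = b" "last (rev xs) = a" using xs by (simp_all add: hd_rev last_rev)
  then show ?thesis unfolding avoiding_def using xs is_walk_rev[of xs] by (intro exI[of _ "rev xs"]) simp
qed

lemma avoiding_mono:
  assumes "avoiding p r a b n" "n \<le> m" shows "avoiding p r a b m"
proof -
  from assms(1) obtain xs where "is_walk xs" "hd xs = a" "last xs = b" "length xs \<le> Suc n" "\<forall>v\<in>set xs. r \<le> d p v"
    unfolding avoiding_def by blast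
  moreover from this(4) have "length xs \<le> Suc m" using assms(2) by linarith
  ultimately show ?thesis unfolding avoiding_def by blast
qed

lemma avoiding_geodesic:
  assumes "is_geodesic g n" "i \<le> j" "j \<le> n" "\<And>k. i \<le> k \<Longrightarrow> k \<le> j \<Longrightarrow> r \<le> d p (g k)"
  shows "avoiding p r (g i) (g j) (j - i)"
proof -
  define xs where "xs = map (\<lambda>k. g (i + k)) [0..<Suc (j - i)]"
  have "is_walk xs" unfolding xs_def
    by (rule geodesic_walk[OF geodesic_shift[OF assms(1)]]) (use assms in simp)
  moreover have "hd xs = g i" "last xs = g j" "length xs \<le> Suc (j - i)"
    using assms(2) by (simp_all add: xs_def hd_map last_map del: upt_Suc)
  moreover have "\<forall>v\<in>set xs. r \<le> d p v" using assms(2,4) by (auto simp: xs_def simp del: upt_Suc)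
  ultimately show ?thesis unfolding avoiding_def by blast
qed

lemma avoiding_geodesic':
  assumes "is_geodesic g n" "i \<le> n" "j \<le> n" "\<And>k. k \<le> n \<Longrightarrow> r \<le> d p (g k)"
  shows "avoiding p r (g i) (g j) (d (g i) (g j))"
proof (cases "i \<le> j")
  case True
  then show ?thesis using avoiding_geodesic[OF assms(1) True assms(3), of r p] assms geodesic_dist(1)[OF assms(1) True assms(3)] by simp
next
  case False
  then have ji: "j \<le> i" by simp
  show ?thesis
    using avoiding_sym[OF avoiding_geodesic[OF assms(1) ji assms(2), of r p]] assms geodesic_dist(2)[OF assms(1) ji assms(2)] by simp
qed

lemma avoiding_ball:
  assumes "d a b \<le> m" "r + m \<le> d p a" shows "avoiding p r a b m"
proof -
  obtain g where g: "is_geodesic g (d a b)" "g 0 = a" "g (d a b) = b" using geodesic_exists by blast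
  have "r \<le> d p (g k)" if "k \<le> d a b" for k
    using d_tri[of p a "g k"] geodesic_dist(2)[OF g(1), of 0 k] g(2) that assms by simp
  then have "avoiding p r a b (d a b)" using avoiding_geodesic'[OF g(1), of 0 "d a b" r p] g by simp
  then show ?thesis using assms(1) avoiding_mono by blast
qed

text \<open>Bounding the perimeter by \<open>L\<close> guarantees that some \<open>R\<close> works,
  namely \<open>L\<close> itself, so there is a least one. The task is to bound it independently of
  \<open>L\<close>.\<close>

definition slim :: "nat \<Rightarrow> nat \<Rightarrow> bool" where
  "slim L R \<longleftrightarrow> (\<forall>g1 n1 g2 n2 g3 n3. is_geodesic g1 n1 \<longrightarrow> is_geodesic g2 n2 \<longrightarrow> is_geodesic g3 n3 \<longrightarrow>
     g1 0 = g2 0 \<longrightarrow> g1 n1 = g3 0 \<longrightarrow> g2 n2 = g3 n3 \<longrightarrow> n1 + n2 + n3 \<le> L \<longrightarrow>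
     (\<forall>i\<le>n1. (\<exists>j\<le>n2. d (g1 i) (g2 j) \<le> R) \<or> (\<exists>j\<le>n3. d (g1 i) (g3 j) \<le> R)))"

lemma slimD:
  assumes "slim L R" "is_geodesic g1 n1" "is_geodesic g2 n2" "is_geodesic g3 n3"
    "g1 0 = g2 0" "g1 n1 = g3 0" "g2 n2 = g3 n3" "n1 + n2 + n3 \<le> L" "i \<le> n1"
  shows "(\<exists>j\<le>n2. d (g1 i) (g2 j) \<le> R) \<or> (\<exists>j\<le>n3. d (g1 i) (g3 j) \<le> R)"
  using assms unfolding slim_def by blast

lemma slim_mono:
  assumes "slim L R" "R \<le> R'" shows "slim L R'"
  unfolding slim_def
proof (intro allI impI)
  fix g1 g2 g3 :: "nat \<Rightarrow> 'v" and n1 n2 n3 i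
  assume *: "is_geodesic g1 n1" "is_geodesic g2 n2" "is_geodesic g3 n3"
     "g1 0 = g2 0" "g1 n1 = g3 0" "g2 n2 = g3 n3" "n1 + n2 + n3 \<le> L" "i \<le> n1"
  from slimD[OF assms(1) *] show "(\<exists>j\<le>n2. d (g1 i) (g2 j) \<le> R') \<or> (\<exists>j\<le>n3. d (g1 i) (g3 j) \<le> R')"
    using assms(2) order_trans by blast
qed

text \<open>Two nearby points on sides with a common endpoint are joined outside the ball. If the
  corner is at most 20 R away, the path goes through it, with length at most 50 R. Otherwise it
  follows the first side for 20 R, crosses to the second by slimness of the triangle cut off at the
  corner, and returns, with length at most 52 R.\<close>

lemma avoiding_corner:
  assumes sl: "slim L R" and R: "R \<ge> 1"
    and gA: "is_geodesic gA nA" and gB: "is_geodesic gB nB" and z: "gA nA = gB nB"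
    and j: "j1 \<le> nA" "j2 \<le> nB" and per: "(nA - j1) + (nB - j2) + d (gA j1) (gB j2) \<le> L"
    and dq: "d (gA j1) (gB j2) \<le> 10 * R" and dp: "d p (gA j1) \<le> 5 * R"
    and far: "\<And>k. k \<le> nA \<Longrightarrow> R \<le> d p (gA k)" "\<And>k. k \<le> nB \<Longrightarrow> R \<le> d p (gB k)"
  shows "avoiding p R (gA j1) (gB j2) (60 * R)"
proof (cases "nA - j1 \<le> 20 * R")
  case True
  have 1: "avoiding p R (gA j1) (gA nA) (20 * R)"
    using avoiding_mono[OF avoiding_geodesic'[OF gA j(1) order_refl far(1)]] True geodesic_dist(1)[OF gA j(1) order_refl] by simp
  have "nB - j2 \<le> 30 * R"
    using d_tri[of "gB j2" "gB nB" "gA j1"] d_sym[of "gA j1" "gB j2"] dq True z geodesic_dist(1)[OF gB j(2) order_refl] geodesic_dist(1)[OF gA j(1) order_refl] by simp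
  then have 2: "avoiding p R (gB nB) (gB j2) (30 * R)"
    using avoiding_mono[OF avoiding_geodesic'[OF gB order_refl j(2) far(2)]] geodesic_dist(2)[OF gB j(2) order_refl] by simp
  show ?thesis using avoiding_mono[OF avoiding_trans[OF 1[unfolded z] 2]] by simp
next
  case False
  define w where "w = gA (j1 + 20 * R)"
  have jw: "j1 + 20 * R \<le> nA" using False by simp
  obtain h where h: "is_geodesic h (d (gA j1) (gB j2))" "h 0 = gA j1" "h (d (gA j1) (gB j2)) = gB j2"
    using geodesic_exists by blast
  have "(\<exists>j\<le>d (gA j1) (gB j2). d (gA (j1 + 20 * R)) (h j) \<le> R) \<or>
        (\<exists>j\<le>nB - j2. d (gA (j1 + 20 * R)) (gB (nB - j)) \<le> R)"
  proof (rule slimD[OF sl, where ?g1.0 = "\<lambda>i. gA (j1 + i)" and ?n1.0 = "nA - j1"])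
    show "is_geodesic (\<lambda>i. gA (j1 + i)) (nA - j1)" by (rule geodesic_shift[OF gA]) (use j in simp)
    show "is_geodesic (\<lambda>i. gB (nB - i)) (nB - j2)"
      using geodesic_shift[OF geodesic_rev[OF gB], of 0 "nB - j2"] by simp
  qed (use h j z per jw in auto)
  then show ?thesis
  proof (elim disjE exE conjE)
    \<comment> \<open>A point 20 R along the side cannot be within R of the short side, whose points
      are within 10 R of its start.\<close>
    fix k assume k: "k \<le> d (gA j1) (gB j2)" "d (gA (j1 + 20 * R)) (h k) \<le> R"
    have "d (gA j1) (gA (j1 + 20 * R)) \<le> d (gA j1) (h k) + d (h k) (gA (j1 + 20 * R))" by (rule d_tri)
    moreover have "d (gA j1) (h k) = k" using geodesic_dist(1)[OF h(1), of 0 k] k h(2) by simp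
    moreover have "d (gA j1) (gA (j1 + 20 * R)) = 20 * R" using geodesic_dist(1)[OF gA, of j1 "j1 + 20 * R"] jw by simp
    ultimately have False using k dq R d_sym[of "h k" "gA (j1 + 20 * R)"] by linarith
    then show ?thesis ..
  next
    fix k assume k: "k \<le> nB - j2" "d (gA (j1 + 20 * R)) (gB (nB - k)) \<le> R"
    have d20: "d (gA j1) (gA (j1 + 20 * R)) = 20 * R" using geodesic_dist(1)[OF gA, of j1 "j1 + 20 * R"] jw by simp
    have 1: "avoiding p R (gA j1) (gA (j1 + 20 * R)) (20 * R)"
      using avoiding_geodesic'[OF gA j(1) jw far(1)] d20 by simp
    have "15 * R \<le> d p (gA (j1 + 20 * R))"
      using d_tri[of "gA j1" "gA (j1 + 20 * R)" p] d_sym[of "gA j1" p] dp d20 by linarith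
    then have 2: "avoiding p R (gA (j1 + 20 * R)) (gB (nB - k)) R"
      using k(2) by (intro avoiding_ball) auto
    have "d (gB (nB - k)) (gB j2) \<le> 31 * R"
      using d_tri[of "gB (nB - k)" "gB j2" "gA (j1 + 20 * R)"] d_tri[of "gA (j1 + 20 * R)" "gB j2" "gA j1"]
        d_sym[of "gB (nB - k)" "gA (j1 + 20 * R)"] d_sym[of "gA (j1 + 20 * R)" "gA j1"] k(2) d20 dq by linarith
    moreover have "nB - k \<le> nB" by simp
    ultimately have 3: "avoiding p R (gB (nB - k)) (gB j2) (31 * R)"
      using avoiding_mono[OF avoiding_geodesic'[OF gB _ j(2) far(2)]] by blast
    show ?thesis
      by (rule avoiding_mono[OF avoiding_trans[OF avoiding_trans[OF 1 2] 3]]) simp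
  qed
qed

text \<open>A point \<open>p\<close> violating the constant R - 1 has distance at least R from the
  two other sides. From the points 4 R before and after \<open>p\<close>, or the ends of the side,
  slimness with R gives jumps of length at most R to these sides. Together with the connection
  between them this is a detour of length 62 R, which \<open>filling_growth\<close> forces to be
  exponentially long in R.\<close>

lemma slim_step:
  assumes lf: "linear_fillings N K" and N: "N \<ge> 1" and K: "K \<ge> 1"
    and sl: "slim L R" and R: "R \<ge> 1" and nsl: "\<not> slim L (R - 1)"
  shows "(4 * K * N) ^ ((R - 1) div N) \<le> (4 * K * N - 1) ^ ((R - 1) div N) * (2 * K * (62 * R + 1))"
proof -
  obtain g1 n1 g2 n2 g3 n3 i where g: "is_geodesic g1 n1" "is_geodesic g2 n2" "is_geodesic g3 n3"
    and e: "g1 0 = g2 0" "g1 n1 = g3 0" "g2 n2 = g3 n3" "n1 + n2 + n3 \<le> L" and i: "i \<le> n1"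
    and f: "\<not> (\<exists>j\<le>n2. d (g1 i) (g2 j) \<le> R - 1)" "\<not> (\<exists>j\<le>n3. d (g1 i) (g3 j) \<le> R - 1)"
    using nsl unfolding slim_def by blast
  define p where "p = g1 i"
  have f2: "R \<le> d p (g2 j)" if "j \<le> n2" for j using f(1) that unfolding p_def by force
  have f3: "R \<le> d p (g3 j)" if "j \<le> n3" for j using f(2) that unfolding p_def by force
  have near: "\<exists>q. (q \<in> g2 ` {..n2} \<or> q \<in> g3 ` {..n3}) \<and> d (g1 k) q \<le> R \<and> avoiding p R (g1 k) q R"
    if k: "k \<le> n1" "k = 0 \<or> k = n1 \<or> d p (g1 k) = 4 * R" for k
  proof -
    consider "k = 0" | "k = n1" | "d p (g1 k) = 4 * R" using k by blast
    then show ?thesis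
    proof cases
      case 1
      have "avoiding p R (g2 0) (g2 0) R"
        by (rule avoiding_mono[OF avoiding_geodesic'[OF g(2) _ _ f2]]) auto
      then show ?thesis using 1 e by (intro exI[of _ "g2 0"]) auto
    next
      case 2
      have "avoiding p R (g3 0) (g3 0) R"
        by (rule avoiding_mono[OF avoiding_geodesic'[OF g(3) _ _ f3]]) auto
      then show ?thesis using 2 e by (intro exI[of _ "g3 0"]) auto
    next
      case 3
      obtain q where q: "q \<in> g2 ` {..n2} \<or> q \<in> g3 ` {..n3}" "d (g1 k) q \<le> R"
        using slimD[OF sl g e k(1)] by auto
      have "avoiding p R (g1 k) q R" by (rule avoiding_ball) (use q 3 in auto)
      then show ?thesis using q by blast
    qed
  qed
  define iu where "iu = i - 4 * R"
  define iv where "iv = min n1 (i + 4 * R)"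
  have iu: "iu \<le> i" "i - iu \<le> 4 * R" and iv: "i \<le> iv" "iv - i \<le> 4 * R" "iv \<le> n1"
    using i by (auto simp: iu_def iv_def)
  have du: "d p (g1 iu) = i - iu" unfolding p_def using geodesic_dist(2)[OF g(1) iu(1) i] .
  have dv: "d p (g1 iv) = iv - i" unfolding p_def using geodesic_dist(1)[OF g(1) iv(1,3)] .
  obtain q1 where q1: "q1 \<in> g2 ` {..n2} \<or> q1 \<in> g3 ` {..n3}" "d (g1 iu) q1 \<le> R" "avoiding p R (g1 iu) q1 R"
  proof -
    have "iu = 0 \<or> iu = n1 \<or> d p (g1 iu) = 4 * R" unfolding du by (auto simp: iu_def)
    moreover have "iu \<le> n1" using iu i by simp
    ultimately show thesis using near[of iu] that by blast
  qed
  obtain q2 where q2: "q2 \<in> g2 ` {..n2} \<or> q2 \<in> g3 ` {..n3}" "d (g1 iv) q2 \<le> R" "avoiding p R (g1 iv) q2 R"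
  proof -
    have "iv = 0 \<or> iv = n1 \<or> d p (g1 iv) = 4 * R" unfolding dv by (auto simp: iv_def)
    then show thesis using near[of iv] that iv(3) by blast
  qed
  have p1: "d p q1 \<le> 5 * R" using d_tri[of p q1 "g1 iu"] du iu q1(2) by linarith
  have p2: "d p q2 \<le> 5 * R" using d_tri[of p q2 "g1 iv"] dv iv q2(2) by linarith
  have d12: "d q1 q2 \<le> 10 * R" using d_tri[of q1 q2 p] d_sym[of q1 p] p1 p2 by linarith
  have per: "(n2 - j1) + (n3 - j2) + d (g2 j1) (g3 j2) \<le> L" if j: "j1 \<le> n2" "j2 \<le> n3" for j1 j2
  proof -
    have "d (g2 j1) (g3 j2) \<le> d (g2 j1) (g2 0) + d (g2 0) (g3 0) + d (g3 0) (g3 j2)"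
      using d_tri[of "g2 j1" "g3 j2" "g2 0"] d_tri[of "g2 0" "g3 j2" "g3 0"] by linarith
    also have "\<dots> = j1 + n1 + j2"
      using geodesic_dist(2)[OF g(2), of 0 j1] geodesic_dist(1)[OF g(3), of 0 j2] geodesic_dist(1)[OF g(1), of 0 n1] e j by simp
    finally show ?thesis using e(4) j by linarith
  qed
  have mid: "avoiding p R q1 q2 (60 * R)"
  proof -
    consider j1 j2 where "q1 = g2 j1" "q2 = g2 j2" "j1 \<le> n2" "j2 \<le> n2"
      | j1 j2 where "q1 = g3 j1" "q2 = g3 j2" "j1 \<le> n3" "j2 \<le> n3"
      | j1 j2 where "q1 = g2 j1" "q2 = g3 j2" "j1 \<le> n2" "j2 \<le> n3"
      | j1 j2 where "q1 = g3 j2" "q2 = g2 j1" "j1 \<le> n2" "j2 \<le> n3"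
      using q1(1) q2(1) by (elim disjE imageE) auto
    then show ?thesis
    proof cases
      case 1
      then show ?thesis using avoiding_mono[OF avoiding_geodesic'[OF g(2) 1(3,4) f2]] d12 by simp
    next
      case 2
      then show ?thesis using avoiding_mono[OF avoiding_geodesic'[OF g(3) 2(3,4) f3]] d12 by simp
    next
      case 3
      show ?thesis unfolding 3(1,2)
        by (rule avoiding_corner[OF sl R g(2,3) e(3) 3(3,4) per[OF 3(3,4)]]) (use d12 p1 f2 f3 3 in auto)
    next
      case 4
      show ?thesis unfolding 4(1,2)
        by (rule avoiding_sym, rule avoiding_corner[OF sl R g(2,3) e(3) 4(3,4) per[OF 4(3,4)]])
           (use d12 p2 f2 f3 4 d_sym[of q1 q2] in auto)
    qed
  qed
  have "avoiding p R (g1 iu) (g1 iv) (R + 60 * R + R)"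
    by (rule avoiding_trans[OF avoiding_trans[OF q1(3) mid] avoiding_sym[OF q2(3)]])
  then obtain q where q: "is_walk q" "hd q = g1 iu" "last q = g1 iv" "length q \<le> Suc (62 * R)" "\<forall>v\<in>set q. R \<le> d p v"
    unfolding avoiding_def by auto
  have "(4 * K * N) ^ ((R - 1) div N) \<le> (4 * K * N - 1) ^ ((R - 1) div N) * (2 * K * length q)"
  proof (rule filling_growth[OF lf N K, where g = "\<lambda>k. g1 (iu + k)" and n = "iv - iu" and ?i0.0 = "i - iu"])
    show "is_geodesic (\<lambda>k. g1 (iu + k)) (iv - iu)" by (rule geodesic_shift[OF g(1)]) (use iu iv in simp)
    fix v assume "v \<in> set q"
    then have "R \<le> d p v" using q by blast
    moreover have "(R - 1) div N * N \<le> R - 1" by (rule div_times_less_eq_dividend)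
    ultimately have "(R - 1) div N * N < d p v" using R by linarith
    then show "(R - 1) div N * N < d (g1 (iu + (i - iu))) v" using iu by (simp add: p_def)
  qed (use iu iv q in auto)
  also have "\<dots> \<le> (4 * K * N - 1) ^ ((R - 1) div N) * (2 * K * (62 * R + 1))"
    using q(4) by (intro mult_left_mono) auto
  finally show ?thesis .
qed

text \<open>The inequality of \<open>slim_step\<close> for the least R compares an exponential with
  a linear function; this bounds R by a constant that depends only on \<open>N\<close> and
  \<open>K\<close>.\<close>

lemma slim_uniform:
  assumes lf: "linear_fillings N K" and N: "N \<ge> 1" and K: "K \<ge> 1"
  shows "\<exists>R. \<forall>L. slim L R"
proof -
  define M where "M = 4 * K * N"
  have M: "M \<ge> 4" using N K by (simp add: M_def)
  define x where "x = real (M - 1) / real M"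
  have x: "0 \<le> x" "x < 1" using M by (auto simp: x_def)
  define B where "B = real (2 * K * (62 * N + 1))"
  have "(\<lambda>j. real j * x ^ j) \<longlonglongrightarrow> 0" using x by (intro powser_times_n_limit_0) simp
  moreover have "(\<lambda>j. x ^ j) \<longlonglongrightarrow> 0" using x by (intro LIMSEQ_power_zero) simp
  ultimately have "(\<lambda>j. B * (real j * x ^ j + x ^ j)) \<longlonglongrightarrow> B * (0 + 0)"
    by (intro tendsto_mult tendsto_add tendsto_const)
  then have "eventually (\<lambda>j. B * (real j * x ^ j + x ^ j) < 1) sequentially"
    by (rule order_tendstoD(2)) simp
  then obtain J where J: "\<And>j. j \<ge> J \<Longrightarrow> B * (real j * x ^ j + x ^ j) < 1"
    by (auto simp: eventually_sequentially)
  have bound: "R \<le> (J + 1) * N" if sl: "slim L R" and nsl: "\<not> slim L (R - 1)" and R: "R \<ge> 1" for L R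
  proof (rule ccontr)
    assume "\<not> R \<le> (J + 1) * N"
    then have big: "(J + 1) * N \<le> R - 1" by simp
    define j where "j = (R - 1) div N"
    have j: "J \<le> j" using div_le_mono[OF big, of N] N by (simp add: j_def)
    have "R - 1 < (j + 1) * N" using N dividend_less_times_div[of N "R - 1"] by (simp add: j_def algebra_simps)
    then have "62 * R + 1 \<le> (62 * N + 1) * (j + 1)" using R by (simp add: algebra_simps)
    then have "(2 * K) * (62 * R + 1) \<le> (2 * K) * ((62 * N + 1) * (j + 1))" by (rule mult_left_mono) simp
    then have Bj: "real (2 * K * (62 * R + 1)) \<le> B * (real j + 1)"
    proof -
      have "real (2 * K * (62 * R + 1)) \<le> real ((2 * K) * ((62 * N + 1) * (j + 1)))"
        using \<open>(2 * K) * (62 * R + 1) \<le> _\<close> by (simp only: of_nat_le_iff)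
      also have "\<dots> = B * (real j + 1)" by (simp add: B_def algebra_simps)
      finally show ?thesis .
    qed
    have "M ^ j \<le> (M - 1) ^ j * (2 * K * (62 * R + 1))"
      using slim_step[OF lf N K sl R nsl] by (simp add: M_def j_def)
    then have "real M ^ j \<le> real (M - 1) ^ j * real (2 * K * (62 * R + 1))"
      by (metis of_nat_le_iff of_nat_mult of_nat_power)
    also have "\<dots> \<le> real (M - 1) ^ j * (B * (real j + 1))" using Bj by (intro mult_left_mono) auto
    finally have "1 \<le> x ^ j * (B * (real j + 1))"
      using M by (simp add: x_def power_divide field_simps)
    then show False using J[OF j] by (simp add: algebra_simps)
  qed
  have "slim L ((J + 1) * N)" for L
  proof -
    have triv: "slim L L" unfolding slim_def
    proof (intro allI impI)
      fix g1 g2 g3 :: "nat \<Rightarrow> 'v" and n1 n2 n3 i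
      assume "is_geodesic g1 n1" "g1 0 = g2 0" "n1 + n2 + n3 \<le> L" "i \<le> n1"
      then show "(\<exists>j\<le>n2. d (g1 i) (g2 j) \<le> L) \<or> (\<exists>j\<le>n3. d (g1 i) (g3 j) \<le> L)"
        using geodesic_dist(2)[of g1 n1 0 i] by (intro disjI1 exI[of _ 0]) auto
    qed
    define R where "R = (LEAST R. slim L R)"
    have sl: "slim L R" unfolding R_def by (rule LeastI[of "slim L", OF triv])
    have "R \<le> (J + 1) * N"
    proof (cases "R = 0")
      case False
      then have "\<not> slim L (R - 1)" unfolding R_def by (intro not_less_Least) simp
      then show ?thesis using bound[OF sl] False by simp
    qed simp
    then show ?thesis by (rule slim_mono[OF sl])
  qed
  then show ?thesis by blast
qed

text \<open>Up to 2 R + 1 the Gromov product of x and y at w is the distance from w to a point on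
  the geodesic from x to y, and it is at most the distance from w to any point of it. By slimness
  the chosen point is within R of a side ending at z, which costs one more R.\<close>

lemma four_point_of_slim:
  assumes sl: "\<And>L. slim L R"
  defines "gp \<equiv> \<lambda>w x y. (real (d w x) + real (d w y) - real (d x y)) / 2"
  shows "gp w x y \<ge> min (gp w x z) (gp w y z) - (3 * real R + 1)"
proof -
  obtain gxy where gxy: "is_geodesic gxy (d x y)" "gxy 0 = x" "gxy (d x y) = y" using geodesic_exists by blast
  obtain gxw where gxw: "is_geodesic gxw (d x w)" "gxw 0 = x" "gxw (d x w) = w" using geodesic_exists by blast
  obtain gyw where gyw: "is_geodesic gyw (d y w)" "gyw 0 = y" "gyw (d y w) = w" using geodesic_exists by blast
  obtain gxz where gxz: "is_geodesic gxz (d x z)" "gxz 0 = x" "gxz (d x z) = z" using geodesic_exists by blast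
  obtain gyz where gyz: "is_geodesic gyz (d y z)" "gyz 0 = y" "gyz (d y z) = z" using geodesic_exists by blast
  define cx where "cx i \<longleftrightarrow> (\<exists>j\<le>d x w. d (gxy i) (gxw j) \<le> R)" for i
  define cy where "cy i \<longleftrightarrow> (\<exists>j\<le>d y w. d (gxy i) (gyw j) \<le> R)" for i
  have cov: "cx i \<or> cy i" if "i \<le> d x y" for i
    unfolding cx_def cy_def by (rule slimD[OF sl gxy(1) gxw(1) gyw(1) _ _ _ order_refl that]) (use gxy gxw gyw in auto)
  have cx0: "cx 0" unfolding cx_def using gxy gxw by (intro exI[of _ 0]) simp
  have cyn: "cy (d x y)" unfolding cy_def using gxy gyw by (intro exI[of _ 0]) simp
  have xb: "d x w + 2 * R \<ge> d w (gxy i) + i" if "cx i" "i \<le> d x y" for i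
  proof -
    from that obtain j where j: "j \<le> d x w" "d (gxy i) (gxw j) \<le> R" by (auto simp: cx_def)
    have "d x (gxw j) = j" "d (gxw j) w = d x w - j" "d x (gxy i) = i"
      using geodesic_dist(1)[OF gxw(1), of 0 j] geodesic_dist(1)[OF gxw(1) j(1) order_refl] geodesic_dist(1)[OF gxy(1), of 0 i] gxw gxy j that by auto
    then show ?thesis using d_tri[of x "gxy i" "gxw j"] d_tri[of w "gxy i" "gxw j"] d_sym[of "gxw j" "gxy i"] d_sym[of w "gxw j"] j by linarith
  qed
  have yb: "d y w + 2 * R \<ge> d w (gxy i) + (d x y - i)" if "cy i" "i \<le> d x y" for i
  proof -
    from that obtain j where j: "j \<le> d y w" "d (gxy i) (gyw j) \<le> R" by (auto simp: cy_def)
    have "d y (gyw j) = j" "d (gyw j) w = d y w - j" "d y (gxy i) = d x y - i"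
      using geodesic_dist(1)[OF gyw(1), of 0 j] geodesic_dist(1)[OF gyw(1) j(1) order_refl] geodesic_dist(2)[OF gxy(1) that(2) order_refl] gyw gxy j by auto
    then show ?thesis using d_tri[of y "gxy i" "gyw j"] d_tri[of w "gxy i" "gyw j"] d_sym[of "gyw j" "gxy i"] d_sym[of w "gyw j"] j by linarith
  qed
  \<comment> \<open>The point is taken where the geodesic changes from being close to the side
    [x, w] to being close to [y, w], so both estimates hold up to a step of length 1.\<close>
  have "\<exists>i\<le>d x y. d w (gxy i) * 2 + d x y \<le> d x w + d y w + 4 * R + 2"
  proof -
    define i where "i = (LEAST i. cy i)"
    have ci: "cy i" unfolding i_def by (rule LeastI[of cy, OF cyn])
    have il: "i \<le> d x y" unfolding i_def by (rule Least_le[of cy, OF cyn])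
    show ?thesis
    proof (cases i)
      case 0
      then show ?thesis using xb[OF cx0] yb[OF ci il] il by (intro exI[of _ 0]) auto
    next
      case (Suc k)
      have "\<not> cy k" using not_less_Least[of k cy] Suc by (simp add: i_def)
      then have ck: "cx k" using cov[of k] Suc il by auto
      have "d (gxy k) (gxy i) = 1" using geodesic_dist(1)[OF gxy(1), of k i] Suc il by simp
      then have "d w (gxy k) \<le> d w (gxy i) + 1" using d_tri[of w "gxy k" "gxy i"] d_sym[of "gxy k" "gxy i"] by simp
      then show ?thesis using xb[OF ck] yb[OF ci il] Suc il by (intro exI[of _ k]) auto
    qed
  qed
  then obtain i where i: "i \<le> d x y" "d w (gxy i) * 2 + d x y \<le> d x w + d y w + 4 * R + 2" by blast
  have low: "gp w x y \<ge> real (d w (gxy i)) - 2 * real R - 1"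
    using i(2) d_sym[of x w] d_sym[of y w] unfolding gp_def by (simp add: field_simps)
  have up: "gp w u v \<le> real (d w (g j))" if "is_geodesic g (d u v)" "g 0 = u" "g (d u v) = v" "j \<le> d u v" for g u v j
  proof -
    have "d u (g j) = j" "d (g j) v = d u v - j"
      using geodesic_dist(1)[OF that(1), of 0 j] geodesic_dist(1)[OF that(1,4) order_refl] that by auto
    then have "d w u + d w v \<le> 2 * d w (g j) + d u v"
      using d_tri[of w u "g j"] d_tri[of w v "g j"] d_sym[of "g j" u] that(4) by linarith
    then show ?thesis unfolding gp_def by (simp add: field_simps)
  qed
  have "(\<exists>j\<le>d x z. d (gxy i) (gxz j) \<le> R) \<or> (\<exists>j\<le>d y z. d (gxy i) (gyz j) \<le> R)"
    by (rule slimD[OF sl gxy(1) gxz(1) gyz(1) _ _ _ order_refl i(1)]) (use gxy gxz gyz in auto)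
  then show ?thesis
  proof (elim disjE exE conjE)
    fix j assume j: "j \<le> d x z" "d (gxy i) (gxz j) \<le> R"
    then show ?thesis using up[OF gxz j(1)] low d_tri[of w "gxz j" "gxy i"] by linarith
  next
    fix j assume j: "j \<le> d y z" "d (gxy i) (gyz j) \<le> R"
    then show ?thesis using up[OF gyz j(1)] low d_tri[of w "gyz j" "gxy i"] by linarith
  qed
qed

theorem linear_fillings_four_point:
  assumes "linear_fillings N K" "N \<ge> 1" "K \<ge> 1"
  shows "\<exists>\<delta>::real. \<forall>x y z w.
     (real (d w x) + real (d w y) - real (d x y)) / 2 \<ge>
       min ((real (d w x) + real (d w z) - real (d x z)) / 2)
           ((real (d w y) + real (d w z) - real (d y z)) / 2) - \<delta>"
proof -
  obtain R where "\<And>L. slim L R" using slim_uniform[OF assms] by blast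
  then show ?thesis using four_point_of_slim by blast
qed

end

section \<open>Actions of presented groups\<close>

context
  fixes act :: "'a \<times> bool \<Rightarrow> 'x \<Rightarrow> 'x" and Z :: "'x set" and Y :: "'a set"
  assumes act_closed: "\<And>x s p. x \<in> Y \<Longrightarrow> p \<in> Z \<Longrightarrow> act (x, s) p \<in> Z"
    and act_inverse: "\<And>x s p. x \<in> Y \<Longrightarrow> p \<in> Z \<Longrightarrow> act (x, s) (act (x, \<not> s) p) = p"
begin

lemma act_Bij: "x \<in> Y \<Longrightarrow> restrict (act (x, s)) Z \<in> Bij Z"
proof -
  assume x: "x \<in> Y"
  have "bij_betw (act (x, s)) Z Z"
    by (rule bij_betw_byWitness[where f' = "act (x, \<not> s)"])
       (use act_closed[OF x] act_inverse[OF x, of _ s] act_inverse[OF x, of _ "\<not> s"] in auto)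
  then show ?thesis
    by (simp add: Bij_def bij_betw_restrict_eq)
qed

lemma foldr_act_closed: "fst ` set w \<subseteq> Y \<Longrightarrow> p \<in> Z \<Longrightarrow> foldr act w p \<in> Z"
  by (induction w) (auto simp: act_closed)

lemma word_eval_BijGroup:
  "fst ` set w \<subseteq> Y \<Longrightarrow>
    word_eval (BijGroup Z) (\<lambda>x. restrict (act (x, False)) Z) w = restrict (foldr act w) Z"
proof (induction w)
  case Nil
  then show ?case by (auto simp: BijGroup_def)
next
  case (Cons a w)
  obtain x s where a: "a = (x, s)" by (cases a)
  have x: "x \<in> Y" using Cons.prems a by simp
  have inv: "inv\<^bsub>BijGroup Z\<^esub> restrict (act (x, False)) Z = restrict (act (x, True)) Z"
  proof (rule group.inv_equality[OF group_BijGroup])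
    show "restrict (act (x, True)) Z \<otimes>\<^bsub>BijGroup Z\<^esub> restrict (act (x, False)) Z = \<one>\<^bsub>BijGroup Z\<^esub>"
      using act_Bij[OF x] act_closed[OF x] act_inverse[OF x, of _ True]
      by (auto simp: BijGroup_def compose_def restrict_def fun_eq_iff)
  qed (use act_Bij[OF x] in \<open>auto simp: BijGroup_def\<close>)
  have IH: "word_eval (BijGroup Z) (\<lambda>x. restrict (act (x, False)) Z) w = restrict (foldr act w) Z"
    by (rule Cons.IH) (use Cons.prems in auto)
  have w: "restrict (foldr act w) Z \<in> Bij Z"
  proof -
    have "word_eval (BijGroup Z) (\<lambda>x. restrict (act (x, False)) Z) w \<in> carrier (BijGroup Z)"
      by (rule group.word_eval_closed[OF group_BijGroup]) (use act_Bij Cons.prems in \<open>auto simp: BijGroup_def\<close>)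
    then show ?thesis unfolding IH by (simp add: BijGroup_def)
  qed
  have mult: "restrict (act (x, s)) Z \<otimes>\<^bsub>BijGroup Z\<^esub> restrict (foldr act w) Z = restrict (foldr act (a # w)) Z"
  proof
    fix p
    have "restrict (act (x, s)) Z \<otimes>\<^bsub>BijGroup Z\<^esub> restrict (foldr act w) Z =
        compose Z (restrict (act (x, s)) Z) (restrict (foldr act w) Z)"
      using act_Bij[OF x, of s] w by (simp add: BijGroup_def)
    then show "(restrict (act (x, s)) Z \<otimes>\<^bsub>BijGroup Z\<^esub> restrict (foldr act w) Z) p = restrict (foldr act (a # w)) Z p"
      using foldr_act_closed[of w p] Cons.prems by (simp add: compose_def a)
  qed
  have "word_eval (BijGroup Z) (\<lambda>x. restrict (act (x, False)) Z) (a # w) =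
      restrict (act (x, s)) Z \<otimes>\<^bsub>BijGroup Z\<^esub> restrict (foldr act w) Z"
    by (cases s) (simp_all only: a word_eval.simps IH inv fst_conv snd_conv if_True if_False)
  then show ?case unfolding mult .
qed

text \<open>Von Dyck's theorem for the group of bijections of \<open>Z\<close>. It serves for the
  exponent of t, for the action on \<open>F3\<close> and for the action behind largeness.\<close>

lemma pres_class_act:
  assumes R: "R \<subseteq> carrier (free_group Y)"
    and rel: "\<And>r p. r \<in> R \<Longrightarrow> p \<in> Z \<Longrightarrow> foldr act r p = p"
    and uv: "fst ` set u \<subseteq> Y" "fst ` set v \<subseteq> Y" "pres_class Y R u = pres_class Y R v" and p: "p \<in> Z"
  shows "foldr act u p = foldr act v p"
proof -
  have "word_eval (BijGroup Z) (\<lambda>x. restrict (act (x, False)) Z) u =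
        word_eval (BijGroup Z) (\<lambda>x. restrict (act (x, False)) Z) v"
  proof (rule pres_class_eval[OF R group_BijGroup _ _ uv])
    show "restrict (act (x, False)) Z \<in> carrier (BijGroup Z)" if "x \<in> Y" for x
      using act_Bij[OF that] by (simp add: BijGroup_def)
    fix r assume r: "r \<in> R"
    then have "fst ` set r \<subseteq> Y" using R by (auto simp: free_group_sel)
    then show "word_eval (BijGroup Z) (\<lambda>x. restrict (act (x, False)) Z) r = \<one>\<^bsub>BijGroup Z\<^esub>"
      using word_eval_BijGroup rel[OF r] by (auto simp: BijGroup_def restrict_def fun_eq_iff)
  qed
  then have "restrict (foldr act u) Z p = restrict (foldr act v) Z p" using word_eval_BijGroup uv by simp
  then show ?thesis using p by simp
qed

end

section \<open>Word metrics\<close>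

context group begin

lemma generate_word:
  assumes "S \<subseteq> carrier G" "g \<in> generate G S"
  shows "\<exists>ws. set ws \<subseteq> S \<union> m_inv G ` S \<and> foldr (\<otimes>) ws \<one> = g"
  using assms(2)
proof induction
  case one then show ?case by (intro exI[of _ "[]"]) simp
next
  case (incl h) then show ?case using assms(1) by (intro exI[of _ "[h]"]) auto
next
  case (inv h) then show ?case using assms(1) by (intro exI[of _ "[inv h]"]) auto
next
  case (eng h1 h2)
  then obtain u v where uv: "set u \<subseteq> S \<union> m_inv G ` S" "foldr (\<otimes>) u \<one> = h1" "set v \<subseteq> S \<union> m_inv G ` S" "foldr (\<otimes>) v \<one> = h2"
    by blast
  have "foldr (\<otimes>) (u @ v) \<one> = foldr (\<otimes>) u \<one> \<otimes> foldr (\<otimes>) v \<one>"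
    using uv(1,3) assms(1)
  proof (induction u)
    case Nil
    have "foldr (\<otimes>) v \<one> \<in> carrier G" using Nil(2,3) by (induction v) auto
    then show ?case by simp
  next
    case (Cons x u)
    have "foldr (\<otimes>) v \<one> \<in> carrier G" using Cons(3,4) by (induction v) auto
    moreover have "foldr (\<otimes>) u \<one> \<in> carrier G" using Cons(2,4) by (induction u) auto
    moreover have "x \<in> carrier G" using Cons(2,4) by auto
    ultimately show ?case using Cons by (simp add: m_assoc)
  qed
  then show ?case using uv by (intro exI[of _ "u @ v"]) auto
qed

end

locale word_metric = group G for G (structure) +
  fixes S
  assumes S: "S \<subseteq> carrier G" and gen: "generate G S = carrier G"
begin

definition letters where "letters = S \<union> m_inv G ` S"

abbreviation "wprod ws \<equiv> foldr (\<otimes>) ws \<one>"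

lemma letters_carrier: "letters \<subseteq> carrier G" using S by (auto simp: letters_def)

lemma letters_inv: "s \<in> letters \<Longrightarrow> inv s \<in> letters"
  using S by (auto simp: letters_def subset_iff)

lemma wprod_closed: "set ws \<subseteq> letters \<Longrightarrow> wprod ws \<in> carrier G"
proof (induction ws)
  case (Cons x ws)
  then have "x \<in> carrier G" using letters_carrier by auto
  then show ?case using Cons by simp
qed simp

lemma wprod_append: "set u \<subseteq> letters \<Longrightarrow> set v \<subseteq> letters \<Longrightarrow> wprod (u @ v) = wprod u \<otimes> wprod v"
proof (induction u)
  case (Cons x u)
  then show ?case using wprod_closed[of u] wprod_closed[of v] letters_carrier by (auto simp: m_assoc subset_iff)
qed (simp add: wprod_closed)

lemma wprod_inv: "set u \<subseteq> letters \<Longrightarrow> wprod (rev (map (m_inv G) u)) = inv (wprod u)"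
proof (induction u)
  case (Cons x u)
  have u: "set (rev (map (m_inv G) u)) \<subseteq> letters" using Cons.prems letters_inv by auto
  have x: "x \<in> carrier G" "inv x \<in> letters" using Cons.prems letters_carrier letters_inv by auto
  have "wprod (rev (map (m_inv G) (x # u))) = wprod (rev (map (m_inv G) u)) \<otimes> wprod [inv x]"
    using wprod_append[OF u, of "[inv x]"] x by simp
  then show ?case using Cons x wprod_closed[of u] by (simp add: inv_mult_group)
qed simp

abbreviation "wl \<equiv> word_length G S"

lemma wl_le: "set ws \<subseteq> letters \<Longrightarrow> wl (wprod ws) \<le> length ws"
  unfolding word_length_def letters_def by (rule Least_le) auto

lemma wl_obtain:
  assumes "g \<in> carrier G"
  obtains ws where "set ws \<subseteq> letters" "wprod ws = g" "length ws = wl g"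
proof -
  obtain ws where "set ws \<subseteq> letters" "wprod ws = g"
    using generate_word[OF S, of g] gen assms by (auto simp: letters_def)
  then have "\<exists>n. \<exists>ws. length ws = n \<and> set ws \<subseteq> letters \<and> wprod ws = g" by blast
  from LeastI_ex[OF this] show ?thesis using that unfolding word_length_def letters_def by auto
qed

lemma wl_0: "g \<in> carrier G \<Longrightarrow> wl g = 0 \<longleftrightarrow> g = \<one>"
proof
  assume "g \<in> carrier G" "wl g = 0"
  then show "g = \<one>" using wl_obtain[of g] by (metis foldr.simps(1) id_apply length_0_conv)
next
  assume "g = \<one>"
  then show "wl g = 0" using wl_le[of "[]"] by simp
qed

lemma wl_mult: "g \<in> carrier G \<Longrightarrow> h \<in> carrier G \<Longrightarrow> wl (g \<otimes> h) \<le> wl g + wl h"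
proof -
  assume "g \<in> carrier G" "h \<in> carrier G"
  then obtain u v where u: "set u \<subseteq> letters" "wprod u = g" "length u = wl g"
    and v: "set v \<subseteq> letters" "wprod v = h" "length v = wl h" by (metis wl_obtain)
  then show ?thesis using wl_le[of "u @ v"] wprod_append[OF u(1) v(1)] by simp
qed

lemma wl_inv_le: "g \<in> carrier G \<Longrightarrow> wl (inv g) \<le> wl g"
proof -
  assume "g \<in> carrier G"
  then obtain u where u: "set u \<subseteq> letters" "wprod u = g" "length u = wl g" by (metis wl_obtain)
  have "set (rev (map (m_inv G) u)) \<subseteq> letters" using u(1) letters_inv by auto
  then show ?thesis using wl_le[of "rev (map (m_inv G) u)"] wprod_inv[OF u(1)] u by simp
qed

lemma wl_inv: "g \<in> carrier G \<Longrightarrow> wl (inv g) = wl g"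
  using wl_inv_le[of g] wl_inv_le[of "inv g"] by simp

lemma wl_letter: "s \<in> letters \<Longrightarrow> wl s \<le> 1"
  using wl_le[of "[s]"] letters_carrier by auto

lemma wl_le_1:
  assumes "g \<in> carrier G" "wl g \<le> 1" shows "g = \<one> \<or> g \<in> letters"
proof -
  obtain u where u: "set u \<subseteq> letters" "wprod u = g" "length u = wl g" using wl_obtain[OF assms(1)] .
  show ?thesis
  proof (cases u)
    case (Cons s v)
    then have "v = []" using u(3) assms(2) by (cases v) auto
    moreover have "s \<in> letters" "s \<in> carrier G" using u(1) Cons letters_carrier by auto
    ultimately show ?thesis using u(2) Cons by simp
  qed (use u in simp)
qed

lemma wl_step:
  assumes "g \<in> carrier G" "wl g = Suc n"
  obtains s h where "s \<in> letters" "h \<in> carrier G" "g = s \<otimes> h" "wl s = 1" "wl h = n"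
proof -
  obtain u where u: "set u \<subseteq> letters" "wprod u = g" "length u = wl g" using wl_obtain[OF assms(1)] .
  then obtain s v where v: "u = s # v" using assms(2) by (cases u) auto
  define h where "h = wprod v"
  have s: "s \<in> letters" "s \<in> carrier G" and hc: "h \<in> carrier G" using u v letters_carrier wprod_closed[of v] by (auto simp: h_def)
  have g: "g = s \<otimes> h" using u v by (simp add: h_def)
  have "wl h \<le> n" using wl_le[of v] u v assms(2) by (simp add: h_def)
  moreover have "Suc n \<le> wl s + wl h" using wl_mult[OF s(2) hc] g assms(2) by simp
  ultimately show ?thesis using that[OF s(1) hc g] wl_letter[OF s(1)] by simp
qed

end

section \<open>The Cayley graph of \<open>Gamma\<close>\<close>

definition Gamma_rels :: "nat fword set" where
  "Gamma_rels = { [(3, False), (0, False), (3, True), (1, True)],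
       [(3, False), (1, False), (3, True), (2, True)],
       [(3, False), (2, False), (3, True), (1, True), (0, True)] }"

definition Gamma_word :: "nat fword \<Rightarrow> bool" where
  "Gamma_word w \<longleftrightarrow> fst ` set w \<subseteq> {0, 1, 2, 3}"

lemma Gamma_word_simps [simp]:
  "Gamma_word []" "Gamma_word (x # w) \<longleftrightarrow> fst x \<in> {0, 1, 2, 3} \<and> Gamma_word w"
  "Gamma_word (u @ v) \<longleftrightarrow> Gamma_word u \<and> Gamma_word v" "Gamma_word (fg_inv w) \<longleftrightarrow> Gamma_word w"
  by (auto simp: Gamma_word_def)

lemma F3_Gamma_word: "F3_word w \<Longrightarrow> Gamma_word w"
  by (auto simp: F3_word_def Gamma_word_def)

lemma Gamma_word_phi_psi [simp]: "Gamma_word (phi w)" "Gamma_word (psi w)"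
  by (simp_all add: F3_Gamma_word)

definition gcl :: "nat fword \<Rightarrow> nat fword set" where
  "gcl = pres_class {0, 1, 2, 3} Gamma_rels"

lemma Gamma_eq: "Gamma = presented_group {0, 1, 2, 3} Gamma_rels"
  by (simp add: Gamma_def Gamma_rels_def)

lemma Gamma_rels_carrier: "Gamma_rels \<subseteq> carrier (free_group {0, 1, 2, 3})"
  by (auto simp: Gamma_rels_def free_group_sel)

lemmas gcl_append = pres_class_append[OF Gamma_rels_carrier, folded Gamma_eq gcl_def Gamma_word_def]
  and gcl_Nil = pres_class_Nil[OF Gamma_rels_carrier, folded Gamma_eq gcl_def]
  and gcl_norm = pres_class_norm[OF Gamma_rels_carrier, folded gcl_def]
  and gcl_inv = pres_class_inv[OF Gamma_rels_carrier, folded Gamma_eq gcl_def Gamma_word_def]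
  and gcl_relator = pres_class_relator[OF Gamma_rels_carrier, folded Gamma_eq gcl_def]
  and Gamma_group = presented_group_group[OF Gamma_rels_carrier, folded Gamma_eq]
  and Gamma_carrier = carrier_presented_group[OF Gamma_rels_carrier, folded Gamma_eq gcl_def Gamma_word_def]

interpretation Gamma: group Gamma by (rule Gamma_group)

lemma gcl_closed: "Gamma_word w \<Longrightarrow> gcl w \<in> carrier Gamma"
  by (auto simp: Gamma_carrier)

definition Gamma_gens :: "nat fword set set" where
  "Gamma_gens = (\<lambda>i. gcl [(i, False)]) ` {0, 1, 2, 3}"

lemma gcl_letter: "fst x \<in> {0, 1, 2, 3} \<Longrightarrow> gcl [x] \<in> Gamma_gens \<union> m_inv Gamma ` Gamma_gens"
proof -
  assume x: "fst x \<in> {0, 1, 2, 3}"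
  then have w: "Gamma_word [(fst x, False)]" by auto
  show ?thesis
  proof (cases "snd x")
    case True
    then have "[x] = fg_inv [(fst x, False)]" by (cases x) (simp add: fg_inv_def)
    then have "gcl [x] = inv\<^bsub>Gamma\<^esub> gcl [(fst x, False)]" using gcl_inv[OF w] by simp
    then show ?thesis using x unfolding Gamma_gens_def by blast
  next
    case False
    then have "[x] = [(fst x, False)]" by (cases x) simp
    then have "gcl [x] \<in> Gamma_gens" using x unfolding Gamma_gens_def by (intro image_eqI[of _ _ "fst x"]) simp_all
    then show ?thesis by blast
  qed
qed

lemma letter_gcl:
  assumes "s \<in> Gamma_gens \<union> m_inv Gamma ` Gamma_gens"
  obtains x where "fst x \<in> {0, 1, 2, 3}" "s = gcl [x]"
proof -
  from assms obtain i where i: "i \<in> {0, 1, 2, 3}" "s = gcl [(i, False)] \<or> s = inv\<^bsub>Gamma\<^esub> gcl [(i, False)]"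
    unfolding Gamma_gens_def by blast
  have "Gamma_word [(i, False)]" using i by auto
  from gcl_inv[OF this] have "inv\<^bsub>Gamma\<^esub> gcl [(i, False)] = gcl [(i, True)]" by (simp add: fg_inv_def)
  then show ?thesis using i that[of "(i, False)"] that[of "(i, True)"] by auto
qed

lemma Gamma_gens_carrier: "Gamma_gens \<subseteq> carrier Gamma"
proof
  fix s assume "s \<in> Gamma_gens"
  then obtain i where "i \<in> {0, 1, 2, 3}" "s = gcl [(i, False)]" unfolding Gamma_gens_def by blast
  then show "s \<in> carrier Gamma" using gcl_closed[of "[(i, False)]"] by auto
qed

lemma Gamma_gens_generate: "generate Gamma Gamma_gens = carrier Gamma"
proof
  show "generate Gamma Gamma_gens \<subseteq> carrier Gamma"
    by (rule Gamma.generate_incl[OF Gamma_gens_carrier])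
  have "gcl w \<in> generate Gamma Gamma_gens" if "Gamma_word w" for w
    using that
  proof (induction w)
    case Nil
    then show ?case by (simp add: gcl_Nil generate.one)
  next
    case (Cons x w)
    have x: "fst x \<in> {0, 1, 2, 3}" "Gamma_word [x]" "Gamma_word w" using Cons.prems by auto
    have "gcl [x] \<in> generate Gamma Gamma_gens"
      using gcl_letter[OF x(1)] by (auto intro: generate.incl generate.inv)
    then show ?case using gcl_append[OF x(2,3)] Cons x by (simp add: generate.eng)
  qed
  then show "carrier Gamma \<subseteq> generate Gamma Gamma_gens" by (auto simp: Gamma_carrier)
qed

interpretation Gamma: word_metric Gamma Gamma_gens
  by unfold_locales (use Gamma_gens_carrier Gamma_gens_generate in auto)

lemmas Gamma_letters = Gamma.letters_def

text \<open>The locale \<open>nat_metric\<close> is about a metric on a whole type, so the carrier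
  is made into one.\<close>

typedef gamma_elt = "carrier Gamma"
  using Gamma.one_closed by blast

definition gdist :: "gamma_elt \<Rightarrow> gamma_elt \<Rightarrow> nat" where
  "gdist x y = word_dist Gamma Gamma_gens (Rep_gamma_elt x) (Rep_gamma_elt y)"

definition gmul :: "gamma_elt \<Rightarrow> nat fword \<Rightarrow> gamma_elt" where
  "gmul x w = Abs_gamma_elt (Rep_gamma_elt x \<otimes>\<^bsub>Gamma\<^esub> gcl w)"

lemma Rep_gmul: "Gamma_word w \<Longrightarrow> Rep_gamma_elt (gmul x w) = Rep_gamma_elt x \<otimes>\<^bsub>Gamma\<^esub> gcl w"
  unfolding gmul_def by (rule Abs_gamma_elt_inverse) (simp add: Rep_gamma_elt gcl_closed)

lemma gmul_append: "Gamma_word u \<Longrightarrow> Gamma_word v \<Longrightarrow> gmul x (u @ v) = gmul (gmul x u) v"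
  by (simp add: gmul_def[of x "u @ v"] gmul_def[of "gmul x u"] Rep_gmul gcl_append Gamma.m_assoc Rep_gamma_elt gcl_closed)

lemma gmul_Nil [simp]: "gmul x [] = x"
  by (simp add: gmul_def gcl_Nil Rep_gamma_elt Rep_gamma_elt_inverse)

lemma gmul_cong: "gcl u = gcl v \<Longrightarrow> gmul x u = gmul x v"
  by (simp add: gmul_def)

lemma gdist_wl: "gdist x y = word_length Gamma Gamma_gens (inv\<^bsub>Gamma\<^esub> Rep_gamma_elt x \<otimes>\<^bsub>Gamma\<^esub> Rep_gamma_elt y)"
  by (simp add: gdist_def word_dist_def)

interpretation GM: nat_metric gdist
proof
  fix x y z :: gamma_elt and n
  let ?x = "Rep_gamma_elt x" and ?y = "Rep_gamma_elt y" and ?z = "Rep_gamma_elt z"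
  have c: "?x \<in> carrier Gamma" "?y \<in> carrier Gamma" "?z \<in> carrier Gamma" by (rule Rep_gamma_elt)+
  show "gdist x y = 0 \<longleftrightarrow> x = y"
  proof -
    have "gdist x y = 0 \<longleftrightarrow> inv\<^bsub>Gamma\<^esub> ?x \<otimes>\<^bsub>Gamma\<^esub> ?y = \<one>\<^bsub>Gamma\<^esub>"
      unfolding gdist_wl using c by (intro Gamma.wl_0) simp
    also have "\<dots> \<longleftrightarrow> ?x = ?y" using c by (metis Gamma.inv_closed Gamma.inv_equality Gamma.inv_inv Gamma.l_inv)
    finally show ?thesis by (simp add: Rep_gamma_elt_inject)
  qed
  show "gdist x y = gdist y x"
  proof -
    have "inv\<^bsub>Gamma\<^esub> ?y \<otimes>\<^bsub>Gamma\<^esub> ?x = inv\<^bsub>Gamma\<^esub> (inv\<^bsub>Gamma\<^esub> ?x \<otimes>\<^bsub>Gamma\<^esub> ?y)"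
      using c by (simp add: Gamma.inv_mult_group)
    then show ?thesis unfolding gdist_wl using c Gamma.wl_inv by simp
  qed
  show "gdist x z \<le> gdist x y + gdist y z"
  proof -
    have "inv\<^bsub>Gamma\<^esub> ?x \<otimes>\<^bsub>Gamma\<^esub> ?z = (inv\<^bsub>Gamma\<^esub> ?x \<otimes>\<^bsub>Gamma\<^esub> ?y) \<otimes>\<^bsub>Gamma\<^esub> (inv\<^bsub>Gamma\<^esub> ?y \<otimes>\<^bsub>Gamma\<^esub> ?z)"
    proof -
      have "?y \<otimes>\<^bsub>Gamma\<^esub> (inv\<^bsub>Gamma\<^esub> ?y \<otimes>\<^bsub>Gamma\<^esub> ?z) = ?z" using c by (simp add: Gamma.m_assoc[symmetric])
      then show ?thesis using c by (simp add: Gamma.m_assoc)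
    qed
    then show ?thesis unfolding gdist_wl using c by (simp add: Gamma.wl_mult)
  qed
  assume "gdist x y = Suc n"
  then obtain s h where s: "s \<in> Gamma_gens \<union> m_inv Gamma ` Gamma_gens" "h \<in> carrier Gamma"
    "inv\<^bsub>Gamma\<^esub> ?x \<otimes>\<^bsub>Gamma\<^esub> ?y = s \<otimes>\<^bsub>Gamma\<^esub> h" "word_length Gamma Gamma_gens s = 1" "word_length Gamma Gamma_gens h = n"
    unfolding gdist_wl
    using Gamma.wl_step[of "inv\<^bsub>Gamma\<^esub> ?x \<otimes>\<^bsub>Gamma\<^esub> ?y" n] c Gamma_letters by (metis Gamma.inv_closed Gamma.m_closed)
  have sc: "s \<in> carrier Gamma" using s(1) Gamma.letters_carrier Gamma_letters by blast
  obtain a where a: "fst a \<in> {0, 1, 2, 3}" "s = gcl [a]" using letter_gcl[OF s(1)] .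
  have wa: "Gamma_word [a]" using a by simp
  let ?v = "gmul x [a]"
  have v: "Rep_gamma_elt ?v = ?x \<otimes>\<^bsub>Gamma\<^esub> s" using Rep_gmul[OF wa] a by simp
  have 1: "inv\<^bsub>Gamma\<^esub> ?x \<otimes>\<^bsub>Gamma\<^esub> Rep_gamma_elt ?v = s"
    unfolding v using c sc by (simp add: Gamma.m_assoc[symmetric])
  have 2: "inv\<^bsub>Gamma\<^esub> Rep_gamma_elt ?v \<otimes>\<^bsub>Gamma\<^esub> ?y = h"
  proof -
    have "inv\<^bsub>Gamma\<^esub> Rep_gamma_elt ?v \<otimes>\<^bsub>Gamma\<^esub> ?y = inv\<^bsub>Gamma\<^esub> s \<otimes>\<^bsub>Gamma\<^esub> (inv\<^bsub>Gamma\<^esub> ?x \<otimes>\<^bsub>Gamma\<^esub> ?y)"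
      unfolding v using c sc by (simp add: Gamma.m_assoc Gamma.inv_mult_group)
    then show ?thesis using s sc by (simp add: Gamma.m_assoc[symmetric])
  qed
  show "\<exists>z. gdist x z = 1 \<and> gdist z y = n"
    by (rule exI[of _ ?v]) (use 1 2 s in \<open>simp add: gdist_wl\<close>)
qed

lemma gdist_gmul: "fst a \<in> {0, 1, 2, 3} \<Longrightarrow> gdist x (gmul x [a]) \<le> 1"
proof -
  assume a: "fst a \<in> {0, 1, 2, 3}"
  then have wa: "Gamma_word [a]" by simp
  have "inv\<^bsub>Gamma\<^esub> Rep_gamma_elt x \<otimes>\<^bsub>Gamma\<^esub> Rep_gamma_elt (gmul x [a]) = gcl [a]"
    using Rep_gmul[OF wa] Rep_gamma_elt gcl_closed[OF wa] by (simp add: Gamma.m_assoc[symmetric])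
  then show ?thesis unfolding gdist_wl using Gamma.wl_letter gcl_letter[OF a] Gamma_letters by simp
qed

lemma gdist_le_1:
  assumes "gdist x y \<le> 1"
  shows "x = y \<or> (\<exists>a. fst a \<in> {0, 1, 2, 3} \<and> y = gmul x [a])"
proof -
  let ?x = "Rep_gamma_elt x" and ?y = "Rep_gamma_elt y"
  have c: "?x \<in> carrier Gamma" "?y \<in> carrier Gamma" by (rule Rep_gamma_elt)+
  have "inv\<^bsub>Gamma\<^esub> ?x \<otimes>\<^bsub>Gamma\<^esub> ?y = \<one>\<^bsub>Gamma\<^esub> \<or> inv\<^bsub>Gamma\<^esub> ?x \<otimes>\<^bsub>Gamma\<^esub> ?y \<in> Gamma_gens \<union> m_inv Gamma ` Gamma_gens"
    using Gamma.wl_le_1[of "inv\<^bsub>Gamma\<^esub> ?x \<otimes>\<^bsub>Gamma\<^esub> ?y"] assms c unfolding gdist_wl Gamma_letters by simp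
  then show ?thesis
  proof
    assume "inv\<^bsub>Gamma\<^esub> ?x \<otimes>\<^bsub>Gamma\<^esub> ?y = \<one>\<^bsub>Gamma\<^esub>"
    then have "?x = ?y" using c by (metis Gamma.inv_closed Gamma.inv_equality Gamma.inv_inv)
    then show ?thesis by (simp add: Rep_gamma_elt_inject)
  next
    assume "inv\<^bsub>Gamma\<^esub> ?x \<otimes>\<^bsub>Gamma\<^esub> ?y \<in> Gamma_gens \<union> m_inv Gamma ` Gamma_gens"
    then obtain a where a: "fst a \<in> {0, 1, 2, 3}" "inv\<^bsub>Gamma\<^esub> ?x \<otimes>\<^bsub>Gamma\<^esub> ?y = gcl [a]" by (rule letter_gcl)
    have "?x \<otimes>\<^bsub>Gamma\<^esub> gcl [a] = ?y" unfolding a(2)[symmetric] using c by (simp add: Gamma.m_assoc[symmetric])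
    then have "gmul x [a] = y" by (simp add: gmul_def Rep_gamma_elt_inverse)
    then show ?thesis using a by blast
  qed
qed

section \<open>Paths and chains spelled by words\<close>

fun word_path :: "gamma_elt \<Rightarrow> nat fword \<Rightarrow> gamma_elt list" where
  "word_path x [] = [x]"
| "word_path x (a # w) = x # word_path (gmul x [a]) w"

lemma word_path_hd: "word_path x w = x # tl (word_path x w)"
  by (cases w) auto

lemma length_word_path [simp]: "length (word_path x w) = Suc (length w)"
  by (induction w arbitrary: x) auto

lemma last_word_path: "Gamma_word w \<Longrightarrow> last (word_path x w) = gmul x w"
proof (induction w arbitrary: x)
  case (Cons a w)
  then have "gmul x (a # w) = gmul (gmul x [a]) w" using gmul_append[of "[a]" w x] by simp
  moreover have "word_path (gmul x [a]) w \<noteq> []" using word_path_hd by (metis list.distinct(1))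
  ultimately show ?case using Cons by simp
qed simp

lemma word_path_walk: "Gamma_word w \<Longrightarrow> GM.is_walk (word_path x w)"
proof (induction w arbitrary: x)
  case (Cons a w)
  have "GM.is_walk (gmul x [a] # tl (word_path (gmul x [a]) w))" using Cons word_path_hd by simp
  then have "GM.is_walk (x # gmul x [a] # tl (word_path (gmul x [a]) w))"
    using gdist_gmul[of a x] Cons.prems by (simp add: GM.is_walk_def)
  then show ?case using word_path_hd by simp
qed (simp add: GM.is_walk_def)

definition word_chain :: "gamma_elt \<Rightarrow> nat fword \<Rightarrow> gamma_elt \<times> gamma_elt \<Rightarrow> int" where
  "word_chain x w = walk_chain (word_path x w)"

lemma word_chain_Nil [simp]: "word_chain x [] p = 0"
  by (simp add: word_chain_def)

lemma word_chain_Cons: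
  "word_chain x (a # w) p = of_bool (p = (x, gmul x [a])) - of_bool (p = (gmul x [a], x)) + word_chain (gmul x [a]) w p"
proof -
  have "word_path x (a # w) = x # gmul x [a] # tl (word_path (gmul x [a]) w)" using word_path_hd by simp
  then have "walk_chain (word_path x (a # w)) p = of_bool (p = (x, gmul x [a])) - of_bool (p = (gmul x [a], x))
     + walk_chain (gmul x [a] # tl (word_path (gmul x [a]) w)) p" by (simp only: walk_chain.simps)
  also have "gmul x [a] # tl (word_path (gmul x [a]) w) = word_path (gmul x [a]) w" by (rule word_path_hd[symmetric])
  finally show ?thesis by (simp add: word_chain_def)
qed

lemma word_chain_append:
  "Gamma_word u \<Longrightarrow> Gamma_word v \<Longrightarrow> word_chain x (u @ v) p = word_chain x u p + word_chain (gmul x u) v p"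
proof (induction u arbitrary: x)
  case (Cons a u)
  have "gmul x (a # u) = gmul (gmul x [a]) u" using gmul_append[of "[a]" u x] Cons.prems by simp
  then show ?case using Cons by (simp add: word_chain_Cons)
qed simp

lemma gmul_backtrack:
  assumes "fst a \<in> {0, 1, 2, 3}" shows "gmul (gmul x [a]) [(fst a, \<not> snd a)] = x"
proof -
  have "gmul (gmul x [a]) [(fst a, \<not> snd a)] = gmul x ([a] @ [(fst a, \<not> snd a)])"
    using assms by (subst gmul_append) auto
  also have "\<dots> = gmul x []"
  proof (rule gmul_cong)
    have "fg_norm ([a] @ [(fst a, \<not> snd a)]) = []" by (simp add: fg_norm_def fg_cons_def)
    then show "gcl ([a] @ [(fst a, \<not> snd a)]) = gcl []" using gcl_norm by metis
  qed
  finally show ?thesis by simp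
qed

text \<open>A letter followed by its inverse runs through an edge and back, which is zero in an
  antisymmetric chain. Free reduction is thus free of charge in \<open>homotopic\<close>.\<close>

lemma word_chain_norm: "Gamma_word w \<Longrightarrow> word_chain x (fg_norm w) p = word_chain x w p"
proof (induction w arbitrary: x)
  case (Cons a w)
  have a: "fst a \<in> {0, 1, 2, 3}" using Cons.prems by simp
  have "word_chain x (fg_cons a (fg_norm w)) p = word_chain x (a # fg_norm w) p"
  proof (cases "\<exists>ys. fg_norm w = (fst a, \<not> snd a) # ys")
    case True
    then obtain ys where ys: "fg_norm w = (fst a, \<not> snd a) # ys" by blast
    then have "fg_cons a (fg_norm w) = ys" by (simp add: fg_cons_def)
    then show ?thesis using gmul_backtrack[OF a, of x] by (simp add: ys word_chain_Cons)
  next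
    case False
    then have "fg_cons a (fg_norm w) = a # fg_norm w"
      by (cases "fg_norm w") (auto simp: fg_cons_def prod_eq_iff)
    then show ?thesis by simp
  qed
  then show ?case using Cons by (simp add: fg_norm_Cons word_chain_Cons)
qed simp

lemma word_chain_inv:
  assumes "Gamma_word w" shows "word_chain x (fg_inv w) p = - word_chain (gmul x (fg_inv w)) w p"
proof -
  have "word_chain x (fg_inv w @ w) p = word_chain x (fg_norm (fg_inv w @ w)) p"
    by (rule word_chain_norm[symmetric]) (use assms in simp)
  then show ?thesis using word_chain_append[of "fg_inv w" w x p] assms by simp
qed

text \<open>Filling from every base point makes the relation compatible with concatenation. The 6 is
  the number of vertices on the closed path of the longest relator, which has five letters.\<close>

definition homotopic :: "nat \<Rightarrow> nat fword \<Rightarrow> nat fword \<Rightarrow> bool" where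
  "homotopic n u v \<longleftrightarrow> Gamma_word u \<and> Gamma_word v \<and> gcl u = gcl v \<and>
     (\<forall>x. \<exists>Ls. GM.is_filling 6 (\<lambda>p. word_chain x u p - word_chain x v p) Ls \<and> length Ls \<le> n)"

lemma homotopic_norm_eq:
  assumes "Gamma_word u" "Gamma_word v" "fg_norm u = fg_norm v" shows "homotopic 0 u v"
  unfolding homotopic_def
proof (intro conjI allI)
  show "gcl u = gcl v" using assms(3) gcl_norm by metis
  show "\<exists>Ls. GM.is_filling 6 (\<lambda>p. word_chain x u p - word_chain x v p) Ls \<and> length Ls \<le> 0" for x
    using word_chain_norm[OF assms(1)] word_chain_norm[OF assms(2)] assms(3)
    by (intro exI[of _ "[]"]) (simp add: GM.is_filling_def)
qed (use assms in auto)

lemma filling_append: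
  "GM.is_filling N y Ls \<Longrightarrow> GM.is_filling N z Ms \<Longrightarrow> GM.is_filling N (\<lambda>p. y p + z p) (Ls @ Ms)"
  by (auto simp: GM.is_filling_def)

lemma homotopic_trans:
  assumes "homotopic n u v" "homotopic m v w" shows "homotopic (n + m) u w"
  unfolding homotopic_def
proof (intro conjI allI)
  fix x
  obtain L1 where L1: "GM.is_filling 6 (\<lambda>p. word_chain x u p - word_chain x v p) L1" "length L1 \<le> n"
    using assms(1) unfolding homotopic_def by blast
  obtain L2 where L2: "GM.is_filling 6 (\<lambda>p. word_chain x v p - word_chain x w p) L2" "length L2 \<le> m"
    using assms(2) unfolding homotopic_def by blast
  show "\<exists>Ls. GM.is_filling 6 (\<lambda>p. word_chain x u p - word_chain x w p) Ls \<and> length Ls \<le> n + m"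
    using filling_append[OF L1(1) L2(1)] L1(2) L2(2) by (intro exI[of _ "L1 @ L2"]) simp
qed (use assms in \<open>auto simp: homotopic_def\<close>)

lemma filling_neg:
  assumes "GM.is_filling N z Ls" shows "GM.is_filling N (\<lambda>p. - z p) (map rev Ls)"
proof -
  have "(\<Sum>l\<leftarrow>map rev Ls. walk_chain l p) = - (\<Sum>l\<leftarrow>Ls. walk_chain l p)" for p
    by (induction Ls) (simp_all add: walk_chain_rev)
  moreover have "GM.closed_walk (rev l)" if "GM.closed_walk l" for l
    using that by (auto simp: GM.closed_walk_def GM.is_walk_rev hd_rev last_rev)
  ultimately show ?thesis using assms by (auto simp: GM.is_filling_def)
qed

lemma homotopic_sym:
  assumes "homotopic n u v" shows "homotopic n v u"
  unfolding homotopic_def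
proof (intro conjI allI)
  fix x
  obtain L where L: "GM.is_filling 6 (\<lambda>p. word_chain x u p - word_chain x v p) L" "length L \<le> n"
    using assms(1) unfolding homotopic_def by blast
  show "\<exists>Ls. GM.is_filling 6 (\<lambda>p. word_chain x v p - word_chain x u p) Ls \<and> length Ls \<le> n"
    using filling_neg[OF L(1)] L(2) by (intro exI[of _ "map rev L"]) simp
qed (use assms in \<open>auto simp: homotopic_def\<close>)

lemma homotopic_append:
  assumes "homotopic n u v" "homotopic m u' v'" shows "homotopic (n + m) (u @ u') (v @ v')"
  unfolding homotopic_def
proof (intro conjI allI)
  have w: "Gamma_word u" "Gamma_word v" "Gamma_word u'" "Gamma_word v'" "gcl u = gcl v" "gcl u' = gcl v'"
    using assms by (auto simp: homotopic_def)
  show "gcl (u @ u') = gcl (v @ v')" using w by (simp add: gcl_append)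
  fix x
  obtain L1 where L1: "GM.is_filling 6 (\<lambda>p. word_chain x u p - word_chain x v p) L1" "length L1 \<le> n"
    using assms(1) unfolding homotopic_def by blast
  obtain L2 where L2: "GM.is_filling 6 (\<lambda>p. word_chain (gmul x u) u' p - word_chain (gmul x u) v' p) L2" "length L2 \<le> m"
    using assms(2) unfolding homotopic_def by blast
  have eq: "word_chain x (u @ u') p - word_chain x (v @ v') p =
     (word_chain x u p - word_chain x v p) + (word_chain (gmul x u) u' p - word_chain (gmul x u) v' p)" for p
    using word_chain_append[OF w(1,3), of x p] word_chain_append[OF w(2,4), of x p] gmul_cong[OF w(5), of x] by simp
  show "\<exists>Ls. GM.is_filling 6 (\<lambda>p. word_chain x (u @ u') p - word_chain x (v @ v') p) Ls \<and> length Ls \<le> n + m"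
    unfolding eq using filling_append[OF L1(1) L2(1)] L1(2) L2(2) by (intro exI[of _ "L1 @ L2"]) simp
qed (use assms in \<open>auto simp: homotopic_def\<close>)

lemma homotopic_refl: "Gamma_word u \<Longrightarrow> homotopic 0 u u"
  by (rule homotopic_norm_eq) auto

lemma homotopic_context:
  assumes "homotopic n u v" "Gamma_word x" "Gamma_word y" shows "homotopic n (x @ u @ y) (x @ v @ y)"
  using homotopic_append[OF homotopic_refl[OF assms(2)] homotopic_append[OF assms(1) homotopic_refl[OF assms(3)]]] by simp

lemma homotopic_inv:
  assumes "homotopic n u v" shows "homotopic n (fg_inv u) (fg_inv v)"
  unfolding homotopic_def
proof (intro conjI allI)
  have w: "Gamma_word u" "Gamma_word v" "gcl u = gcl v" using assms by (auto simp: homotopic_def)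
  show g: "gcl (fg_inv u) = gcl (fg_inv v)" using w by (simp add: gcl_inv)
  show "Gamma_word (fg_inv u)" "Gamma_word (fg_inv v)" using w by simp_all
  fix x
  let ?y = "gmul x (fg_inv u)"
  obtain L where L: "GM.is_filling 6 (\<lambda>p. word_chain ?y u p - word_chain ?y v p) L" "length L \<le> n"
    using assms unfolding homotopic_def by blast
  have "gmul x (fg_inv v) = ?y" by (rule gmul_cong[OF g[symmetric]])
  then have eq: "word_chain x (fg_inv u) p - word_chain x (fg_inv v) p = - (word_chain ?y u p - word_chain ?y v p)" for p
    using word_chain_inv[OF w(1), of x p] word_chain_inv[OF w(2), of x p] by simp
  show "\<exists>Ls. GM.is_filling 6 (\<lambda>p. word_chain x (fg_inv u) p - word_chain x (fg_inv v) p) Ls \<and> length Ls \<le> n"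
    unfolding eq using filling_neg[OF L(1)] L(2) by (intro exI[of _ "map rev L"]) simp
qed

lemma homotopic_relator:
  assumes "r \<in> Gamma_rels" shows "homotopic 1 r []"
  unfolding homotopic_def
proof (intro conjI allI)
  show w: "Gamma_word r" using assms by (auto simp: Gamma_rels_def)
  show g: "gcl r = gcl []" using gcl_relator[OF assms] gcl_Nil by simp
  fix x
  have "last (word_path x r) = x" using last_word_path[OF w, of x] gmul_cong[OF g, of x] by simp
  moreover have "hd (word_path x r) = x" using word_path_hd[of x r] by (metis list.sel(1))
  ultimately have "GM.closed_walk (word_path x r)" using word_path_walk[OF w] by (simp add: GM.closed_walk_def)
  moreover have "length (word_path x r) \<le> 6" using assms by (auto simp: Gamma_rels_def)
  ultimately show "\<exists>Ls. GM.is_filling 6 (\<lambda>p. word_chain x r p - word_chain x [] p) Ls \<and> length Ls \<le> 1"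
    by (intro exI[of _ "[word_path x r]"]) (simp add: GM.is_filling_def word_chain_def)
qed simp

lemma homotopic_t_generator:
  assumes "i \<in> {0, 1, 2}" shows "homotopic 1 [(3, False), (i, False), (3, True)] (phi [(i, False)])"
proof -
  have p: "phi [(0, False)] = [(1, False)]" "phi [(1, False)] = [(2, False)]" "phi [(2, False)] = [(0, False), (1, False)]"
    by (simp_all add: phi_def fg_lift_def fg_norm_def fg_cons_def)
  let ?r = "[(3, False), (i, False), (3, True)] @ fg_inv (phi [(i, False)])"
  have r: "?r \<in> Gamma_rels" using assms by (auto simp: Gamma_rels_def p[simplified] fg_inv_def)
  have w: "Gamma_word (phi [(i, False)])" by simp
  have w': "Gamma_word [(3, False), (i, False), (3, True)]" using assms by auto
  have "homotopic 1 (?r @ phi [(i, False)]) ([] @ phi [(i, False)])"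
    using homotopic_append[OF homotopic_relator[OF r] homotopic_refl[OF w]] by simp
  moreover have "homotopic 0 [(3, False), (i, False), (3, True)] (?r @ phi [(i, False)])"
  proof (rule homotopic_norm_eq[OF w'])
    show "Gamma_word (?r @ phi [(i, False)])" using w w' by simp
    show "fg_norm [(3, False), (i, False), (3, True)] = fg_norm (?r @ phi [(i, False)])"
      using fg_norm_cancel_mid[of "[(3, False), (i, False), (3, True)]" "fg_inv (phi [(i, False)])" "[]"] by simp
  qed
  ultimately show ?thesis using homotopic_trans by fastforce
qed

lemma homotopic_t_letter:
  assumes "fst a \<in> {0, 1, 2}" shows "homotopic 1 [(3, False), a, (3, True)] (phi [a])"
proof (cases "snd a")
  case False
  then have "a = (fst a, False)" by (cases a) simp
  then show ?thesis using homotopic_t_generator[OF assms] by simp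
next
  case True
  then have a: "[(3, False), a, (3, True)] = fg_inv [(3, False), (fst a, False), (3, True)]" "[a] = fg_inv [(fst a, False)]"
    by (cases a, simp add: fg_inv_def)+
  show ?thesis unfolding a(1) using homotopic_inv[OF homotopic_t_generator[OF assms]] by (simp add: a(2))
qed

text \<open>A corridor, one relator for each letter of its bottom \<open>w\<close>.\<close>

lemma homotopic_t_word:
  "F3_word w \<Longrightarrow> homotopic (length w) ([(3, False)] @ w @ [(3, True)]) (phi w)"
proof (induction w)
  case Nil
  show ?case by (simp, rule homotopic_norm_eq) (simp_all add: fg_norm_def fg_cons_def)
next
  case (Cons a w)
  have w: "F3_word w" "fst a \<in> {0, 1, 2}" "Gamma_word w" "fst a \<in> {0, 1, 2, 3}" using Cons.prems F3_Gamma_word[of w] by auto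
  let ?t = "[(3::nat, False)]" and ?T = "[(3::nat, True)]"
  have 0: "homotopic 0 (?t @ (a # w) @ ?T) ([(3, False), a, (3, True)] @ (?t @ w @ ?T))"
  proof (rule homotopic_norm_eq)
    show "fg_norm (?t @ (a # w) @ ?T) = fg_norm ([(3, False), a, (3, True)] @ (?t @ w @ ?T))"
      using fg_norm_cancel_mid[of "[(3, False), a]" ?T "w @ ?T"] by (simp add: fg_inv_def)
  qed (use w in auto)
  have 1: "homotopic (1 + length w) ([(3, False), a, (3, True)] @ (?t @ w @ ?T)) (phi [a] @ phi w)"
    by (rule homotopic_append[OF homotopic_t_letter[OF w(2)] Cons.IH[OF w(1)]])
  have 2: "homotopic 0 (phi [a] @ phi w) (phi (a # w))"
  proof (rule homotopic_norm_eq)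
    show "fg_norm (phi [a] @ phi w) = fg_norm (phi (a # w))" using phi_append[of "[a]" w] phi_simps(2)[of "a # w"] by (simp only: append_Cons append_Nil)
  qed simp_all
  show ?case using homotopic_trans[OF 0 homotopic_trans[OF 1 2]] by simp
qed

lemma items_homotopic:
  "item_ok i \<Longrightarrow> homotopic (item_area i) (item_word i) (item_val i)"
  "items_ok ws \<Longrightarrow> homotopic (items_area ws) (items_word ws) (items_val ws)"
proof (induction i and ws rule: item_word_items_word.induct)
  case (1 x)
  then show ?case by (simp, intro homotopic_refl) auto
next
  case (2 ws)
  have F: "F3_word (items_val ws)" using 2 items_F3(2) by simp
  have "homotopic (items_area ws) ([(3, False)] @ items_word ws @ [(3, True)]) ([(3, False)] @ items_val ws @ [(3, True)])"
    by (rule homotopic_context) (use 2 in auto)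
  from homotopic_trans[OF this homotopic_t_word[OF F]] show ?case by (simp add: add.commute)
next
  case (3 ws)
  let ?u = "psi (items_val ws)"
  have F: "F3_word (items_val ws)" using 3 items_F3(2) by simp
  have "homotopic (length ?u) ([(3, False)] @ ?u @ [(3, True)]) (phi ?u)" by (rule homotopic_t_word) simp
  moreover have "phi ?u = items_val ws" using phi_psi[OF F] by (simp add: fg_norm_id)
  ultimately have "homotopic (length ?u) (items_val ws) ([(3, False)] @ ?u @ [(3, True)])"
    using homotopic_sym by simp
  then have 1: "homotopic (length ?u) ([(3, True)] @ items_val ws @ [(3, False)])
      ([(3, True)] @ ([(3, False)] @ ?u @ [(3, True)]) @ [(3, False)])"
    by (rule homotopic_context) auto
  have 2: "homotopic 0 ([(3, True)] @ ([(3, False)] @ ?u @ [(3, True)]) @ [(3, False)]) ?u"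
  proof (rule homotopic_norm_eq)
    show "fg_norm ([(3, True)] @ ([(3, False)] @ ?u @ [(3, True)]) @ [(3, False)]) = fg_norm ?u"
      using fg_norm_cancel_mid[of "[]" "[(3, True)]" "?u @ [(3, True)] @ [(3, False)]"]
        fg_norm_cancel_mid[of ?u "[(3, True)]" "[]"] by (simp add: fg_inv_def)
  qed simp_all
  have 0: "homotopic (items_area ws) ([(3, True)] @ items_word ws @ [(3, False)]) ([(3, True)] @ items_val ws @ [(3, False)])"
    by (rule homotopic_context) (use 3 in auto)
  from homotopic_trans[OF 0 homotopic_trans[OF 1 2]] show ?case by (simp add: add.commute)
next
  case 4
  then show ?case by (simp add: homotopic_refl)
next
  case (5 i ws)
  have 1: "homotopic (item_area i + items_area ws) (item_word i @ items_word ws) (item_val i @ items_val ws)"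
    using 5 by (intro homotopic_append) auto
  have "F3_word (item_val i @ items_val ws)" using 5 items_F3 by simp
  then have 2: "homotopic 0 (item_val i @ items_val ws) (fg_norm (item_val i @ items_val ws))"
    by (intro homotopic_norm_eq F3_Gamma_word F3_word_norm) (simp_all add: fg_norm_id)
  from homotopic_trans[OF 1 2] show ?case by simp
qed

text \<open>The two invariants needed of a word trivial in \<open>Gamma\<close>: exponent zero gives
  a complete pairing, and the trivial action makes the value of this pairing trivial, as
  \<open>area_linear\<close> requires.\<close>

lemma gcl_trivial:
  assumes w: "Gamma_word w" "gcl w = gcl []"
  shows "t_exponent w = 0" "foldr F3_act w [] = []"
proof -
  define act where "act x n = (if fst x = 3 then (if snd x then n - 1 else n + 1) else (n::int))" for x :: "nat \<times> bool" and n
  have fold: "foldr act u n = t_exponent u + n" for u n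
    by (induction u) (auto simp: t_exponent_def act_def)
  have "foldr act w 0 = foldr act [] 0"
    by (rule pres_class_act[where Z = UNIV and Y = "{0, 1, 2, 3}", OF _ _ Gamma_rels_carrier _ w(1)[unfolded Gamma_word_def] _ w(2)[unfolded gcl_def]])
       (auto simp: act_def Gamma_rels_def)
  then show "t_exponent w = 0" using fold by simp
  let ?X = "{g. fg_reduced g \<and> F3_word g}"
  have inv: "F3_act (x, s) (F3_act (x, \<not> s) g) = g" if "x \<in> {0, 1, 2, 3}" "g \<in> ?X" for x s g
  proof (cases "x = 3")
    case True
    then show ?thesis using that by (cases s) (auto simp: F3_act_simps phi_psi psi_phi fg_norm_id)
  next
    case False
    have "fg_norm ((x, s) # fg_norm ((x, \<not> s) # g)) = fg_norm ([(x, s)] @ [(x, \<not> s)] @ g)"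
      using fg_norm_append_right[of "[(x, s)]" "(x, \<not> s) # g"] by simp
    also have "\<dots> = g" using fg_norm_cancel_mid[of "[]" "[(x, s)]" g] that by (simp add: fg_inv_def fg_norm_id)
    finally show ?thesis using False by (simp add: F3_act_def)
  qed
  have closed: "F3_act (x, s) g \<in> ?X" if "x \<in> {0, 1, 2, 3}" "g \<in> ?X" for x s g
    using that by (auto simp: F3_act_def intro!: F3_word_norm)
  have rel: "foldr F3_act r g = g" if r: "r \<in> Gamma_rels" and g: "g \<in> ?X" for r g
  proof -
    have p: "phi [(0, False)] = [(1, False)]" "phi [(1, False)] = [(2, False)]" "phi [(2, False)] = [(0, False), (1, False)]"
      by (simp_all add: phi_def fg_lift_def fg_norm_def fg_cons_def)
    obtain i where i: "i \<in> {0, 1, 2}" "r = [(3, False), (i, False), (3, True)] @ fg_inv (phi [(i, False)])"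
      using r by (auto simp: Gamma_rels_def p[simplified] fg_inv_def)
    have F: "foldr F3_act u h = fg_norm (u @ h)" if "F3_word u" "fg_reduced h" for u h
      using that
    proof (induction u)
      case (Cons y u)
      then show ?case using fg_norm_append_right[of "[y]" "u @ h"] by (simp add: F3_act_simps)
    qed (simp add: fg_norm_id)
    let ?h = "fg_norm (fg_inv (phi [(i, False)]) @ g)"
    have Fh: "F3_word ?h" using g by (intro F3_word_norm) simp
    have "foldr F3_act r g = phi (fg_norm ((i, False) # psi ?h))"
      using F[of "fg_inv (phi [(i, False)])" g] g i by (simp add: F3_act_simps)
    also have "\<dots> = fg_norm (phi [(i, False)] @ phi (psi ?h))" using phi_append[of "[(i, False)]" "psi ?h"] by simp
    also have "\<dots> = fg_norm (phi [(i, False)] @ fg_inv (phi [(i, False)]) @ g)" by (simp only: phi_psi[OF Fh] fg_norm_append_right)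
    also have "\<dots> = g" using fg_norm_cancel_mid[of "[]" "phi [(i, False)]" g] g by (simp add: fg_norm_id)
    finally show ?thesis .
  qed
  have "foldr F3_act w [] = foldr F3_act [] []"
    by (rule pres_class_act[where Z = ?X and Y = "{0, 1, 2, 3}", OF closed inv Gamma_rels_carrier rel w(1)[unfolded Gamma_word_def] _ w(2)[unfolded gcl_def]]) auto
  then show "foldr F3_act w [] = []" by simp
qed

text \<open>Pauses of the walk have zero chain and are dropped, hence an inequality for the
  length.\<close>

lemma walk_word:
  "GM.is_walk xs \<Longrightarrow> \<exists>w. Gamma_word w \<and> length w \<le> length xs \<and> last xs = gmul (hd xs) w \<and>
     (\<forall>p. walk_chain xs p = word_chain (hd xs) w p)"
proof (induction xs rule: induct_list012)
  case (2 x)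
  then show ?case by (intro exI[of _ "[]"]) simp
next
  case (3 x y zs)
  then have "GM.is_walk (y # zs)" "gdist x y \<le> 1" by (auto simp: GM.is_walk_def)
  then obtain w where w: "Gamma_word w" "length w \<le> length (y # zs)" "last (y # zs) = gmul y w"
    "\<forall>p. walk_chain (y # zs) p = word_chain y w p" using 3 by auto
  from gdist_le_1[OF \<open>gdist x y \<le> 1\<close>] show ?case
  proof (elim disjE exE conjE)
    assume "x = y"
    then show ?thesis using w by (intro exI[of _ w]) auto
  next
    fix a assume a: "fst a \<in> {0, 1, 2, 3}" "y = gmul x [a]"
    then have "gmul x (a # w) = gmul y w" using gmul_append[of "[a]" w x] w by simp
    then show ?thesis using w a by (intro exI[of _ "a # w"]) (auto simp: word_chain_Cons)
  qed
qed (simp add: GM.is_walk_def)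

lemma Gamma_linear_fillings: "GM.linear_fillings 6 781"
  unfolding GM.linear_fillings_def
proof (intro allI impI)
  fix xs assume xs: "GM.closed_walk xs"
  then obtain w where w: "Gamma_word w" "length w \<le> length xs" "last xs = gmul (hd xs) w"
    "\<forall>p. walk_chain xs p = word_chain (hd xs) w p"
    using walk_word[of xs] unfolding GM.closed_walk_def by blast
  let ?x = "hd xs"
  have "gmul ?x w = ?x" using w(3) xs by (simp add: GM.closed_walk_def)
  then have "Rep_gamma_elt ?x \<otimes>\<^bsub>Gamma\<^esub> gcl w = Rep_gamma_elt ?x" using Rep_gmul[OF w(1), of ?x] by simp
  then have cl: "gcl w = gcl []"
    using Gamma.l_cancel_one[OF Rep_gamma_elt gcl_closed[OF w(1)]] gcl_Nil by simp
  obtain ws where ws: "min_area ws" "items_word ws = w"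
    using items_exist[OF w(1)[unfolded Gamma_word_def] gcl_trivial(1)[OF w(1) cl]] .
  have ok: "items_ok ws" by (rule min_area_ok[OF ws(1)])
  have val: "items_val ws = []"
    using foldr_F3_act(2)[OF ok, of "[]"] gcl_trivial(2)[OF w(1) cl] ws(2) by (simp add: fg_norm_id)
  have "homotopic (items_area ws) w []" using items_homotopic(2)[OF ok] ws(2) val by simp
  then obtain Ls where Ls: "GM.is_filling 6 (\<lambda>p. word_chain ?x w p - word_chain ?x [] p) Ls" "length Ls \<le> items_area ws"
    unfolding homotopic_def by blast
  have "length Ls \<le> 781 * length xs"
    using Ls(2) area_linear[OF ws(1) val] ws(2) w(2) by simp
  moreover have "GM.is_filling 6 (walk_chain xs) Ls" using Ls(1) w(4) by (simp add: GM.is_filling_def)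
  ultimately show "\<exists>Ls. GM.is_filling 6 (walk_chain xs) Ls \<and> length Ls \<le> 781 * length xs" by blast
qed

theorem Gamma_hyperbolic: "word_hyperbolic Gamma"
proof -
  obtain \<delta> :: real where \<delta>: "\<And>x y z w. (real (gdist w x) + real (gdist w y) - real (gdist x y)) / 2 \<ge>
       min ((real (gdist w x) + real (gdist w z) - real (gdist x z)) / 2)
           ((real (gdist w y) + real (gdist w z) - real (gdist y z)) / 2) - \<delta>"
    using GM.linear_fillings_four_point[OF Gamma_linear_fillings] by auto
  have "\<forall>x\<in>carrier Gamma. \<forall>y\<in>carrier Gamma. \<forall>z\<in>carrier Gamma. \<forall>w\<in>carrier Gamma.
        gromov_product Gamma Gamma_gens w x y \<ge>
          min (gromov_product Gamma Gamma_gens w x z) (gromov_product Gamma Gamma_gens w y z) - \<delta>"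
  proof (intro ballI)
    fix x y z w assume c: "x \<in> carrier Gamma" "y \<in> carrier Gamma" "z \<in> carrier Gamma" "w \<in> carrier Gamma"
    show "gromov_product Gamma Gamma_gens w x y \<ge>
          min (gromov_product Gamma Gamma_gens w x z) (gromov_product Gamma Gamma_gens w y z) - \<delta>"
      using \<delta>[where x = "Abs_gamma_elt x" and y = "Abs_gamma_elt y" and z = "Abs_gamma_elt z" and w = "Abs_gamma_elt w"] c
      by (simp add: gdist_def gromov_product_def Abs_gamma_elt_inverse)
  qed
  then show ?thesis
    unfolding word_hyperbolic_def using Gamma_group Gamma_gens_carrier Gamma_gens_generate
    by (intro conjI exI[of _ Gamma_gens] exI[of _ \<delta>]) (auto simp: Gamma_gens_def)
qed

section \<open>A finite index subgroup with a free quotient\<close>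

text \<open>A labelled permutation representation on 112 points: the generators \<open>a\<close> and \<open>t\<close> act on
  \<open>{0..<112}\<close> times the free group on \<open>{0, 1}\<close>, commuting with right multiplication. It was found
  by a computer search: a subgroup of index 14 with first Betti number 2 has a double cover with a
  homomorphism to the integers whose Alexander polynomial vanishes modulo 2, and the double cyclic
  cover of the latter maps onto the free product of the integers and a group of order 2, which
  contains a free group of rank 2 with index 2. The label codes 0, 1, 2, 3, 4 stand for the words
  \<open>1\<close>, \<open>x\<close>, \<open>x\<inverse>\<close>, \<open>y\<close>, \<open>y\<inverse>\<close>.\<close>

definition perm_a_table :: "nat list" where "perm_a_table =
  [4, 5, 6, 7, 0, 1, 2, 3, 14, 15, 12, 13, 10, 11, 8, 9, 32, 33, 35, 34, 36, 37, 38, 39, 48,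
    49, 50, 51, 54, 55, 52, 53, 16, 17, 18, 19, 20, 21, 23, 22, 76, 77, 78, 79, 72, 73, 74, 75,
    25, 24, 26, 27, 30, 31, 29, 28, 58, 59, 56, 57, 62, 63, 60, 61, 71, 70, 68, 69, 67, 66, 64,
    65, 44, 45, 46, 47, 40, 41, 42, 43, 104, 105, 106, 107, 108, 109, 110, 111, 90, 91, 89, 88,
    95, 94, 92, 93, 103, 102, 101, 100, 98, 99, 96, 97, 80, 81, 82, 83, 85, 84, 87, 86]"

definition perm_a :: "nat \<Rightarrow> nat" where "perm_a i = perm_a_table ! i"

definition perm_a_inv_table :: "nat list" where "perm_a_inv_table =
  [4, 5, 6, 7, 0, 1, 2, 3, 14, 15, 12, 13, 10, 11, 8, 9, 32, 33, 34, 35, 36, 37, 39, 38, 49,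
    48, 50, 51, 55, 54, 52, 53, 16, 17, 19, 18, 20, 21, 22, 23, 76, 77, 78, 79, 72, 73, 74, 75,
    24, 25, 26, 27, 30, 31, 28, 29, 58, 59, 56, 57, 62, 63, 60, 61, 70, 71, 69, 68, 66, 67, 65,
    64, 44, 45, 46, 47, 40, 41, 42, 43, 104, 105, 106, 107, 109, 108, 111, 110, 91, 90, 88, 89,
    94, 95, 93, 92, 102, 103, 100, 101, 99, 98, 97, 96, 80, 81, 82, 83, 84, 85, 86, 87]"

definition perm_a_inv :: "nat \<Rightarrow> nat" where "perm_a_inv i = perm_a_inv_table ! i"

definition perm_t_table :: "nat list" where "perm_t_table =
  [8, 9, 10, 11, 12, 13, 14, 15, 26, 27, 24, 25, 28, 29, 30, 31, 0, 1, 2, 3, 4, 5, 6, 7, 56,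
    57, 58, 59, 60, 61, 62, 63, 66, 67, 64, 65, 68, 69, 70, 71, 18, 19, 16, 17, 22, 23, 20, 21,
    88, 89, 90, 91, 92, 93, 94, 95, 106, 107, 104, 105, 108, 109, 110, 111, 100, 101, 102, 103,
    98, 99, 96, 97, 32, 33, 34, 35, 36, 37, 39, 38, 40, 41, 42, 43, 44, 45, 47, 46, 85, 84, 87,
    86, 80, 81, 82, 83, 48, 49, 50, 51, 52, 53, 55, 54, 72, 73, 74, 75, 76, 77, 79, 78]"

definition perm_t :: "nat \<Rightarrow> nat" where "perm_t i = perm_t_table ! i"

definition perm_t_inv_table :: "nat list" where "perm_t_inv_table =
  [16, 17, 18, 19, 20, 21, 22, 23, 0, 1, 2, 3, 4, 5, 6, 7, 42, 43, 40, 41, 46, 47, 44, 45, 10,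
    11, 8, 9, 12, 13, 14, 15, 72, 73, 74, 75, 76, 77, 79, 78, 80, 81, 82, 83, 84, 85, 87, 86,
    96, 97, 98, 99, 100, 101, 103, 102, 24, 25, 26, 27, 28, 29, 30, 31, 34, 35, 32, 33, 36, 37,
    38, 39, 104, 105, 106, 107, 108, 109, 111, 110, 92, 93, 94, 95, 89, 88, 91, 90, 48, 49, 50,
    51, 52, 53, 54, 55, 70, 71, 68, 69, 64, 65, 66, 67, 58, 59, 56, 57, 60, 61, 62, 63]"

definition perm_t_inv :: "nat \<Rightarrow> nat" where "perm_t_inv i = perm_t_inv_table ! i"

definition label_a_table :: "nat list" where "label_a_table =
  [0, 0, 0, 0, 2, 4, 2, 4, 0, 0, 1, 3, 0, 0, 1, 3, 0, 0, 0, 0, 0, 0, 0, 0, 2, 4, 2, 4, 0, 0, 1,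
    3, 0, 0, 0, 0, 0, 0, 0, 0, 0, 0, 0, 0, 0, 0, 0, 0, 0, 0, 0, 0, 0, 0, 3, 1, 0, 0, 1, 3, 2,
    4, 0, 0, 0, 0, 1, 3, 0, 0, 1, 3, 0, 0, 0, 0, 0, 0, 0, 0, 0, 0, 0, 0, 0, 0, 0, 0, 0, 0, 1,
    3, 2, 4, 0, 0, 4, 2, 0, 0, 2, 4, 0, 0, 0, 0, 0, 0, 0, 0, 0, 0]"

definition label_a :: "nat \<Rightarrow> nat" where "label_a i = label_a_table ! i"

definition label_t_table :: "nat list" where "label_t_table =
  [0, 0, 0, 0, 0, 0, 0, 0, 0, 0, 1, 3, 0, 0, 0, 0, 0, 0, 0, 0, 0, 0, 0, 0, 0, 0, 0, 0, 0, 0, 0,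
    0, 2, 4, 0, 0, 0, 0, 0, 0, 2, 4, 0, 0, 2, 4, 0, 0, 0, 0, 0, 0, 0, 0, 0, 0, 0, 0, 1, 3, 0,
    0, 0, 0, 0, 0, 0, 0, 2, 4, 0, 0, 0, 0, 0, 0, 0, 0, 0, 0, 0, 0, 0, 0, 1, 3, 3, 1, 0, 0, 0,
    0, 0, 0, 0, 0, 0, 0, 0, 0, 0, 0, 0, 0, 0, 0, 0, 0, 0, 0, 0, 0]"

definition label_t :: "nat \<Rightarrow> nat" where "label_t i = label_t_table ! i"

lemma tables:
  "map perm_a [0..<112] = perm_a_table"
  "map perm_a_inv [0..<112] = perm_a_inv_table"
  "map perm_t [0..<112] = perm_t_table"
  "map perm_t_inv [0..<112] = perm_t_inv_table"
  "map label_a [0..<112] = label_a_table"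
  "map label_t [0..<112] = label_t_table"
proof -
  have "length perm_a_table = 112" by (simp add: perm_a_table_def)
  from map_nth[of perm_a_table, unfolded this] show "map perm_a [0..<112] = perm_a_table" by (simp only: perm_a_def[abs_def])
  have "length perm_a_inv_table = 112" by (simp add: perm_a_inv_table_def)
  from map_nth[of perm_a_inv_table, unfolded this] show "map perm_a_inv [0..<112] = perm_a_inv_table" by (simp only: perm_a_inv_def[abs_def])
  have "length perm_t_table = 112" by (simp add: perm_t_table_def)
  from map_nth[of perm_t_table, unfolded this] show "map perm_t [0..<112] = perm_t_table" by (simp only: perm_t_def[abs_def])
  have "length perm_t_inv_table = 112" by (simp add: perm_t_inv_table_def)
  from map_nth[of perm_t_inv_table, unfolded this] show "map perm_t_inv [0..<112] = perm_t_inv_table" by (simp only: perm_t_inv_def[abs_def])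
  have "length label_a_table = 112" by (simp add: label_a_table_def)
  from map_nth[of label_a_table, unfolded this] show "map label_a [0..<112] = label_a_table" by (simp only: label_a_def[abs_def])
  have "length label_t_table = 112" by (simp add: label_t_table_def)
  from map_nth[of label_t_table, unfolded this] show "map label_t [0..<112] = label_t_table" by (simp only: label_t_def[abs_def])
qed

lemma upt_112: "[0..<112] =
    [0::nat, 1, 2, 3, 4, 5, 6, 7, 8, 9, 10, 11, 12, 13, 14, 15, 16, 17, 18, 19, 20, 21, 22,
    23, 24, 25, 26, 27, 28, 29, 30, 31, 32, 33, 34, 35, 36, 37, 38, 39, 40, 41, 42, 43, 44,
    45, 46, 47, 48, 49, 50, 51, 52, 53, 54, 55, 56, 57, 58, 59, 60, 61, 62, 63, 64, 65, 66,
    67, 68, 69, 70, 71, 72, 73, 74, 75, 76, 77, 78, 79, 80, 81, 82, 83, 84, 85, 86, 87, 88,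
    89, 90, 91, 92, 93, 94, 95, 96, 97, 98, 99, 100, 101, 102, 103, 104, 105, 106, 107, 108,
    109, 110, 111]"
  by (simp add: upt_rec)

text \<open>Unrolling the lists turns the tables into 672 rewrite rules.\<close>

lemmas table_eqs = tables[unfolded upt_112 perm_a_table_def perm_a_inv_table_def perm_t_table_def perm_t_inv_table_def label_a_table_def label_t_table_def list.map list.inject, simplified]

definition label_word :: "nat \<Rightarrow> nat fword" where
  "label_word n = (if n = 0 then [] else if n = 1 then [(0, False)] else if n = 2 then [(0, True)]
     else if n = 3 then [(1, False)] else [(1, True)])"

text \<open>Words act from the left, while the tables give the point reached by the inverse letter:
  \<open>perm_a\<close> is used for a^-1 and its inverse for a, with the labels inverted
  accordingly.\<close>

definition act_a :: "bool \<Rightarrow> nat \<times> nat fword \<Rightarrow> nat \<times> nat fword" where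
  "act_a s p = (if s then (perm_a (fst p), fg_norm (fg_inv (label_word (label_a (fst p))) @ snd p))
     else (perm_a_inv (fst p), fg_norm (label_word (label_a (perm_a_inv (fst p))) @ snd p)))"

definition act_t :: "bool \<Rightarrow> nat \<times> nat fword \<Rightarrow> nat \<times> nat fword" where
  "act_t s p = (if s then (perm_t (fst p), fg_norm (fg_inv (label_word (label_t (fst p))) @ snd p))
     else (perm_t_inv (fst p), fg_norm (label_word (label_t (perm_t_inv (fst p))) @ snd p)))"

text \<open>The letters b and c act as t a t^-1 and t^2 a t^-2. The first two relators then hold by
  construction.\<close>

definition act_G :: "nat \<times> bool \<Rightarrow> nat \<times> nat fword \<Rightarrow> nat \<times> nat fword" where
  "act_G x p = (if fst x = 3 then act_t (snd x) p else if fst x = 0 then act_a (snd x) p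
     else if fst x = 1 then act_t False (act_a (snd x) (act_t True p))
     else act_t False (act_t False (act_a (snd x) (act_t True (act_t True p)))))"

definition points :: "(nat \<times> nat fword) set" where
  "points = {p. fst p < 112 \<and> snd p \<in> carrier (free_group {0, 1})}"

lemma tables_check:
  "list_all (\<lambda>i. perm_a i < 112 \<and> perm_a_inv i < 112 \<and> perm_t i < 112 \<and> perm_t_inv i < 112 \<and>
     perm_a (perm_a_inv i) = i \<and> perm_a_inv (perm_a i) = i \<and>
     perm_t (perm_t_inv i) = i \<and> perm_t_inv (perm_t i) = i) [0..<112]"
  unfolding upt_112 by (simp add: table_eqs)

text \<open>The word t^3 a t^-2 a^-1 t^-1 a^-1 is the third relator with b and c eliminated. Testing
  it at the identity of each copy is enough, because the action commutes with right
  multiplication.\<close>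

lemma relator_check:
  "list_all (\<lambda>i. act_t False (act_t False (act_t False (act_a False (act_t True (act_t True
     (act_a True (act_t True (act_a True (i, []))))))))) = (i, [])) [0..<112]"
  unfolding upt_112
  by (simp add: act_a_def act_t_def table_eqs label_word_def fg_norm_def fg_cons_def fg_inv_def)

lemma perm_facts:
  assumes "i < 112"
  shows "perm_a i < 112" "perm_a_inv i < 112" "perm_t i < 112" "perm_t_inv i < 112"
     "perm_a (perm_a_inv i) = i" "perm_a_inv (perm_a i) = i"
     "perm_t (perm_t_inv i) = i" "perm_t_inv (perm_t i) = i"
  using tables_check assms unfolding list_all_iff set_upt by auto

lemma label_word_letters: "fst ` set (label_word n) \<subseteq> {0, 1}"
  by (auto simp: label_word_def)

lemma label_word_carrier:
  assumes "g \<in> carrier (free_group {0, 1})"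
  shows "fg_norm (label_word n @ g) \<in> carrier (free_group {0, 1})"
    "fg_norm (fg_inv (label_word n) @ g) \<in> carrier (free_group {0, 1})"
proof -
  have g: "fst ` set g \<subseteq> {0, 1}" using assms by (auto simp: free_group_sel)
  have *: "fg_norm w \<in> carrier (free_group {0, 1})" if "fst ` set w \<subseteq> {0, 1}" for w :: "nat fword"
    unfolding free_group_sel using order_trans[OF image_mono[OF set_fg_norm] that] by simp
  show "fg_norm (label_word n @ g) \<in> carrier (free_group {0, 1})"
    by (rule * ) (simp only: set_append image_Un Un_subset_iff label_word_letters g simp_thms)
  show "fg_norm (fg_inv (label_word n) @ g) \<in> carrier (free_group {0, 1})"
    by (rule * ) (simp only: set_append image_Un Un_subset_iff fst_set_fg_inv label_word_letters g simp_thms)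
qed

lemma act_at_closed:
  assumes "p \<in> points" shows "act_a s p \<in> points" "act_t s p \<in> points"
  using assms perm_facts[of "fst p"] label_word_carrier[of "snd p"]
  by (auto simp: points_def act_a_def act_t_def)

lemma act_at_inverse:
  assumes "p \<in> points" shows "act_a s (act_a (\<not> s) p) = p" "act_t s (act_t (\<not> s) p) = p"
proof -
  have i: "fst p < 112" and g: "fg_norm (snd p) = snd p"
    using assms by (auto simp: points_def free_group_sel fg_norm_id)
  have 1: "fg_norm (fg_inv u @ fg_norm (u @ snd p)) = snd p" "fg_norm (u @ fg_norm (fg_inv u @ snd p)) = snd p" for u
    using fg_norm_cancel_mid[of "[]" "fg_inv u" "snd p"] fg_norm_cancel_mid[of "[]" u "snd p"] g by simp_all
  show "act_a s (act_a (\<not> s) p) = p" "act_t s (act_t (\<not> s) p) = p"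
    using perm_facts[OF i] 1 by (cases s; simp add: act_a_def act_t_def prod_eq_iff)+
qed

lemma act_G_closed: "p \<in> points \<Longrightarrow> act_G x p \<in> points"
  by (simp add: act_G_def act_at_closed)

lemma act_G_inverse: "p \<in> points \<Longrightarrow> act_G (x, s) (act_G (x, \<not> s) p) = p"
  using act_at_inverse(2)[of _ True] act_at_inverse(2)[of _ False]
  by (simp add: act_G_def act_at_closed act_at_inverse)

definition equivariant :: "(nat \<times> nat fword \<Rightarrow> nat \<times> nat fword) \<Rightarrow> bool" where
  "equivariant f \<longleftrightarrow> (\<forall>i g. f (i, g) = (fst (f (i, [])), fg_norm (snd (f (i, [])) @ g)))"

lemma equivariantD: "equivariant f \<Longrightarrow> f (i, g) = (fst (f (i, [])), fg_norm (snd (f (i, [])) @ g))"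
  unfolding equivariant_def by blast

lemma equivariant_comp:
  assumes "equivariant f" "equivariant h" shows "equivariant (\<lambda>p. f (h p))"
  unfolding equivariant_def
proof (intro allI)
  fix i g
  let ?j = "fst (h (i, []))" and ?l = "snd (h (i, []))"
  have "f (h (i, g)) = f (?j, fg_norm (?l @ g))" using equivariantD[OF assms(2), of i g] by simp
  also have "\<dots> = (fst (f (?j, [])), fg_norm (snd (f (?j, [])) @ ?l @ g))"
    using equivariantD[OF assms(1), of ?j "fg_norm (?l @ g)"] by simp
  finally have 1: "f (h (i, g)) = (fst (f (?j, [])), fg_norm (snd (f (?j, [])) @ ?l @ g))" .
  have 2: "f (h (i, [])) = (fst (f (?j, [])), fg_norm (snd (f (?j, [])) @ ?l))"
    using equivariantD[OF assms(1), of ?j ?l] by simp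
  show "f (h (i, g)) = (fst (f (h (i, []))), fg_norm (snd (f (h (i, []))) @ g))"
    unfolding 1 2 by simp
qed

lemma equivariant_act: "equivariant (act_a s)" "equivariant (act_t s)"
  by (auto simp: equivariant_def act_a_def act_t_def)

lemma equivariant_act_G: "equivariant (act_G x)"
proof -
  have 1: "equivariant (\<lambda>p. act_t False (act_a (snd x) (act_t True p)))"
    by (rule equivariant_comp[OF equivariant_act(2) equivariant_comp[OF equivariant_act]])
  have 2: "equivariant (\<lambda>p. act_t False (act_t False (act_a (snd x) (act_t True (act_t True p)))))"
    by (rule equivariant_comp[OF equivariant_act(2) equivariant_comp[OF equivariant_act(2)
          equivariant_comp[OF equivariant_act(1) equivariant_comp[OF equivariant_act(2,2)]]]])
  show ?thesis
  proof (cases "fst x = 3 \<or> fst x = 0")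
    case True
    then have "act_G x = act_t (snd x) \<or> act_G x = act_a (snd x)"
      by (auto simp: act_G_def fun_eq_iff)
    then show ?thesis using equivariant_act by metis
  next
    case False
    show ?thesis
    proof (cases "fst x = 1")
      case True
      then have "act_G x = (\<lambda>p. act_t False (act_a (snd x) (act_t True p)))"
        by (simp add: act_G_def fun_eq_iff)
      then show ?thesis using 1 by (simp only:)
    next
      case 3: False
      then have "act_G x = (\<lambda>p. act_t False (act_t False (act_a (snd x) (act_t True (act_t True p)))))"
        using False by (simp add: act_G_def fun_eq_iff)
      then show ?thesis using 2 by (simp only:)
    qed
  qed
qed

text \<open>The empty word is excluded because the identity does not reduce its argument;
  \<open>foldr_act_G\<close> covers it for reduced arguments.\<close>

lemma equivariant_word: "w \<noteq> [] \<Longrightarrow> equivariant (foldr act_G w)"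
proof (induction w)
  case (Cons x w)
  show ?case
  proof (cases "w = []")
    case True
    then have "foldr act_G (x # w) = act_G x" by (simp add: fun_eq_iff)
    then show ?thesis using equivariant_act_G[of x] by (simp only:)
  next
    case False
    then have "equivariant (foldr act_G w)" by (rule Cons.IH)
    moreover have "foldr act_G (x # w) = (\<lambda>p. act_G x (foldr act_G w p))" by (simp add: fun_eq_iff)
    ultimately show ?thesis by (simp only: equivariant_comp[OF equivariant_act_G])
  qed
qed simp

lemma foldr_act_G:
  assumes "(i, g) \<in> points"
  shows "foldr act_G w (i, g) = (fst (foldr act_G w (i, [])), fg_norm (snd (foldr act_G w (i, [])) @ g))"
proof (cases "w = []")
  case True
  then show ?thesis using assms by (simp add: points_def free_group_sel fg_norm_id)
next
  case False
  from equivariant_word[OF False] show ?thesis by (rule equivariantD)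
qed

lemma act_G_relators:
  assumes "r \<in> Gamma_rels" "p \<in> points" shows "foldr act_G r p = p"
proof -
  have tt: "act_t False (act_t True q) = q" "act_t True (act_t False q) = q" "act_a False (act_a True q) = q"
    if "q \<in> points" for q
    using act_at_inverse[OF that, of False] act_at_inverse[OF that, of True] by simp_all
  have rel: "act_t False (act_t False (act_t False (act_a False (act_t True (act_t True
     (act_a True (act_t True (act_a True p)))))))) = p"
  proof -
    let ?f = "\<lambda>p. act_t False (act_t False (act_t False (act_a False (act_t True (act_t True
     (act_a True (act_t True (act_a True p))))))))"
    have e: "equivariant ?f"
      by (rule equivariant_comp[OF equivariant_act(2) equivariant_comp[OF equivariant_act(2)
          equivariant_comp[OF equivariant_act(2) equivariant_comp[OF equivariant_act(1)
          equivariant_comp[OF equivariant_act(2) equivariant_comp[OF equivariant_act(2)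
          equivariant_comp[OF equivariant_act(1) equivariant_comp[OF equivariant_act(2,1)]]]]]]]])
    have "fst p < 112" using assms(2) by (simp add: points_def)
    then have "?f (fst p, []) = (fst p, [])" using relator_check
      unfolding list_all_iff set_upt by simp
    then show ?thesis using equivariantD[OF e, of "fst p" "snd p"] assms(2)
      by (simp add: points_def free_group_sel fg_norm_id)
  qed
  from assms(1) consider "r = [(3, False), (0, False), (3, True), (1, True)]"
    | "r = [(3, False), (1, False), (3, True), (2, True)]"
    | "r = [(3, False), (2, False), (3, True), (1, True), (0, True)]"
    unfolding Gamma_rels_def by blast
  then show ?thesis
  proof cases
    case 1
    then show ?thesis using assms(2) tt by (simp add: act_G_def act_at_closed)
  next
    case 2
    then show ?thesis using assms(2) tt by (simp add: act_G_def act_at_closed)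
  next
    case 3
    then show ?thesis using assms(2) tt rel by (simp add: act_G_def act_at_closed)
  qed
qed

lemma act_G_cong:
  assumes "Gamma_word u" "Gamma_word v" "gcl u = gcl v" "p \<in> points"
  shows "foldr act_G u p = foldr act_G v p"
  by (rule pres_class_act[where Z = points and Y = "{0, 1, 2, 3}", OF act_G_closed act_G_inverse Gamma_rels_carrier act_G_relators])
     (use assms in \<open>auto simp: Gamma_word_def gcl_def\<close>)

definition class_act :: "nat fword set \<Rightarrow> nat \<times> nat fword \<Rightarrow> nat \<times> nat fword" where
  "class_act c = foldr act_G (SOME w. Gamma_word w \<and> gcl w = c)"

lemma class_act_gcl: "Gamma_word w \<Longrightarrow> p \<in> points \<Longrightarrow> class_act (gcl w) p = foldr act_G w p"
proof -
  assume w: "Gamma_word w" and p: "p \<in> points"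
  have "\<exists>v. Gamma_word v \<and> gcl v = gcl w" using w by blast
  from someI_ex[OF this] show ?thesis unfolding class_act_def using act_G_cong w p by blast
qed

lemma base_point: "(0, g) \<in> points \<longleftrightarrow> g \<in> carrier (free_group {0, 1})"
  by (simp add: points_def)

lemma Nil_carrier: "[] \<in> carrier (free_group Y)"
  by (simp add: free_group_sel)

lemma foldr_act_G_closed: "p \<in> points \<Longrightarrow> foldr act_G w p \<in> points"
  by (induction w) (auto simp: act_G_closed)

lemma class_act_closed: "c \<in> carrier Gamma \<Longrightarrow> p \<in> points \<Longrightarrow> class_act c p \<in> points"
  by (auto simp: class_act_def foldr_act_G_closed)

lemma class_act_mult:
  assumes "c \<in> carrier Gamma" "e \<in> carrier Gamma" "p \<in> points"
  shows "class_act (c \<otimes>\<^bsub>Gamma\<^esub> e) p = class_act c (class_act e p)"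
proof -
  obtain u v where uv: "Gamma_word u" "c = gcl u" "Gamma_word v" "e = gcl v"
    using assms by (auto simp: Gamma_carrier)
  have "class_act (gcl (u @ v)) p = foldr act_G u (foldr act_G v p)"
    using class_act_gcl[of "u @ v" p] uv assms by simp
  then show ?thesis using uv assms by (simp add: gcl_append class_act_gcl foldr_act_G_closed)
qed

lemma class_act_one: "p \<in> points \<Longrightarrow> class_act \<one>\<^bsub>Gamma\<^esub> p = p"
  using class_act_gcl[of "[]" p] by (simp add: gcl_Nil)

lemma class_act_equivariant:
  assumes "c \<in> carrier Gamma" "(i, g) \<in> points"
  shows "class_act c (i, g) = (fst (class_act c (i, [])), fg_norm (snd (class_act c (i, [])) @ g))"
  unfolding class_act_def by (rule foldr_act_G[OF assms(2)])

section \<open>The stabilizer of a copy and its free quotient\<close>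

definition stab :: "nat fword set set" where
  "stab = {c \<in> carrier Gamma. fst (class_act c (0, [])) = 0}"

lemma base: "(0, []) \<in> points" by (simp add: base_point Nil_carrier)

lemma stab_act:
  assumes "c \<in> stab" "g \<in> carrier (free_group {0, 1})"
  shows "class_act c (0, g) = (0, fg_norm (snd (class_act c (0, [])) @ g))"
  using class_act_equivariant[of c 0 g] assms by (simp add: stab_def base_point)

lemma class_act_snd: "c \<in> carrier Gamma \<Longrightarrow> snd (class_act c (0, [])) \<in> carrier (free_group {0, 1})"
  using class_act_closed[OF _ base] by (simp add: points_def)

lemma stab_inv:
  assumes "c \<in> carrier Gamma" "e \<in> carrier Gamma" "fst (class_act c (0, [])) = fst (class_act e (0, []))"
  shows "inv\<^bsub>Gamma\<^esub> c \<otimes>\<^bsub>Gamma\<^esub> e \<in> stab"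
proof -
  define i where "i = fst (class_act c (0, []))"
  obtain l m where l: "class_act c (0, []) = (i, l)" and m: "class_act e (0, []) = (i, m)"
    using assms(3) i_def by (metis prod.collapse)
  have il: "(i, l) \<in> points" "(i, m) \<in> points" using class_act_closed[OF assms(1) base] class_act_closed[OF assms(2) base] l m by simp_all
  have ic: "inv\<^bsub>Gamma\<^esub> c \<in> carrier Gamma" using assms by simp
  have "class_act (inv\<^bsub>Gamma\<^esub> c) (i, l) = (0, [])"
    using class_act_mult[OF ic assms(1) base] assms(1) l class_act_one[OF base] by simp
  then have "fst (class_act (inv\<^bsub>Gamma\<^esub> c) (i, [])) = 0"
    using class_act_equivariant[OF ic il(1)] by simp
  then have "fst (class_act (inv\<^bsub>Gamma\<^esub> c) (i, m)) = 0"
    using class_act_equivariant[OF ic il(2)] by simp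
  then show ?thesis using class_act_mult[OF ic assms(2) base] m assms ic by (simp add: stab_def)
qed

lemma stab_subgroup: "subgroup stab Gamma"
proof
  show "stab \<subseteq> carrier Gamma" by (auto simp: stab_def)
  show one: "\<one>\<^bsub>Gamma\<^esub> \<in> stab" using class_act_one[OF base] by (simp add: stab_def)
  fix x assume x: "x \<in> stab"
  then have xc: "x \<in> carrier Gamma" by (simp add: stab_def)
  show "inv\<^bsub>Gamma\<^esub> x \<in> stab"
    using stab_inv[OF xc Gamma.one_closed] x one xc by (simp add: stab_def)
  fix y assume y: "y \<in> stab"
  then have yc: "y \<in> carrier Gamma" by (simp add: stab_def)
  have "class_act (x \<otimes>\<^bsub>Gamma\<^esub> y) (0, []) = class_act x (0, snd (class_act y (0, [])))"
    using class_act_mult[OF xc yc base] y by (simp add: stab_def) (metis prod.collapse)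
  then show "x \<otimes>\<^bsub>Gamma\<^esub> y \<in> stab"
    using stab_act[OF x class_act_snd[OF yc]] xc yc by (simp add: stab_def)
qed

text \<open>The right coset of g is determined by the copy to which g^-1 moves copy 0, so there are
  at most 112 of them.\<close>

lemma stab_finite_index: "finite (rcosets\<^bsub>Gamma\<^esub> stab)"
proof -
  define k where "k g = fst (class_act (inv\<^bsub>Gamma\<^esub> g) (0, []))" for g
  have k: "k g < 112" if "g \<in> carrier Gamma" for g
    using class_act_closed[OF _ base, of "inv\<^bsub>Gamma\<^esub> g"] that by (simp add: k_def points_def)
  have eq: "stab #>\<^bsub>Gamma\<^esub> g = stab #>\<^bsub>Gamma\<^esub> h" if g: "g \<in> carrier Gamma" and h: "h \<in> carrier Gamma" and kk: "k g = k h" for g h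
  proof -
    have "inv\<^bsub>Gamma\<^esub> (inv\<^bsub>Gamma\<^esub> h) \<otimes>\<^bsub>Gamma\<^esub> inv\<^bsub>Gamma\<^esub> g \<in> stab"
      by (rule stab_inv) (use g h kk in \<open>simp_all add: k_def\<close>)
    then have s: "h \<otimes>\<^bsub>Gamma\<^esub> inv\<^bsub>Gamma\<^esub> g \<in> stab" using h by simp
    have "h = (h \<otimes>\<^bsub>Gamma\<^esub> inv\<^bsub>Gamma\<^esub> g) \<otimes>\<^bsub>Gamma\<^esub> g" using g h by (simp add: Gamma.m_assoc)
    then have "h \<in> stab #>\<^bsub>Gamma\<^esub> g" using s unfolding r_coset_def by blast
    then show ?thesis by (rule Gamma.repr_independence[OF _ g stab_subgroup])
  qed
  define F where "F n = stab #>\<^bsub>Gamma\<^esub> (SOME g. g \<in> carrier Gamma \<and> k g = n)" for n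
  have "rcosets\<^bsub>Gamma\<^esub> stab \<subseteq> F ` {..<112}"
  proof
    fix C assume "C \<in> rcosets\<^bsub>Gamma\<^esub> stab"
    then obtain g where g: "g \<in> carrier Gamma" "C = stab #>\<^bsub>Gamma\<^esub> g" by (auto simp: RCOSETS_def)
    have "\<exists>h. h \<in> carrier Gamma \<and> k h = k g" using g by blast
    from someI_ex[OF this] have "F (k g) = C" unfolding F_def g(2) using eq g(1) by metis
    then show "C \<in> F ` {..<112}" using k[OF g(1)] by (intro image_eqI[of _ _ "k g"]) auto
  qed
  then show ?thesis by (rule finite_subset) simp
qed

definition stab_map :: "nat fword set \<Rightarrow> nat fword" where
  "stab_map c = snd (class_act c (0, []))"

lemma stab_map_mult:
  assumes "x \<in> stab" "y \<in> stab"
  shows "stab_map (x \<otimes>\<^bsub>Gamma\<^esub> y) = fg_norm (stab_map x @ stab_map y)"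
proof -
  have c: "x \<in> carrier Gamma" "y \<in> carrier Gamma" using assms by (simp_all add: stab_def)
  have "class_act (x \<otimes>\<^bsub>Gamma\<^esub> y) (0, []) = class_act x (0, stab_map y)"
    using class_act_mult[OF c base] assms(2) by (simp add: stab_def stab_map_def) (metis prod.collapse)
  then show ?thesis using stab_act[OF assms(1), of "stab_map y"] class_act_snd[OF c(2)] by (simp add: stab_map_def)
qed

text \<open>Explicit preimages of the free generators: a^-2 for the first and a t^2 a^4 t^-2 a for
  the second.\<close>

definition F2_lift :: "nat \<times> bool \<Rightarrow> nat fword" where
  "F2_lift x = (if fst x = 0 then (if snd x then [(0, False), (0, False)] else [(0, True), (0, True)])
     else (let w = [(0, False), (3, False), (3, False), (0, False), (0, False), (0, False), (0, False),
        (3, True), (3, True), (0, False)] in if snd x then fg_inv w else w))"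

lemma F2_lift_check:
  "\<forall>x\<in>{(0, False), (0, True), (1, False), (1, True)}. foldr act_G (F2_lift x) (0, []) = (0, [x])"
  by (simp add: F2_lift_def act_G_def act_a_def act_t_def table_eqs label_word_def fg_norm_def fg_cons_def fg_inv_def)

lemma F2_lift_letter:
  assumes "fst x \<in> {0, 1}"
  shows "gcl (F2_lift x) \<in> stab" "stab_map (gcl (F2_lift x)) = [x]"
proof -
  have "x \<in> {(0, False), (0, True), (1, False), (1, True)}" using assms by (cases x; cases "snd x") auto
  then have e: "foldr act_G (F2_lift x) (0, []) = (0, [x])" using F2_lift_check by blast
  have w: "Gamma_word (F2_lift x)" by (simp add: F2_lift_def Let_def)
  show "gcl (F2_lift x) \<in> stab" "stab_map (gcl (F2_lift x)) = [x]"
    using class_act_gcl[OF w base] e gcl_closed[OF w] by (simp_all add: stab_def stab_map_def)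
qed

lemma stab_map_surj:
  assumes "w \<in> carrier (free_group {0, 1})" shows "w \<in> stab_map ` stab"
proof -
  have "fst ` set w \<subseteq> {0, 1} \<Longrightarrow> fg_norm w \<in> stab_map ` stab" for w
  proof (induction w)
    case Nil
    have "stab_map \<one>\<^bsub>Gamma\<^esub> = []" using class_act_one[OF base] by (simp add: stab_map_def)
    then show ?case using subgroup.one_closed[OF stab_subgroup] by (metis fg_norm_Nil imageI)
  next
    case (Cons x w)
    then obtain c where c: "c \<in> stab" "stab_map c = fg_norm w" by auto
    have x: "gcl (F2_lift x) \<in> stab" "stab_map (gcl (F2_lift x)) = [x]" using F2_lift_letter[of x] Cons.prems by auto
    have "stab_map (gcl (F2_lift x) \<otimes>\<^bsub>Gamma\<^esub> c) = fg_norm (x # w)"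
      using stab_map_mult[OF x(1) c(1)] x(2) c(2) fg_norm_append_right[of "[x]" w] by simp
    moreover have "gcl (F2_lift x) \<otimes>\<^bsub>Gamma\<^esub> c \<in> stab" using subgroup.m_closed[OF stab_subgroup x(1) c(1)] .
    ultimately show ?case by (metis imageI)
  qed
  from this[of w] show ?thesis using assms unfolding free_group_sel by (simp add: fg_norm_id)
qed

theorem Gamma_large: "large Gamma"
  unfolding large_def
proof (intro exI[of _ stab] conjI exI[of _ "{0, 1} :: nat set"] exI[of _ stab_map])
  show "subgroup stab Gamma" by (rule stab_subgroup)
  show "finite (rcosets\<^bsub>Gamma\<^esub> stab)" by (rule stab_finite_index)
  show "\<exists>x\<in>{0, 1}. \<exists>y\<in>{0, 1}. x \<noteq> (y::nat)" by auto
  have closed: "stab_map c \<in> carrier (free_group {0, 1})" if "c \<in> stab" for c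
    using that class_act_snd[of c] by (simp add: stab_def stab_map_def)
  show "stab_map \<in> hom (Gamma\<lparr>carrier := stab\<rparr>) (free_group {0, 1})"
    using closed stab_map_mult by (auto simp: hom_def free_group_sel(2))
  show "stab_map ` stab = carrier (free_group {0, 1})"
    using closed stab_map_surj by blast
qed

section \<open>The Magnus expansion\<close>

definition cnt :: "'a \<Rightarrow> 'a fword \<Rightarrow> int" where
  "cnt i w = (\<Sum>x\<leftarrow>w. if fst x = i then (if snd x then -1 else 1) else 0)"

lemma cnt_simps [simp]:
  "cnt i [] = 0"
  "cnt i (x # w) = (if fst x = i then (if snd x then -1 else 1) else 0) + cnt i w"
  "cnt i (u @ v) = cnt i u + cnt i v"
  by (simp_all add: cnt_def)

lemma cnt_norm [simp]: "cnt i (fg_norm w) = cnt i w"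
proof (induction w)
  case (Cons x w)
  have "cnt i (fg_cons x v) = cnt i (x # v)" for v
    by (cases v) (auto simp: fg_cons_def)
  then show ?case using Cons by (simp add: fg_norm_Cons)
qed simp

lemma cnt_inv [simp]: "cnt i (fg_inv w) = - cnt i w"
  by (induction w) (auto simp: fg_inv_Cons)

text \<open>A homomorphism to the integers factors through the abelianization.\<close>

lemma additive_eq_sum_cnt:
  fixes h :: "'a fword \<Rightarrow> int"
  assumes add: "\<And>u v. u \<in> carrier (free_group Y) \<Longrightarrow> v \<in> carrier (free_group Y) \<Longrightarrow>
      h (fg_norm (u @ v)) = h u + h v"
    and Y: "finite Y" and w: "w \<in> carrier (free_group Y)"
  shows "h w = (\<Sum>i\<in>Y. cnt i w * h [(i, False)])"
proof -
  have nil: "h [] = 0" using add[of "[]" "[]"] by (simp add: free_group_sel)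
  have *: "h (fg_norm w) = (\<Sum>i\<in>Y. cnt i w * h [(i, False)])" if "fst ` set w \<subseteq> Y" for w
    using that
  proof (induction w)
    case Nil
    then show ?case using nil by simp
  next
    case (Cons x w)
    obtain j s where x: "x = (j, s)" by (cases x)
    have j: "j \<in> Y" using Cons.prems x by simp
    have "h (fg_norm ([x] @ fg_norm w)) = h [x] + h (fg_norm w)"
      by (rule add) (use Cons.prems set_fg_norm[of w] in \<open>auto simp: free_group_sel\<close>)
    then have 1: "h (fg_norm (x # w)) = h [x] + (\<Sum>i\<in>Y. cnt i w * h [(i, False)])"
      using Cons fg_norm_append_right[of "[x]" w] by simp
    have "h (fg_norm ([(j, True)] @ [(j, False)])) = h [(j, True)] + h [(j, False)]"
      by (rule add) (use j in \<open>auto simp: free_group_sel\<close>)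
    then have "h [(j, True)] = - h [(j, False)]" using nil by (simp add: fg_norm_Cons fg_cons_def)
    then have "h [x] = (\<Sum>i\<in>Y. if i = j then (if s then -1 else 1) * h [(i, False)] else 0)"
      using Y j by (cases s) (simp_all add: x)
    also have "\<dots> = (\<Sum>i\<in>Y. cnt i [x] * h [(i, False)])"
      by (rule sum.cong) (auto simp: x)
    finally have 2: "h [x] = (\<Sum>i\<in>Y. cnt i [x] * h [(i, False)])" .
    have "cnt i (x # w) * h [(i, False)] = cnt i [x] * h [(i, False)] + cnt i w * h [(i, False)]" for i
      by (simp add: distrib_right)
    then show ?case unfolding 1 2 by (simp only: sum.distrib)
  qed
  from this[of w] show ?thesis using w by (simp add: free_group_sel fg_norm_id)
qed

text \<open>\<open>magnus w m\<close> is the coefficient of the monomial \<open>m\<close> in the Magnus expansion of \<open>w\<close>, which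
  sends a generator \<open>x\<close> to the non-commutative power series \<open>1 + x\<close>.\<close>
function magnus :: "'a fword \<Rightarrow> 'a list \<Rightarrow> int" where
  "magnus [] m = (if m = [] then 1 else 0)"
| "magnus ((i, False) # w) m =
    magnus w m + (if m \<noteq> [] \<and> hd m = i then magnus w (tl m) else 0)"
| "magnus ((i, True) # w) m =
    magnus w m - (if m \<noteq> [] \<and> hd m = i then magnus ((i, True) # w) (tl m) else 0)"
  by pat_completeness auto
text \<open>For an inverse letter, V = (1 + x)^-1 W is computed from V = W - x V; that recursion
  shortens the monomial and not the word.\<close>

termination by (relation "measures [\<lambda>(w, m). length w, \<lambda>(w, m). length m]") auto

declare magnus.simps(2,3) [simp del]

lemma magnus_simps [simp]:
  "magnus ((i, s) # w) [] = magnus w []"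
  "magnus ((i, False) # w) (j # m) = magnus w (j # m) + (if j = i then magnus w m else 0)"
  "magnus ((i, True) # w) (j # m) =
    magnus w (j # m) - (if j = i then magnus ((i, True) # w) m else 0)"
  by (cases s; simp add: magnus.simps)+

lemma magnus_one [simp]: "magnus w [] = 1"
proof (induction w)
  case (Cons x w)
  then show ?case by (cases x; cases "snd x") auto
qed simp

lemma magnus_other: "m = [] \<or> hd m \<noteq> i \<Longrightarrow> magnus ((i, s) # w) m = magnus w m"
  by (cases m; cases s) auto

lemma magnus_inverse_pair: "magnus ((i, s) # (i, \<not> s) # w) m = magnus w m"
proof (cases s)
  case True
  have "magnus ((i, True) # (i, False) # w) m = magnus w m"
    by (induction m) auto
  then show ?thesis using True by simp
next
  case False
  then show ?thesis by (cases m) auto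
qed

lemma magnus_Cons_cong:
  assumes "\<And>m. magnus u m = magnus v m" shows "magnus (x # u) m = magnus (x # v) m"
proof (cases x)
  case (Pair i s)
  have "magnus ((i, True) # u) m = magnus ((i, True) # v) m"
    by (induction m) (use assms in auto)
  moreover have "magnus ((i, False) # u) m = magnus ((i, False) # v) m"
    by (cases m) (use assms in auto)
  ultimately show ?thesis by (cases s) (simp_all add: Pair)
qed

lemma magnus_norm [simp]: "magnus (fg_norm w) m = magnus w m"
proof (induction w arbitrary: m)
  case (Cons x w)
  have "magnus (fg_cons x v) m = magnus (x # v) m" for v
    using magnus_inverse_pair[of "fst x" "snd x"]
    by (cases v; cases x) (auto simp: fg_cons_def simp del: magnus_simps)
  then show ?case using magnus_Cons_cong[OF Cons.IH] by (simp add: fg_norm_Cons)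
qed simp

text \<open>If the series of \<open>v\<close> is 1 up to degree N, a product of non-constant terms
  of \<open>u\<close> and \<open>v\<close> has degree at least N + 2, so up to degree N + 1 the
  non-constant parts add.\<close>

lemma magnus_append_additive:
  assumes v: "\<And>m. m \<noteq> [] \<Longrightarrow> length m \<le> N \<Longrightarrow> magnus v m = 0" and m: "length m \<le> Suc N"
  shows "magnus (u @ v) m = magnus u m + (if m = [] then 0 else magnus v m)"
  using m
proof (induction u arbitrary: m)
  case (Cons x u)
  obtain i s where x: "x = (i, s)" by (cases x)
  note IH = Cons.IH
  have "magnus ((i, True) # u @ v) m = magnus ((i, True) # u) m + (if m = [] then 0 else magnus v m)"
    if "length m \<le> Suc N" for m
    using that
  proof (induction m)
    case (Cons j m)
    then show ?case using v[of m] IH[of "j # m"] by auto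
  qed simp
  moreover have "magnus ((i, False) # u @ v) m = magnus ((i, False) # u) m + (if m = [] then 0 else magnus v m)"
    using IH[of m] IH[of "tl m"] Cons.prems v[of "tl m"] by (cases m) auto
  ultimately show ?case using Cons.prems by (cases s) (auto simp: x)
qed simp

abbreviation syl :: "'a list \<Rightarrow> nat" where
  "syl m \<equiv> length (remdups_adj m)"

lemma syl_Cons: "syl (i # m) = (if m \<noteq> [] \<and> hd m = i then syl m else Suc (syl m))"
  by (cases m) auto

text \<open>A monomial in the expansion is a product of powers of the generators of successive
  syllables, so it has no more syllables than the word. Putting the first generator in front keeps
  track of the first syllable in the induction.\<close>

lemma magnus_support:
  "w \<noteq> [] \<Longrightarrow> magnus w m \<noteq> 0 \<Longrightarrow> syl (fst (hd w) # m) \<le> syl (map fst w)"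
proof (induction w arbitrary: m)
  case (Cons x w)
  obtain i s where x: "x = (i, s)" by (cases x)
  have base: "syl (i # n) \<le> syl (map fst (x # w))" if n: "magnus w n \<noteq> 0" for n
  proof (cases "w = []")
    case True
    then show ?thesis using n by (auto simp: x split: if_splits)
  next
    case False
    then show ?thesis using Cons.IH[OF False n] by (cases w) (auto simp: x syl_Cons split: if_splits)
  qed
  have "syl (i # n) \<le> syl (map fst (x # w))" if "magnus ((i, True) # w) n \<noteq> 0" for n
    using that
  proof (induction n)
    case Nil
    then show ?case by (intro base) auto
  next
    case (Cons j n)
    then show ?case using base[of "j # n"] by (cases "j = i"; cases "magnus w (j # n) = 0") auto
  qed
  moreover have "syl (i # m) \<le> syl (map fst (x # w))" if "magnus ((i, False) # w) m \<noteq> 0"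
  proof (cases "magnus w m = 0")
    case True
    then have "m = i # tl m" "magnus w (tl m) \<noteq> 0" using that by (cases m; auto split: if_splits)+
    then show ?thesis using base[of "tl m"] by (metis remdups_adj.simps(3))
  qed (rule base)
  ultimately show ?case using Cons.prems(2) by (cases s) (auto simp: x)
qed simp

text \<open>For a reduced word with syllables \<open>x\<^sub>1^e\<^sub>1 \<dots> x\<^sub>k^e\<^sub>k\<close> the coefficient of \<open>x\<^sub>1 \<dots> x\<^sub>k\<close> is
  \<open>e\<^sub>1 \<dots> e\<^sub>k\<close>, and that of \<open>x\<^sub>2 \<dots> x\<^sub>k\<close> is \<open>e\<^sub>2 \<dots> e\<^sub>k\<close>; the sign of their product is that of \<open>e\<^sub>1\<close>.\<close>
lemma magnus_syllables:
  "fg_reduced w \<Longrightarrow> w \<noteq> [] \<Longrightarrow>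
    0 < (if snd (hd w) then -1 else 1) * magnus w (remdups_adj (map fst w)) *
          magnus w (tl (remdups_adj (map fst w)))"
proof (induction w)
  case (Cons x w)
  obtain i s where x: "x = (i, s)" by (cases x)
  define \<sigma> :: int where "\<sigma> = (if s then -1 else 1)"
  have \<sigma>: "\<sigma> * \<sigma> = 1" by (simp add: \<sigma>_def)
  have step: "magnus ((i, s) # w) (i # m) = magnus w (i # m) + \<sigma> * magnus w m"
    if "m = [] \<or> hd m \<noteq> i" for m
    using that magnus_other[OF that, of True w] by (cases s) (simp_all add: \<sigma>_def)
  show ?case
  proof (cases w)
    case Nil
    then show ?thesis by (cases s) (auto simp: x)
  next
    case (Cons y v)
    obtain j r where y: "y = (j, r)" by (cases y)
    define n where "n = tl (remdups_adj (map fst w))"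
    have sy: "remdups_adj (map fst w) = j # n"
      unfolding n_def Cons y by (metis fst_conv list.simps(9) remdups_adj_Cons_alt)
    have n: "n = [] \<or> hd n \<noteq> j"
      using distinct_adj_remdups_adj[of "map fst w"] unfolding sy by (cases n) auto
    have IH: "0 < (if r then -1 else 1) * magnus w (j # n) * magnus w n"
      using Cons.IH Cons.prems unfolding sy by (simp add: Cons y fg_reduced_Cons)
    show ?thesis
    proof (cases "i = j")
      case True
      then have "r = s" using Cons.prems by (auto simp: x y Cons fg_reduced_Cons)
      have e: "remdups_adj (map fst (x # w)) = i # n" using sy True by (simp add: x y Cons)
      have "0 < \<sigma> * magnus w (i # n) * magnus w n" using IH \<open>r = s\<close> True by (simp add: \<sigma>_def)
      moreover have "\<sigma> * (magnus w (i # n) + \<sigma> * magnus w n) * magnus w n =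
          \<sigma> * magnus w (i # n) * magnus w n + (\<sigma> * \<sigma>) * (magnus w n * magnus w n)"
        by (simp add: algebra_simps)
      ultimately have "0 < \<sigma> * (magnus w (i # n) + \<sigma> * magnus w n) * magnus w n"
        using \<sigma> by (simp add: add_pos_nonneg)
      moreover have "magnus ((i, s) # w) (i # n) = magnus w (i # n) + \<sigma> * magnus w n"
        by (rule step) (use n True in simp)
      moreover have "magnus ((i, s) # w) n = magnus w n"
        by (rule magnus_other) (use n True in simp)
      ultimately show ?thesis unfolding e by (simp add: x \<sigma>_def del: magnus_simps)
    next
      case False
      have e: "remdups_adj (map fst (x # w)) = i # j # n" using sy False by (simp add: x y Cons)
      have c: "magnus w (j # n) \<noteq> 0" using IH by auto
      \<comment> \<open>Preceded by j this monomial would have two syllables more than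
        \<open>w\<close>.\<close>
      have "magnus w (i # j # n) = 0"
      proof (rule ccontr)
        assume "magnus w (i # j # n) \<noteq> 0"
        from magnus_support[OF _ this] have "syl (j # i # j # n) \<le> syl (map fst w)" by (simp add: Cons y)
        moreover have "syl (j # n) = syl (map fst w)" 
          using distinct_adj_remdups_adj[of "map fst w"] unfolding sy
          by (simp add: distinct_adj_conv_length_remdups_adj sy)
        ultimately show False using False by simp
      qed
      then have 1: "magnus ((i, s) # w) (i # j # n) = \<sigma> * magnus w (j # n)" using step[of "j # n"] False by simp
      have 2: "magnus ((i, s) # w) (j # n) = magnus w (j # n)" by (rule magnus_other) (use False in simp)
      have "\<sigma> * (\<sigma> * magnus w (j # n)) * magnus w (j # n) = magnus w (j # n) * magnus w (j # n)"
        using \<sigma> by (metis mult.assoc mult_1)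
      also have "\<dots> > 0" using c by (simp add: zero_less_mult_iff) linarith
      finally show ?thesis unfolding e using 1 2 by (simp add: x \<sigma>_def del: magnus_simps)
    qed
  qed
qed simp

lemma magnus_faithful:
  assumes "fg_reduced w" "w \<noteq> []" obtains m where "m \<noteq> []" "magnus w m \<noteq> 0"
proof
  show "remdups_adj (map fst w) \<noteq> []" using assms by simp
  show "magnus w (remdups_adj (map fst w)) \<noteq> 0" using magnus_syllables[OF assms] by auto
qed

text \<open>If the abelianization of \<open>F\<close> vanishes on a retract \<open>A\<close> of \<open>F\<close>, then Magnus coefficients of
  elements of \<open>A\<close> vanish by induction on the degree: the coefficients of the lowest degree are
  additive on \<open>A\<close>, and composed with the retraction they factor through the abelianization.\<close>
lemma retract_abelianization:
  assumes \<rho>: "\<rho> \<in> hom (free_group Y) (free_group Y)" and Y: "finite Y"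
    and A: "\<And>w. w \<in> carrier (free_group Y) \<Longrightarrow> \<rho> w \<in> A" "\<And>a. a \<in> A \<Longrightarrow> \<rho> a = a"
    and sub: "A \<subseteq> carrier (free_group Y)"
    and zero: "\<And>a i. a \<in> A \<Longrightarrow> cnt i a = 0"
  shows "A \<subseteq> {[]}"
proof -
  have van: "magnus a m = 0" if "a \<in> A" "m \<noteq> []" "length m \<le> N" for N a m
    using that
  proof (induction N arbitrary: a m)
    case (Suc N)
    define h where "h w = magnus (\<rho> w) m" for w
    have "h a = (\<Sum>i\<in>Y. cnt i a * h [(i, False)])"
    proof (rule additive_eq_sum_cnt[OF _ Y])
      fix u v assume u: "u \<in> carrier (free_group Y)" and v: "v \<in> carrier (free_group Y)"
      have "\<rho> (fg_norm (u @ v)) = fg_norm (\<rho> u @ \<rho> v)" using hom_mult[OF \<rho> u v] by (simp add: free_group_sel)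
      then have "h (fg_norm (u @ v)) = magnus (\<rho> u @ \<rho> v) m" by (simp add: h_def)
      also have "\<dots> = magnus (\<rho> u) m + (if m = [] then 0 else magnus (\<rho> v) m)"
        by (rule magnus_append_additive[OF Suc.IH Suc.prems(3)]) (use A v in auto)
      finally show "h (fg_norm (u @ v)) = h u + h v" using Suc.prems by (simp add: h_def)
    qed (use Suc.prems sub in auto)
    also have "\<dots> = 0" using zero[OF Suc.prems(1)] by simp
    finally show ?case using A(2)[OF Suc.prems(1)] by (simp add: h_def)
  qed simp
  show ?thesis
  proof
    fix a assume a: "a \<in> A"
    then have "fg_reduced a" using sub by (auto simp: free_group_sel)
    then show "a \<in> {[]}" using magnus_faithful[of a] van[OF a] by (metis order_refl singletonI)
  qed
qed

section \<open>Free products\<close>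

definition fp_eval :: "('h, 'm) monoid_scheme \<Rightarrow> (nat \<Rightarrow> 'g \<Rightarrow> 'h) \<Rightarrow> (nat \<times> 'g) list \<Rightarrow> 'h" where
  "fp_eval H f ps = foldr (\<lambda>p acc. f (fst p) (snd p) \<otimes>\<^bsub>H\<^esub> acc) ps \<one>\<^bsub>H\<^esub>"

lemma fp_eval_simps [simp]:
  "fp_eval H f [] = \<one>\<^bsub>H\<^esub>" "fp_eval H f (p # ps) = f (fst p) (snd p) \<otimes>\<^bsub>H\<^esub> fp_eval H f ps"
  by (simp_all add: fp_eval_def)

locale free_product_homs = G: group G + H: group H
  for G :: "('g, 'm) monoid_scheme" and H :: "('h, 'n) monoid_scheme" +
  fixes As :: "'g set list" and f :: "nat \<Rightarrow> 'g \<Rightarrow> 'h"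
  assumes decomp: "free_product_decomp G As"
    and f_hom: "\<And>i. i < length As \<Longrightarrow> f i \<in> hom (G\<lparr>carrier := As ! i\<rparr>) H"
begin

lemma factor_subgroup: "i < length As \<Longrightarrow> subgroup (As ! i) G"
  using decomp by (simp add: free_product_decomp_def)

definition valid :: "(nat \<times> 'g) list \<Rightarrow> bool" where
  "valid ps \<longleftrightarrow> (\<forall>p\<in>set ps. fst p < length As \<and> snd p \<in> As ! fst p)"

lemma valid_simps [simp]:
  "valid []" "valid (p # ps) \<longleftrightarrow> fst p < length As \<and> snd p \<in> As ! fst p \<and> valid ps"
  "valid (ps @ qs) \<longleftrightarrow> valid ps \<and> valid qs"
  by (auto simp: valid_def)

abbreviation "val \<equiv> fp_eval G (\<lambda>i x. x)"
abbreviation "img \<equiv> fp_eval H f"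

lemma factor_closed: "i < length As \<Longrightarrow> x \<in> As ! i \<Longrightarrow> x \<in> carrier G"
  using subgroup.mem_carrier[OF factor_subgroup] .

lemma f_closed: "i < length As \<Longrightarrow> x \<in> As ! i \<Longrightarrow> f i x \<in> carrier H"
  using f_hom[of i] by (auto simp: hom_def)

lemma f_mult: "i < length As \<Longrightarrow> x \<in> As ! i \<Longrightarrow> y \<in> As ! i \<Longrightarrow> f i (x \<otimes>\<^bsub>G\<^esub> y) = f i x \<otimes>\<^bsub>H\<^esub> f i y"
  using f_hom[of i] by (auto simp: hom_def)

lemma f_one: "i < length As \<Longrightarrow> f i \<one>\<^bsub>G\<^esub> = \<one>\<^bsub>H\<^esub>"
  using f_mult[of i "\<one>\<^bsub>G\<^esub>" "\<one>\<^bsub>G\<^esub>"] f_closed[of i "\<one>\<^bsub>G\<^esub>"] subgroup.one_closed[OF factor_subgroup, of i]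
  by simp

lemma eval_closed: "valid ps \<Longrightarrow> val ps \<in> carrier G" "valid ps \<Longrightarrow> img ps \<in> carrier H"
  by (induction ps) (auto simp: factor_closed f_closed)

lemma eval_append:
  "valid ps \<Longrightarrow> valid qs \<Longrightarrow> val (ps @ qs) = val ps \<otimes>\<^bsub>G\<^esub> val qs"
  "valid ps \<Longrightarrow> valid qs \<Longrightarrow> img (ps @ qs) = img ps \<otimes>\<^bsub>H\<^esub> img qs"
  by (induction ps) (auto simp: eval_closed factor_closed f_closed G.m_assoc H.m_assoc)

lemma eval_one: "valid ps \<Longrightarrow> val ps = \<one>\<^bsub>G\<^esub> \<Longrightarrow> img ps = \<one>\<^bsub>H\<^esub>"
proof (induction "length ps" arbitrary: ps rule: less_induct)
  case less
  consider "ps = []" | p where "p \<in> set ps" "snd p = \<one>\<^bsub>G\<^esub>"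
    | j where "Suc j < length ps" "fst (ps ! j) = fst (ps ! Suc j)"
    | "ps \<noteq> []" "\<forall>p\<in>set ps. snd p \<noteq> \<one>\<^bsub>G\<^esub>" "\<forall>j. Suc j < length ps \<longrightarrow> fst (ps ! j) \<noteq> fst (ps ! Suc j)"
    by blast
  then show ?case
  proof cases
    case (2 p)
    then obtain us vs where ps: "ps = us @ p # vs" by (metis split_list)
    then have v: "valid us" "valid vs" "fst p < length As" "valid (p # vs)" using less.prems by auto
    have "val ps = val (us @ vs)" "img ps = img (us @ vs)"
      using v eval_closed[OF v(2)] by (simp_all add: ps eval_append 2(2) f_one)
    then show ?thesis using less.hyps[of "us @ vs"] less.prems v by (simp add: ps)
  next
    case (3 j)
    define i x y where "i = fst (ps ! j)" "x = snd (ps ! j)" "y = snd (ps ! Suc j)"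
    have ps: "ps = take j ps @ (i, x) # (i, y) # drop (Suc (Suc j)) ps"
      using 3 by (metis Cons_nth_drop_Suc Suc_lessD i_x_y_def append_take_drop_id prod.collapse)
    define us vs where "us = take j ps" "vs = drop (Suc (Suc j)) ps"
    have ps: "ps = us @ (i, x) # (i, y) # vs" using ps unfolding us_vs_def .
    have v: "valid us" "valid vs" "i < length As" "x \<in> As ! i" "y \<in> As ! i" using less.prems unfolding ps by auto
    have xy: "x \<otimes>\<^bsub>G\<^esub> y \<in> As ! i" using subgroup.m_closed[OF factor_subgroup[OF v(3)] v(4,5)] .
    let ?qs = "us @ (i, x \<otimes>\<^bsub>G\<^esub> y) # vs"
    have c: "x \<in> carrier G" "y \<in> carrier G" "f i x \<in> carrier H" "f i y \<in> carrier H" "val vs \<in> carrier G" "img vs \<in> carrier H"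
      using factor_closed f_closed eval_closed v by auto
    have "val ps = val ?qs" "img ps = img ?qs"
      using v xy c by (simp_all add: ps eval_append f_mult G.m_assoc H.m_assoc)
    moreover have "img ?qs = \<one>\<^bsub>H\<^esub>"
      by (rule less.hyps) (use less.prems v xy calculation in \<open>auto simp: ps\<close>)
    ultimately show ?thesis by simp
  next
    case 4
    then have "val ps \<noteq> \<one>\<^bsub>G\<^esub>"
      using decomp less.prems(1) unfolding free_product_decomp_def valid_def fp_eval_def by blast
    then show ?thesis using less.prems by simp
  qed simp
qed

lemma eval_inverse:
  "valid ps \<Longrightarrow> \<exists>qs. valid qs \<and> val qs = inv\<^bsub>G\<^esub> val ps \<and> img qs = inv\<^bsub>H\<^esub> img ps"
proof (induction ps)
  case Nil
  then show ?case by (intro exI[of _ "[]"]) simp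
next
  case (Cons p ps)
  then obtain qs where q: "valid qs" "val qs = inv\<^bsub>G\<^esub> val ps" "img qs = inv\<^bsub>H\<^esub> img ps" by auto
  have p: "fst p < length As" "snd p \<in> As ! fst p" "valid ps" using Cons.prems by auto
  have i: "inv\<^bsub>G\<^esub> snd p \<in> As ! fst p" using subgroup.m_inv_closed[OF factor_subgroup] p by blast
  have "f (fst p) (inv\<^bsub>G\<^esub> snd p) \<otimes>\<^bsub>H\<^esub> f (fst p) (snd p) = \<one>\<^bsub>H\<^esub>"
    using f_mult[OF p(1) i p(2)] factor_closed[OF p(1,2)] f_one[OF p(1)] by simp
  then have "f (fst p) (inv\<^bsub>G\<^esub> snd p) = inv\<^bsub>H\<^esub> f (fst p) (snd p)"
    using H.inv_equality f_closed p i by metis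
  then show ?case
    using p q i eval_closed[OF p(3)] factor_closed[OF p(1,2)] f_closed[OF p(1,2)]
    by (intro exI[of _ "qs @ [(fst p, inv\<^bsub>G\<^esub> snd p)]"])
      (auto simp: eval_append G.inv_mult_group H.inv_mult_group)
qed

lemma eval_wd:
  assumes "valid ps" "valid qs" "val ps = val qs" shows "img ps = img qs"
proof -
  obtain rs where r: "valid rs" "val rs = inv\<^bsub>G\<^esub> val qs" "img rs = inv\<^bsub>H\<^esub> img qs"
    using eval_inverse[OF assms(2)] by blast
  have "img (ps @ rs) = \<one>\<^bsub>H\<^esub>"
    by (rule eval_one) (use assms r eval_closed in \<open>auto simp: eval_append\<close>)
  then have "img ps \<otimes>\<^bsub>H\<^esub> inv\<^bsub>H\<^esub> img qs = \<one>\<^bsub>H\<^esub>" using assms r by (simp add: eval_append)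
  then show ?thesis using eval_closed(2) assms by (metis H.inv_equality H.inv_inv H.inv_closed)
qed

lemma val_surj: "g \<in> carrier G \<Longrightarrow> \<exists>ps. valid ps \<and> val ps = g"
proof -
  assume "g \<in> carrier G"
  then have "g \<in> generate G (\<Union>(set As))" using decomp by (simp add: free_product_decomp_def)
  then show ?thesis
  proof (induction rule: generate.induct)
    case one
    then show ?case by (intro exI[of _ "[]"]) simp
  next
    case (incl h)
    then obtain i where "i < length As" "h \<in> As ! i" by (auto simp: in_set_conv_nth)
    then show ?case by (intro exI[of _ "[(i, h)]"]) (simp add: factor_closed)
  next
    case (inv h)
    then obtain i where "i < length As" "h \<in> As ! i" by (auto simp: in_set_conv_nth)
    then show ?case using subgroup.m_inv_closed[OF factor_subgroup, of i h]
      by (intro exI[of _ "[(i, inv\<^bsub>G\<^esub> h)]"]) (simp add: factor_closed)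
  next
    case (eng h1 h2)
    then show ?case using eval_append(1) by (metis valid_simps(3))
  qed
qed

text \<open>The universal property of the free product; \<open>eval_wd\<close> makes the image
  independent of the chosen factorization.\<close>

lemma extension: "\<exists>\<rho>\<in>hom G H. \<forall>i<length As. \<forall>x\<in>As ! i. \<rho> x = f i x"
proof -
  define \<rho> where "\<rho> g = img (SOME ps. valid ps \<and> val ps = g)" for g
  have \<rho>: "\<rho> (val ps) = img ps" if "valid ps" for ps
  proof -
    have "\<exists>qs. valid qs \<and> val qs = val ps" using that by blast
    from someI_ex[OF this] show ?thesis unfolding \<rho>_def using eval_wd that by blast
  qed
  have "\<rho> \<in> hom G H"
  proof (rule homI)
    fix g assume "g \<in> carrier G"
    then show "\<rho> g \<in> carrier H" using val_surj \<rho> eval_closed(2) by metis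
  next
    fix g h assume "g \<in> carrier G" "h \<in> carrier G"
    then obtain ps qs where "valid ps" "val ps = g" "valid qs" "val qs = h" using val_surj by meson
    then show "\<rho> (g \<otimes>\<^bsub>G\<^esub> h) = \<rho> g \<otimes>\<^bsub>H\<^esub> \<rho> h"
      using \<rho>[of "ps @ qs"] \<rho>[of ps] \<rho>[of qs] by (auto simp: eval_append)
  qed
  moreover have "\<rho> x = f i x" if "i < length As" "x \<in> As ! i" for i x
    using \<rho>[of "[(i, x)]"] that by (simp add: factor_closed f_closed)
  ultimately show ?thesis by blast
qed

end

lemma free_product_retraction:
  assumes G: "group G" and d: "free_product_decomp G [A, B]"
  shows "\<exists>\<rho>\<in>hom G G. (\<forall>x\<in>A. \<rho> x = x) \<and> (\<forall>x\<in>B. \<rho> x = \<one>\<^bsub>G\<^esub>) \<and> \<rho> ` carrier G \<subseteq> A"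
proof -
  interpret group G by fact
  have A: "subgroup A G" and B: "subgroup B G" using d by (auto simp: free_product_decomp_def)
  let ?H = "G\<lparr>carrier := A\<rparr>"
  interpret free_product_homs G ?H "[A, B]" "\<lambda>i x. if i = 0 then x else \<one>\<^bsub>G\<^esub>"
  proof (rule free_product_homs.intro[OF G subgroup_imp_group[OF A]], unfold_locales)
    show "free_product_decomp G [A, B]" by fact
    fix i assume "i < length [A, B]"
    then have "i = 0 \<or> i = 1" by auto
    then show "(\<lambda>x. if i = 0 then x else \<one>\<^bsub>G\<^esub>) \<in> hom (G\<lparr>carrier := [A, B] ! i\<rparr>) ?H"
      using subgroup.one_closed[OF A] by (auto simp: hom_def)
  qed
  obtain \<rho> where \<rho>: "\<rho> \<in> hom G ?H" "\<forall>i<2. \<forall>x\<in>[A, B] ! i. \<rho> x = (if i = 0 then x else \<one>\<^bsub>G\<^esub>)"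
    using extension by auto
  have "\<rho> \<in> hom G G" using \<rho>(1) subgroup.subset[OF A] by (auto simp: hom_def)
  moreover have "\<rho> x = x" if "x \<in> A" for x using \<rho>(2)[rule_format, of 0 x] that by simp
  moreover have "\<rho> x = \<one>\<^bsub>G\<^esub>" if "x \<in> B" for x using \<rho>(2)[rule_format, of 1 x] that by simp
  moreover have "\<rho> ` carrier G \<subseteq> A" using \<rho>(1) by (auto simp: hom_def)
  ultimately show ?thesis by blast
qed

lemma free_product_decomp_swap:
  assumes "free_product_decomp G [A, B]" shows "free_product_decomp G [B, A]"
  unfolding free_product_decomp_def
proof (intro conjI allI impI)
  show "\<forall>C\<in>set [B, A]. subgroup C G" "generate G (\<Union> (set [B, A])) = carrier G"
    using assms by (auto simp: free_product_decomp_def Un_commute)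
next
  fix ps :: "(nat \<times> 'a) list"
  assume ps: "ps \<noteq> []" "\<forall>p\<in>set ps. fst p < length [B, A] \<and> snd p \<in> [B, A] ! fst p \<and> snd p \<noteq> \<one>\<^bsub>G\<^esub>"
    "\<forall>j. Suc j < length ps \<longrightarrow> fst (ps ! j) \<noteq> fst (ps ! Suc j)"
  let ?qs = "map (\<lambda>p. (1 - fst p, snd p)) ps"
  have lt: "fst (ps ! j) < 2" if "j < length ps" for j using ps(2) nth_mem[OF that] by fastforce
  have "?qs \<noteq> []" using ps by simp
  moreover have "\<forall>p\<in>set ?qs. fst p < length [A, B] \<and> snd p \<in> [A, B] ! fst p \<and> snd p \<noteq> \<one>\<^bsub>G\<^esub>"
  proof -
    have "[A, B] ! (1 - i) = [B, A] ! i" "1 - i < 2" if "i < 2" for i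
      using that by (auto simp: less_2_cases_iff)
    then show ?thesis using ps(2) by (auto simp: numeral_2_eq_2)
  qed
  moreover have "\<forall>j. Suc j < length ?qs \<longrightarrow> fst (?qs ! j) \<noteq> fst (?qs ! Suc j)"
  proof (intro allI impI)
    fix j assume "Suc j < length ?qs"
    then show "fst (?qs ! j) \<noteq> fst (?qs ! Suc j)"
      using ps(3)[rule_format, of j] lt[of j] lt[of "Suc j"] by (auto simp: less_2_cases_iff)
  qed
  ultimately have "foldr (\<lambda>p acc. snd p \<otimes>\<^bsub>G\<^esub> acc) ?qs \<one>\<^bsub>G\<^esub> \<noteq> \<one>\<^bsub>G\<^esub>"
    using assms unfolding free_product_decomp_def by blast
  then show "foldr (\<lambda>p acc. snd p \<otimes>\<^bsub>G\<^esub> acc) ps \<one>\<^bsub>G\<^esub> \<noteq> \<one>\<^bsub>G\<^esub>" by (simp add: foldr_map comp_def)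
qed

section \<open>Irreducibility\<close>

type_synonym int3 = "int \<times> int \<times> int"

definition ab :: "nat fword \<Rightarrow> int3" where
  "ab w = (cnt 0 w, cnt 1 w, cnt 2 w)"

text \<open>Triples of integers are the elements of \<open>\<int>[\<theta>]\<close> with \<open>\<theta>\<^sup>3 = \<theta> + 1\<close>: the automorphism
  \<open>phi\<close> acts on the abelianization of \<open>F\<^sub>3\<close> as multiplication by \<open>\<theta>\<close>.\<close>
definition tmul :: "int3 \<Rightarrow> int3 \<Rightarrow> int3" where
  "tmul = (\<lambda>(x, y, z) (p, q, r). (x*p + y*r + z*q, x*q + y*p + y*r + z*q + z*r, x*r + y*q + z*p + z*r))"

definition theta :: "int3 \<Rightarrow> int3" where
  "theta = (\<lambda>(x, y, z). (z, x + z, y))"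

text \<open>The norm form of the ring in the basis 1, \<theta>, \<theta>^2.\<close>

definition tnorm :: "int3 \<Rightarrow> int" where
  "tnorm = (\<lambda>(x, y, z). x^3 + y^3 + z^3 + 2*x^2*z + x*z^2 - x*y^2 - y*z^2 - 3*x*y*z)"

definition det3 :: "int3 \<Rightarrow> int3 \<Rightarrow> int3 \<Rightarrow> int" where
  "det3 = (\<lambda>(a, b, c) (d, e, f) (g, h, i). a*(e*i - f*h) - b*(d*i - f*g) + c*(d*h - e*g))"

lemma ab_phi: "F3_word w \<Longrightarrow> ab (phi w) = theta (ab w)"
proof (induction w)
  case Nil
  then show ?case by (simp add: ab_def theta_def)
next
  case (Cons x w)
  have x: "fst x \<in> {0, 1, 2}" using Cons.prems by simp
  have "ab (phi [x]) = theta (ab [x])"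
    by (cases rule: letter_cases[OF x])
      (simp_all add: ab_def theta_def phi_def fg_lift_def fg_inv_def)
  moreover have "ab (phi (x # w)) = (cnt 0 (phi [x]) + cnt 0 (phi w), cnt 1 (phi [x]) + cnt 1 (phi w), cnt 2 (phi [x]) + cnt 2 (phi w))"
    using phi_append[of "[x]" w] by (simp add: ab_def)
  ultimately show ?case using Cons by (simp add: ab_def theta_def)
qed

lemma ab_phi_pow: "F3_word w \<Longrightarrow> F3_word ((phi ^^ k) w) \<and> ab ((phi ^^ k) w) = (theta ^^ k) (ab w)"
  by (induction k) (auto simp: ab_phi)

lemma theta_pow_tmul: "(theta ^^ k) v = tmul v ((theta ^^ k) (1, 0, 0))"
proof (induction k)
  case 0
  then show ?case by (cases v) (simp add: tmul_def)
next
  case (Suc k)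
  obtain p q r where "(theta ^^ k) (1, 0, 0) = (p, q, r)" by (metis prod_cases3)
  then show ?case using Suc by (cases v) (simp add: tmul_def theta_def algebra_simps)
qed

lemma theta_pow_nonneg:
  "case (theta ^^ k) (1, 0, 0) of (p, q, r) \<Rightarrow> 0 \<le> p \<and> 0 \<le> q \<and> 0 \<le> r \<and> 0 < p + q + r"
  by (induction k) (auto simp: theta_def split: prod.splits)

text \<open>With q = r = 0 the power of \<theta> would be an integer. The previous power would then
  have all coordinates zero, since they are nonnegative.\<close>

lemma theta_pow_not_int:
  assumes "k \<ge> 1" "(theta ^^ k) (1, 0, 0) = (p, q, r)" shows "q \<noteq> 0 \<or> r \<noteq> 0"
proof -
  obtain j where k: "k = Suc j" using assms(1) by (cases k) auto
  obtain a b c where "(theta ^^ j) (1, 0, 0) = (a, b, c)" by (metis prod_cases3)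
  then show ?thesis using theta_pow_nonneg[of j] assms(2) by (auto simp: k theta_def)
qed

text \<open>Modulo 2 the form has no zero other than the trivial one, so a solution can be halved
  forever. The norm form in \<open>tnorm_nonzero\<close> has the same property, because x^3 - x - 1
  is irreducible modulo 2.\<close>

lemma binary_form_nonzero:
  fixes q r :: int
  assumes "q^3 - q*r^2 - r^3 = 0" shows "q = 0 \<and> r = 0"
  using assms
proof (induction "nat \<bar>q\<bar> + nat \<bar>r\<bar>" arbitrary: q r rule: less_induct)
  case less
  have "even (q^3 - q*r^2 - r^3)" using less.prems by simp
  then have "even q \<and> even r" by (cases "even q"; cases "even r") simp_all
  then obtain a b where q: "q = 2 * a" "r = 2 * b" by (auto elim!: evenE)
  have "8 * (a^3 - a*b^2 - b^3) = 0" using less.prems unfolding q by (simp add: algebra_simps power2_eq_square power3_eq_cube)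
  then have "a^3 - a*b^2 - b^3 = 0" by simp
  have dbl: "nat \<bar>2 * a\<bar> = 2 * nat \<bar>a\<bar>" for a :: int by (simp add: abs_mult nat_mult_distrib)
  show ?case using \<open>a^3 - a*b^2 - b^3 = 0\<close> less.hyps[of a b] unfolding q dbl by (cases "a = 0 \<and> b = 0") auto
qed

lemma tnorm_nonzero: "tnorm (x, y, z) = 0 \<Longrightarrow> x = 0 \<and> y = 0 \<and> z = 0"
proof (induction "nat \<bar>x\<bar> + nat \<bar>y\<bar> + nat \<bar>z\<bar>" arbitrary: x y z rule: less_induct)
  case less
  have "even (tnorm (x, y, z))" using less.prems by simp
  then have "even x \<and> even y \<and> even z"
    unfolding tnorm_def by (cases "even x"; cases "even y"; cases "even z") simp_all
  then obtain a b c where q: "x = 2 * a" "y = 2 * b" "z = 2 * c" by (auto elim!: evenE)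
  have "8 * tnorm (a, b, c) = 0" using less.prems unfolding q tnorm_def
    by (simp add: algebra_simps power2_eq_square power3_eq_cube)
  then have "tnorm (a, b, c) = 0" by simp
  have dbl: "nat \<bar>2 * a\<bar> = 2 * nat \<bar>a\<bar>" for a :: int by (simp add: abs_mult nat_mult_distrib)
  show ?case using \<open>tnorm (a, b, c) = 0\<close> less.hyps[of a b c] unfolding q dbl by (cases "a = 0 \<and> b = 0 \<and> c = 0") auto
qed

text \<open>For \<beta> with coordinates p, q, r, the determinant of v, v \<beta>, v \<beta>^2 is
  the norm of v times the index form of \<beta>, which is cubic in q and r.\<close>

lemma det3_powers:
  "det3 v (tmul v (p, q, r)) (tmul (tmul v (p, q, r)) (p, q, r)) = tnorm v * (q^3 - q*r^2 - r^3)"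
  by (cases v) (simp add: det3_def tmul_def tnorm_def algebra_simps power2_eq_square power3_eq_cube)

definition tadd :: "int3 \<Rightarrow> int3 \<Rightarrow> int3" where
  "tadd = (\<lambda>(x, y, z) (p, q, r). (x + p, y + q, z + r))"

definition tscale :: "int \<Rightarrow> int3 \<Rightarrow> int3" where
  "tscale n = (\<lambda>(x, y, z). (n * x, n * y, n * z))"

lemma cramer3:
  "tscale (det3 v w t) u =
    tadd (tscale (det3 u w t) v) (tadd (tscale (det3 v u t) w) (tscale (det3 v w u) t))"
  by (cases v; cases w; cases t; cases u) (simp add: tscale_def tadd_def det3_def algebra_simps)

text \<open>With \<beta> = \<theta>^k the elements v, v \<beta> and v \<beta>^2 lie in
  \<open>V\<close> and have non-zero determinant; by Cramer's rule the multiples of this determinant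
  are integer combinations of them.\<close>

lemma invariant_lattice_full_rank:
  assumes V: "\<And>v w. v \<in> V \<Longrightarrow> w \<in> V \<Longrightarrow> tadd v w \<in> V" "\<And>v n. v \<in> V \<Longrightarrow> tscale n v \<in> V"
    and inv: "\<And>v. v \<in> V \<Longrightarrow> (theta ^^ k) v \<in> V" and k: "k \<ge> 1"
    and v: "v \<in> V" "v \<noteq> (0, 0, 0)"
  shows "\<exists>d\<noteq>0. \<forall>u. tscale d u \<in> V"
proof -
  obtain p q r where b: "(theta ^^ k) (1, 0, 0) = (p, q, r)" by (metis prod_cases3)
  let ?w = "tmul v (p, q, r)"
  let ?t = "tmul ?w (p, q, r)"
  have w: "?w \<in> V" using inv[OF v(1)] theta_pow_tmul[of k v] b by simp
  have t: "?t \<in> V" using inv[OF w] theta_pow_tmul[of k ?w] b by simp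
  have "tnorm v \<noteq> 0" using tnorm_nonzero v(2) by (metis prod_cases3)
  moreover have "q^3 - q*r^2 - r^3 \<noteq> 0" using binary_form_nonzero theta_pow_not_int[OF k b] by blast
  ultimately have "det3 v ?w ?t \<noteq> 0" by (simp add: det3_powers)
  moreover have "tscale (det3 v ?w ?t) u \<in> V" for u
    unfolding cramer3[of v ?w ?t u] by (intro V v(1) w t)
  ultimately show ?thesis by blast
qed

section \<open>Free factors and their images in the abelianization\<close>

lemma F3_group: "group F3"
  unfolding F3_def by (rule free_group_group)

lemma F3_carrier: "w \<in> carrier F3 \<longleftrightarrow> fg_reduced w \<and> F3_word w"
  by (simp add: F3_def free_group_sel F3_word_def)

lemma ab_mult: "ab (u \<otimes>\<^bsub>F3\<^esub> v) = tadd (ab u) (ab v)"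
  by (simp add: F3_def free_group_sel ab_def tadd_def)

lemma ab_conj: "g \<in> carrier F3 \<Longrightarrow> ab (g \<otimes>\<^bsub>F3\<^esub> h \<otimes>\<^bsub>F3\<^esub> inv\<^bsub>F3\<^esub> g) = ab h"
  by (simp add: F3_def free_group_inv) (simp add: free_group_sel ab_def)

lemma ab_zero_iff:
  assumes "F3_word w" shows "ab w = (0, 0, 0) \<longleftrightarrow> (\<forall>i. cnt i w = 0)"
proof -
  have "cnt i w = 0" if "i \<notin> {0, 1, 2}" for i
    using assms that by (induction w) auto
  then have "cnt i w = 0" if "ab w = (0, 0, 0)" for i
    using that by (cases "i \<in> {0, 1, 2}") (auto simp: ab_def)
  moreover have "ab w = (0, 0, 0)" if "\<forall>i. cnt i w = 0" using that by (simp add: ab_def)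
  ultimately show ?thesis by blast
qed

lemma free_factor_ab:
  assumes "free_product_decomp F3 [A, B]" "A \<noteq> {\<one>\<^bsub>F3\<^esub>}"
  obtains a where "a \<in> A" "ab a \<noteq> (0, 0, 0)"
proof -
  have A: "subgroup A F3" using assms by (simp add: free_product_decomp_def)
  obtain \<rho> where \<rho>: "\<rho> \<in> hom F3 F3" "\<forall>x\<in>A. \<rho> x = x" "\<rho> ` carrier F3 \<subseteq> A"
    using free_product_retraction[OF F3_group assms(1)] by blast
  have sub: "A \<subseteq> carrier F3" using subgroup.subset[OF A] .
  have "\<not> A \<subseteq> {[]}" using assms(2) subgroup.one_closed[OF A] by (auto simp: F3_def free_group_sel)
  moreover have "A \<subseteq> {[]}" if zero: "\<And>a i. a \<in> A \<Longrightarrow> cnt i a = 0"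
  proof (rule retract_abelianization)
    show "\<rho> \<in> hom (free_group {0, 1, 2}) (free_group {0, 1, 2})" using \<rho>(1) unfolding F3_def .
    show "A \<subseteq> carrier (free_group {0, 1, 2})" using sub unfolding F3_def .
    fix w assume "w \<in> carrier (free_group {0, 1, 2 :: nat})"
    then show "\<rho> w \<in> A" using \<rho>(3) unfolding F3_def by blast
  qed (use \<rho>(2) zero in auto)
  ultimately obtain a i where a: "a \<in> A" "cnt i a \<noteq> 0" by blast
  then have "F3_word a" using sub F3_carrier by blast
  then show ?thesis using that[OF a(1)] a(2) ab_zero_iff by blast
qed

text \<open>The retraction onto \<open>B\<close> kills \<open>A\<close>, hence on the abelianization
  it kills every multiple of d, and so everything, because integers have no torsion. But it fixes a
  non-zero class coming from \<open>B\<close>.\<close>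

lemma free_factor_ab_rank:
  assumes d: "free_product_decomp F3 [A, B]" and proper: "A \<noteq> carrier F3"
    and full: "d \<noteq> 0" "\<And>u. \<exists>a\<in>A. ab a = tscale d u"
  shows False
proof -
  interpret F3: group F3 by (rule F3_group)
  have A: "subgroup A F3" and B: "subgroup B F3" and gen: "generate F3 (A \<union> B) = carrier F3"
    using d by (auto simp: free_product_decomp_def)
  have sub: "A \<subseteq> carrier F3" "B \<subseteq> carrier F3" using A B subgroup.subset by blast+
  have "B \<noteq> {\<one>\<^bsub>F3\<^esub>}"
  proof
    assume "B = {\<one>\<^bsub>F3\<^esub>}"
    then have "A \<union> B \<subseteq> A" using subgroup.one_closed[OF A] by auto
    then have "generate F3 (A \<union> B) \<subseteq> A" by (rule F3.generate_subgroup_incl[OF _ A])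
    then show False using gen proper sub by auto
  qed
  then obtain b where b: "b \<in> B" "ab b \<noteq> (0, 0, 0)"
    using free_factor_ab[OF free_product_decomp_swap[OF d]] by blast
  obtain a where a: "a \<in> A" "ab a = tscale d (ab b)" using full(2) by blast
  obtain \<rho> where \<rho>: "\<rho> \<in> hom F3 F3" "\<forall>x\<in>B. \<rho> x = x" "\<forall>x\<in>A. \<rho> x = \<one>\<^bsub>F3\<^esub>"
    using free_product_retraction[OF F3_group free_product_decomp_swap[OF d]] by blast
  have "cnt i b = 0" for i
  proof -
    define h where "h w = cnt i (\<rho> w)" for w
    have h: "h w = (\<Sum>j\<in>{0, 1, 2}. cnt j w * h [(j, False)])" if "w \<in> carrier F3" for w
    proof (rule additive_eq_sum_cnt)
      fix u v assume "u \<in> carrier (free_group {0, 1, 2 :: nat})" "v \<in> carrier (free_group {0, 1, 2 :: nat})"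
      then have "\<rho> (fg_norm (u @ v)) = fg_norm (\<rho> u @ \<rho> v)"
        using hom_mult[OF \<rho>(1), of u v] by (simp add: F3_def free_group_sel)
      then show "h (fg_norm (u @ v)) = h u + h v" by (simp add: h_def)
    qed (use that in \<open>auto simp: F3_def\<close>)
    have "h a = d * h b"
      using h[OF subsetD[OF sub(1) a(1)]] h[OF subsetD[OF sub(2) b(1)]] a(2)
      by (simp add: ab_def tscale_def distrib_left mult.assoc)
    moreover have "h a = 0" using \<rho>(3) a by (simp add: h_def F3_def free_group_sel)
    moreover have "h b = cnt i b" using \<rho>(2) b by (simp add: h_def)
    ultimately show ?thesis using full(1) by simp
  qed
  then show False using b(2) by (simp add: ab_def)
qed

theorem phi_pow_irreducible:
  assumes "k \<ge> 1" shows "irreducible_aut F3 (phi ^^ k)"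
  unfolding irreducible_aut_def
proof
  assume "reducible_aut F3 (phi ^^ k)"
  then obtain Rs where Rs: "Rs \<noteq> []" "\<forall>R\<in>set Rs. proper_free_factor F3 R"
    "\<forall>i<length Rs. \<exists>j<length Rs. conjugate_subgroups F3 ((phi ^^ k) ` (Rs ! i)) (Rs ! j)"
    "\<forall>i<length Rs. \<forall>j<length Rs. \<exists>m. conjugate_subgroups F3 (((phi ^^ k) ^^ m) ` (Rs ! i)) (Rs ! j)"
    unfolding reducible_aut_def by blast
  define A where "A = Rs ! 0"
  have pos: "0 < length Rs" using Rs(1) by simp
  have factor: "proper_free_factor F3 R" if "R \<in> set Rs" for R using Rs(2) that by blast
  have sub: "R \<subseteq> carrier F3" if "R \<in> set Rs" for R
    using factor[OF that] subgroup.subset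
    by (fastforce simp: proper_free_factor_def free_factor_def free_product_decomp_def)
  have move: "\<exists>b\<in>R'. ab b = (theta ^^ n) (ab a)"
    if c: "conjugate_subgroups F3 ((phi ^^ n) ` R) R'" and a: "a \<in> R" and R: "R \<in> set Rs" for n R R' a
  proof -
    obtain g where g: "g \<in> carrier F3" "R' = sg_conj F3 g ((phi ^^ n) ` R)"
      using c by (auto simp: conjugate_subgroups_def)
    have "g \<otimes>\<^bsub>F3\<^esub> (phi ^^ n) a \<otimes>\<^bsub>F3\<^esub> inv\<^bsub>F3\<^esub> g \<in> R'" using a g(2) by (auto simp: sg_conj_def)
    moreover have "F3_word a" using sub[OF R] a by (auto simp: F3_carrier)
    ultimately show ?thesis using ab_conj[OF g(1)] ab_phi_pow[of a n] by metis
  qed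
  \<comment> \<open>The exponent \<open>m\<close> that leads back to \<open>A\<close> may be 0.
    Starting the round trip with one application of \<open>phi ^^ k\<close> makes the total exponent
    of \<theta> positive.\<close>
  obtain j where j: "j < length Rs" "conjugate_subgroups F3 ((phi ^^ k) ` A) (Rs ! j)"
    using Rs(3) pos unfolding A_def by blast
  obtain m where m: "conjugate_subgroups F3 ((phi ^^ (k * m)) ` (Rs ! j)) A"
    using Rs(4) pos j(1) unfolding A_def funpow_mult by blast
  have AR: "A \<in> set Rs" using pos by (simp add: A_def)
  have inv: "(theta ^^ (k * m + k)) v \<in> ab ` A" if v: "v \<in> ab ` A" for v
  proof -
    obtain a where a: "a \<in> A" "v = ab a" using v by blast
    obtain b where b: "b \<in> Rs ! j" "ab b = (theta ^^ k) (ab a)" using move[OF j(2) a(1) AR] by blast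
    obtain c where "c \<in> A" "ab c = (theta ^^ (k * m)) (ab b)" using move[OF m b(1)] j(1) by auto
    then show ?thesis using a b by (simp add: funpow_add image_iff) metis
  qed
  obtain B where d: "free_product_decomp F3 [A, B]" and A: "A \<noteq> carrier F3" "A \<noteq> {\<one>\<^bsub>F3\<^esub>}"
    using factor[OF AR] by (auto simp: proper_free_factor_def free_factor_def)
  have sg: "subgroup A F3" using d by (simp add: free_product_decomp_def)
  have add: "tadd v w \<in> ab ` A" if vw: "v \<in> ab ` A" "w \<in> ab ` A" for v w
  proof -
    obtain a b where "a \<in> A" "v = ab a" "b \<in> A" "w = ab b" using vw by blast
    then show ?thesis using subgroup.m_closed[OF sg, of a b] ab_mult[of a b] by (metis imageI)
  qed
  have neg: "tscale (-1) v \<in> ab ` A" if v: "v \<in> ab ` A" for v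
  proof -
    obtain a where a: "a \<in> A" "v = ab a" using v by blast
    have "inv\<^bsub>F3\<^esub> a = fg_inv a" using sub[OF AR] a(1) by (auto simp: F3_def free_group_inv)
    then have "ab (inv\<^bsub>F3\<^esub> a) = tscale (-1) v" by (simp add: a(2) ab_def tscale_def)
    then show ?thesis using subgroup.m_inv_closed[OF sg a(1)] by (metis imageI)
  qed
  have nat: "tscale (int n) v \<in> ab ` A" if "v \<in> ab ` A" for v n
  proof (induction n)
    case 0
    have "ab \<one>\<^bsub>F3\<^esub> = tscale 0 v" by (cases v) (simp add: F3_def free_group_sel ab_def tscale_def)
    then show ?case using subgroup.one_closed[OF sg] by (metis imageI of_nat_0)
  next
    case (Suc n)
    have "tscale (int (Suc n)) v = tadd v (tscale (int n) v)"
      by (cases v) (simp add: tadd_def tscale_def algebra_simps)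
    then show ?case using add[OF that Suc.IH] by simp
  qed
  have scale: "tscale n v \<in> ab ` A" if "v \<in> ab ` A" for v n
  proof (cases "n \<ge> 0")
    case True
    then show ?thesis using nat[OF that, of "nat n"] by simp
  next
    case False
    then have "tscale n v = tscale (-1) (tscale (int (nat (- n))) v)" by (cases v) (simp add: tscale_def)
    then show ?thesis using neg[OF nat[OF that]] by (simp only:)
  qed
  obtain a where a: "a \<in> A" "ab a \<noteq> (0, 0, 0)" using free_factor_ab[OF d A(2)] .
  have "k * m + k \<ge> 1" using assms by simp
  from invariant_lattice_full_rank[OF add scale inv this imageI[OF a(1)] a(2)]
  obtain d' where "d' \<noteq> 0" "\<forall>u. tscale d' u \<in> ab ` A" by blast
  then show False using free_factor_ab_rank[OF d A(1), of d'] by (metis imageE)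
qed

theorem theorem3p2:
  shows "word_hyperbolic Gamma \<and> large Gamma \<and> (\<forall>k\<ge>1. irreducible_aut F3 (phi ^^ k))"
  using Gamma_hyperbolic Gamma_large phi_pow_irreducible by blast

end
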